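(* Let $Y^{n}=(Y_{1},\ldots,Y_{n})$ with $Y_{i}\overset{\mathrm{iid}}{\sim}\mathbb{P}_{\theta}\in\mathcal{P}_{\Theta}$, where $\mathcal{P}_{\Theta}$ is an identifiable family of distributions that is Laplace-regular (definition in the context). In particular $\mathcal{P}_{\Theta}$ admits densities $f(y^{n}\mid\theta)$ with respect to Lebesgue measure that are six times continuously differentiable in $\theta$ at the data-governing parameter $\theta\in\Theta\subset\mathbb{R}^{p}$, with $\Theta$ open with non-empty interior. Assume that the prior densities $\pi(\theta\mid\mathcal{H}_{\widetilde{0}})$ and $\pi(\theta\mid\mathcal{H}_{1})$ on $\Theta$ assign positive mass to a neighborhood at the data-governing parameter $\theta$ and are four times continuously differentiable at $\theta$. Let $\dot v(\theta)\in\mathbb{R}^{p}$ and $\ddot v(\theta)\in\mathbb{R}^{p\times p}$ be the gradient and the Hessian matrix at $\theta$ of $\log\big(\tfrac{\pi(\theta\mid\mathcal{H}_{1})}{\pi(\theta\mid\mathcal{H}_{\widetilde{0}})}\big)$, let $I(\theta)$ be the Fisher information matrix, and let $$E(\theta,n)=\log\left(\frac{1+C^{1}(\theta\mid\mathcal{H}_{1})/n+C^{2}(\theta\mid\mathcal{H}_{1})/n^{2}}{1+C^{1}(\theta\mid\mathcal{H}_{\widetilde{0}})/n+C^{2}(\theta\mid\mathcal{H}_{\widetilde{0}})/n^{2}}\right),$$ where $C^{1},C^{2}$ are given in the context. (1) For all data-governing parameters $\theta$ with $\dot v(\theta)\neq 0$, as $n\to\infty$, $$\sqrt{n}\Big(\log\mathrm{BF}_{1\widetilde{0}}(Y^{n})-\log\big(\tfrac{\pi(\theta\mid\mathcal{H}_{1})}{\pi(\theta\mid\mathcal{H}_{\widetilde{0}})}\big)-E(\theta,n)\Big)\overset{\mathbb{P}_{\theta}}{\rightsquigarrow}\mathcal{N}\big(0,\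 \dot v(\theta)^{T}I^{-1}(\theta)\dot v(\theta)\big),$$ and the bias term $E(\theta,n)$ is asymptotically negligible. (2) For all $\theta$ with $\dot v(\theta)=0$ but $\ddot v(\theta)\neq 0$, as $n\to\infty$, $$n\Big(\log\mathrm{BF}_{1\widetilde{0}}(Y^{n})-\log\big(\tfrac{\pi(\theta\mid\mathcal{H}_{1})}{\pi(\theta\mid\mathcal{H}_{\widetilde{0}})}\big)-E(\theta,n)\Big)\overset{\mathbb{P}_{\theta}}{\rightsquigarrow}\tfrac{1}{2}\,Z^{T}I^{-1/2}(\theta)\,\ddot v(\theta)\,I^{-1/2}(\theta)Z,$$ where $Z\sim\mathcal{N}(0,I)$ with $I\in\mathbb{R}^{p\times p}$ the identity matrix.
   Context: The alternative hypothesis $\mathcal{H}_{1}$ and the peri-null hypothesis $\mathcal{H}_{\widetilde{0}}$ use the same parameter space $\Theta\subset\mathbb{R}^{p}$ and the same likelihood $f(y^{n}\mid\theta)=\prod_{i=1}^{n}f(y_{i}\mid\theta)$; they differ only in their prior densities $\pi(\cdot\mid\mathcal{H}_{1})$ and $\pi(\cdot\mid\mathcal{H}_{\widetilde{0}})$ on $\Theta$. The marginal likelihoods are $p(y^{n}\mid\mathcal{H}_{j})=\int_{\Theta}f(y^{n}\mid\theta)\,\pi(\theta\mid\mathcal{H}_{j})\,\mathrm{d}\theta$ for $j\in\{\widetilde{0},1\}$, and the peri-null Bayes factor is $\mathrm{BF}_{1\widetilde{0}}(y^{n})=p(y^{n}\mid\mathcal{H}_{1})/p(y^{n}\mid\mathcal{H}_{\widetilde{0}})$.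 The symbol $\overset{\mathbb{P}_{\theta}}{\rightsquigarrow}$ denotes convergence in distribution under $\mathbb{P}_{\theta}$. "Asymptotically negligible" means $E(\theta,n)\to 0$ at a rate making it irrelevant at scale $\sqrt n$, i.e. $\sqrt{n}\,E(\theta,n)\to 0$. Laplace-regular (in the sense of Kass, Tierney and Kadane, 1990): write $\ell_{n}(\theta)=\sum_{i=1}^{n}\log f(Y_{i}\mid\theta)$. The family is Laplace-regular if $\ell_{n}$ is six times continuously differentiable on $\Theta$ and for every $\theta_{0}\in\Theta$ there exist $\varepsilon,M,\eta>0$ with $B_{\varepsilon}(\theta_{0})\subset\Theta$ (open ball) such that, with $\mathbb{P}_{\theta_{0}}$-probability one: (i) $\limsup_{n}\sup_{\theta\in B_{\varepsilon}(\theta_{0})}n^{-1}|\partial_{j_{1}\cdots j_{d}}\ell_{n}(\theta)|<M$ for all $0\le d\le 6$ and $1\le j_{1},\ldots,j_{d}\le p$; (ii) $\liminf_{n}\inf_{\theta\in B_{\varepsilon}(\theta_{0})}\det(-n^{-1}D^{2}\ell_{n}(\theta))>\eta$; (iii) for every $\delta>0$ with $B_{\delta}(\theta_{0})\subset\Theta$, $\limsup_{n}\sup_{\theta\in\Theta\setminus B_{\delta}(\theta_{0})}n^{-1}[\ell_{n}(\theta)-\ell_{n}(\theta_{0})]<0$. Such models are regular: the maximum likelihood estimator $\hat\theta$ is consistent and $\sqrt{n}(\hat\theta-\theta)\overset{\mathbb{P}_{\theta}}{\rightsquigarrow}\mathcal{N}(0,I^{-1}(\theta))$ with $I(\theta)$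 non-degenerate. Definition of $C^{1}(\theta\mid\mathcal{H}_{j})$ and $C^{2}(\theta\mid\mathcal{H}_{j})$. Write $\pi=\pi(\cdot\mid\mathcal{H}_{j})$. Subscripts denote partial derivatives at $\theta$: $\pi_{a}=\partial_{\theta_{a}}\pi(\theta)$, $\pi_{ab}=\partial_{\theta_{a}}\partial_{\theta_{b}}\pi(\theta)$, etc., and $h_{a_{1}\cdots a_{k}}$ is the expected value under $\mathbb{P}_{\theta}$ of $-\partial_{\theta_{a_{1}}}\cdots\partial_{\theta_{a_{k}}}\log f(Y_{1}\mid\theta)$. Let $Q\sim\mathcal{N}_{p}(0,I(\theta)^{-1})$ and let $\varsigma^{a_{1}\cdots a_{w}}=\mathrm{E}[Q^{a_{1}}\cdots Q^{a_{w}}]$. With Einstein's convention (indices repeated in sub- and superscript are summed over $1,\ldots,p$), $$C^{1}=\tfrac{\pi_{ab}}{2\pi(\theta)}\varsigma^{ab}-\Big(\tfrac{h_{abcd}}{24}+\tfrac{h_{abc}\pi_{d}}{6\pi(\theta)}\Big)\varsigma^{abcd}+\tfrac{h_{abc}h_{def}}{72}\varsigma^{abcdef},$$ $$\begin{aligned}C^{2}=\ &\tfrac{\pi_{abcd}}{24\pi(\theta)}\varsigma^{abcd}-\tfrac{\pi(\theta)h_{abcdef}+6h_{abcde}\pi_{f}+15h_{abcd}\pi_{ef}+20h_{abc}\pi_{def}}{720\pi(\theta)}\varsigma^{abcdef}\\&+\tfrac{5\pi(\theta)h_{abcd}h_{efgh}+8\pi(\theta)h_{abcde}h_{fgh}+40h_{abc}(h_{defg}\pi_{h}+h_{def}\pi_{gh})}{5760\pi(\theta)}\varsigma^{abcdefgh}\\&-\tfrac{3\pi(\theta)h_{abcd}h_{efg}h_{hij}+4h_{abc}h_{def}h_{ghi}\pi_{j}}{5184\pi(\theta)}\varsigma^{abcdefghij}+\tfrac{h_{abc}h_{def}h_{ghi}h_{jkl}}{31104}\varsigma^{abcdefghijkl}.\end{aligned}$$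 *)

theory Defs
  imports "HOL-Probability.Probability"
begin

section \<open>Partial derivatives\<close>

text \<open>\<open>partials [a, b, \<dots>] g\<close> is the iterated partial derivative
  \<open>\<partial>\<^sub>a \<partial>\<^sub>b \<dots> g\<close>.\<close>

primrec partials :: "'p list \<Rightarrow> (real^'p \<Rightarrow> real) \<Rightarrow> real^'p \<Rightarrow> real" where
  "partials [] g = g"
| "partials (a # as) g = (\<lambda>x. deriv (\<lambda>t. partials as g (x + t *\<^sub>R axis a 1)) 0)"

text \<open>\<open>g\<close> is \<open>k\<close> times continuously differentiable on \<open>U\<close> (meant for open \<open>U\<close>): all partial
  derivatives of order up to \<open>k\<close> exist and are continuous. Existence must be required
  separately because \<^const>\<open>deriv\<close> is total.\<close>

definition Ck_on :: "nat \<Rightarrow> (real^'p \<Rightarrow> real) \<Rightarrow> (real^'p) set \<Rightarrow> bool" where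
  "Ck_on k g U \<longleftrightarrow>
     (\<forall>as a. length as < k \<longrightarrow>
        (\<forall>x\<in>U. (\<lambda>t. partials as g (x + t *\<^sub>R axis a 1)) field_differentiable at 0)) \<and>
     (\<forall>as. length as \<le> k \<longrightarrow> continuous_on U (partials as g))"

definition Ck_at :: "nat \<Rightarrow> (real^'p \<Rightarrow> real) \<Rightarrow> real^'p \<Rightarrow> bool" where
  "Ck_at k g x \<longleftrightarrow> (\<exists>U. open U \<and> x \<in> U \<and> Ck_on k g U)"

definition grad :: "(real^'p \<Rightarrow> real) \<Rightarrow> real^'p \<Rightarrow> real^'p" where
  "grad g x = (\<chi> a. partials [a] g x)"

definition hessian :: "(real^'p \<Rightarrow> real) \<Rightarrow> real^'p \<Rightarrow> real^'p^'p" where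
  "hessian g x = (\<chi> a b. partials [a, b] g x)"


section \<open>Multivariate normal law and convergence of random vectors\<close>

text \<open>The law \<open>\<N>(0, \<Sigma>)\<close> for a positive definite covariance matrix \<open>\<Sigma>\<close>.\<close>

definition mvn :: "real^'p^'p \<Rightarrow> (real^'p) measure" where
  "mvn \<Sigma> = density lborel
     (\<lambda>x. ennreal (exp (- (x \<bullet> (matrix_inv \<Sigma> *v x)) / 2) / sqrt ((2 * pi) ^ CARD('p) * det \<Sigma>)))"

text \<open>The positive semidefinite symmetric square root (unique if it exists).\<close>

definition psd_sqrt :: "real^'p^'p \<Rightarrow> real^'p^'p" where
  "psd_sqrt A = (SOME S. transpose S = S \<and> (\<forall>x. 0 \<le> x \<bullet> (S *v x)) \<and> S ** S = A)"

text \<open>The library's \<^const>\<open>weak_conv_m\<close> is restricted to real-valued random variables.\<close>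

definition converges_in_dist ::
  "'s measure \<Rightarrow> (nat \<Rightarrow> 's \<Rightarrow> 'b::euclidean_space) \<Rightarrow> 'b measure \<Rightarrow> bool" where
  "converges_in_dist M X \<mu> \<longleftrightarrow>
     (\<forall>g :: 'b \<Rightarrow> real. continuous_on UNIV g \<and> bounded (range g) \<longrightarrow>
        (\<lambda>n. LINT \<omega>|M. g (X n \<omega>)) \<longlonglongrightarrow> (LINT x|\<mu>. g x))"

definition converges_in_prob ::
  "'s measure \<Rightarrow> (nat \<Rightarrow> 's \<Rightarrow> 'b::euclidean_space) \<Rightarrow> 'b \<Rightarrow> bool" where
  "converges_in_prob M X c \<longleftrightarrow>
     (\<forall>e>0. (\<lambda>n. measure M {\<omega> \<in> space M. e < dist (X n \<omega>) c}) \<longlonglongrightarrow> 0)"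


section \<open>The statistical model\<close>

text \<open>\<open>f \<theta> y\<close> is the density of a single observation. A point \<open>\<omega>\<close> of the sample space is the
  whole sequence of observations; \<open>Y\<^sub>1, \<dots>, Y\<^sub>n\<close> are its entries \<open>\<omega> 0, \<dots>, \<omega> (n - 1)\<close>, and they
  are i.i.d. under \<open>sample_law f \<theta>\<close>.\<close>

definition obs_law :: "(real^'p \<Rightarrow> 'y::euclidean_space \<Rightarrow> real) \<Rightarrow> real^'p \<Rightarrow> 'y measure" where
  "obs_law f \<theta> = density lborel (\<lambda>y. ennreal (f \<theta> y))"

definition sample_law ::
  "(real^'p \<Rightarrow> 'y::euclidean_space \<Rightarrow> real) \<Rightarrow> real^'p \<Rightarrow> (nat \<Rightarrow> 'y) measure" where
  "sample_law f \<theta> = PiM UNIV (\<lambda>_. obs_law f \<theta>)"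

definition density_family ::
  "(real^'p) set \<Rightarrow> (real^'p \<Rightarrow> 'y::euclidean_space \<Rightarrow> real) \<Rightarrow> bool" where
  "density_family \<Theta> f \<longleftrightarrow>
     (\<forall>\<theta>\<in>\<Theta>. f \<theta> \<in> borel_measurable borel \<and> (\<forall>y. 0 \<le> f \<theta> y) \<and> prob_space (obs_law f \<theta>))"

definition identifiable ::
  "(real^'p) set \<Rightarrow> (real^'p \<Rightarrow> 'y::euclidean_space \<Rightarrow> real) \<Rightarrow> bool" where
  "identifiable \<Theta> f \<longleftrightarrow> inj_on (obs_law f) \<Theta>"

definition likelihood ::
  "(real^'p \<Rightarrow> 'y \<Rightarrow> real) \<Rightarrow> (nat \<Rightarrow> 'y) \<Rightarrow> nat \<Rightarrow> real^'p \<Rightarrow> real" where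
  "likelihood f \<omega> n \<theta> = (\<Prod>i<n. f \<theta> (\<omega> i))"

definition loglik ::
  "(real^'p \<Rightarrow> 'y \<Rightarrow> real) \<Rightarrow> (nat \<Rightarrow> 'y) \<Rightarrow> nat \<Rightarrow> real^'p \<Rightarrow> real" where
  "loglik f \<omega> n \<theta> = (\<Sum>i<n. ln (f \<theta> (\<omega> i)))"

text \<open>The expected derivatives \<open>h\<^sub>a\<^sub>b\<^sub>\<dots>\<close> of \<open>- log f\<close> at \<open>\<theta>\<close>.\<close>

definition exp_nld ::
  "(real^'p \<Rightarrow> 'y::euclidean_space \<Rightarrow> real) \<Rightarrow> real^'p \<Rightarrow> 'p list \<Rightarrow> real" where
  "exp_nld f \<theta> as = (LINT y|obs_law f \<theta>. - partials as (\<lambda>u. ln (f u y)) \<theta>)"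

definition fisher_info ::
  "(real^'p \<Rightarrow> 'y::euclidean_space \<Rightarrow> real) \<Rightarrow> real^'p \<Rightarrow> real^'p^'p" where
  "fisher_info f \<theta> = (\<chi> a b. exp_nld f \<theta> [a, b])"


section \<open>Laplace-regular families\<close>

text \<open>The log-likelihood must be finite on all of \<open>\<Theta>\<close> for every possible sample. Since
  \<open>ln 0 = 0\<close> in the library, this is made explicit by requiring that all densities of the family
  are positive on the same set of observations.\<close>

definition obs_support :: "(real^'p) set \<Rightarrow> (real^'p \<Rightarrow> 'y \<Rightarrow> real) \<Rightarrow> 'y set" where
  "obs_support \<Theta> f = {y. \<exists>\<theta>\<in>\<Theta>. 0 < f \<theta> y}"

definition smooth_loglik :: "(real^'p) set \<Rightarrow> (real^'p \<Rightarrow> 'y \<Rightarrow> real) \<Rightarrow> bool" where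
  "smooth_loglik \<Theta> f \<longleftrightarrow>
     (\<forall>\<theta>\<in>\<Theta>. \<forall>y\<in>obs_support \<Theta> f. 0 < f \<theta> y) \<and>
     (\<forall>\<omega> n. (\<forall>i<n. \<omega> i \<in> obs_support \<Theta> f) \<longrightarrow> Ck_on 6 (loglik f \<omega> n) \<Theta>)"

definition laplace_regular ::
  "(real^'p) set \<Rightarrow> (real^'p \<Rightarrow> 'y::euclidean_space \<Rightarrow> real) \<Rightarrow> bool" where
  "laplace_regular \<Theta> f \<longleftrightarrow>
     smooth_loglik \<Theta> f \<and>
     (\<forall>\<theta>\<^sub>0\<in>\<Theta>. \<exists>\<epsilon>>0. \<exists>M>0. \<exists>\<eta>>0. ball \<theta>\<^sub>0 \<epsilon> \<subseteq> \<Theta> \<and>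
        (AE \<omega> in sample_law f \<theta>\<^sub>0.
           (\<forall>js. length js \<le> 6 \<longrightarrow>
              limsup (\<lambda>n. SUP \<theta>\<in>ball \<theta>\<^sub>0 \<epsilon>.
                ereal (\<bar>partials js (loglik f \<omega> n) \<theta>\<bar> / real n)) < ereal M) \<and>
           ereal \<eta> < liminf (\<lambda>n. INF \<theta>\<in>ball \<theta>\<^sub>0 \<epsilon>.
                ereal (det ((- 1 / real n) *\<^sub>R hessian (loglik f \<omega> n) \<theta>))) \<and>
           (\<forall>\<delta>>0. ball \<theta>\<^sub>0 \<delta> \<subseteq> \<Theta> \<longrightarrow>
              limsup (\<lambda>n. SUP \<theta>\<in>\<Theta> - ball \<theta>\<^sub>0 \<delta>.
                ereal ((loglik f \<omega> n \<theta> - loglik f \<omega> n \<theta>\<^sub>0) / real n)) < 0)))"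

text \<open>Regularity of the maximum likelihood estimator: non-degenerate information, consistency and
  asymptotic normality. The maximiser is only required to exist for all sufficiently large
  sample sizes, almost surely.\<close>

definition is_mle ::
  "(real^'p) set \<Rightarrow> (real^'p \<Rightarrow> 'y::euclidean_space \<Rightarrow> real) \<Rightarrow> real^'p \<Rightarrow>
   (nat \<Rightarrow> (nat \<Rightarrow> 'y) \<Rightarrow> real^'p) \<Rightarrow> bool" where
  "is_mle \<Theta> f \<theta> T \<longleftrightarrow>
     (\<forall>n. T n \<in> borel_measurable (sample_law f \<theta>)) \<and>
     (AE \<omega> in sample_law f \<theta>. \<forall>\<^sub>F n in sequentially.
        T n \<omega> \<in> \<Theta> \<and> (\<forall>u\<in>\<Theta>. loglik f \<omega> n u \<le> loglik f \<omega> n (T n \<omega>)))"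

definition regular_family ::
  "(real^'p) set \<Rightarrow> (real^'p \<Rightarrow> 'y::euclidean_space \<Rightarrow> real) \<Rightarrow> bool" where
  "regular_family \<Theta> f \<longleftrightarrow>
     (\<forall>\<theta>\<in>\<Theta>. invertible (fisher_info f \<theta>) \<and>
        (\<exists>T. is_mle \<Theta> f \<theta> T \<and>
             converges_in_prob (sample_law f \<theta>) T \<theta> \<and>
             converges_in_dist (sample_law f \<theta>)
               (\<lambda>n \<omega>. sqrt (real n) *\<^sub>R (T n \<omega> - \<theta>)) (mvn (matrix_inv (fisher_info f \<theta>)))))"


section \<open>Priors and the peri-null Bayes factor\<close>

definition prior_density :: "(real^'p) set \<Rightarrow> (real^'p \<Rightarrow> real) \<Rightarrow> bool" where
  "prior_density \<Theta> \<pi> \<longleftrightarrow>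
     (\<forall>\<theta>\<in>\<Theta>. 0 \<le> \<pi> \<theta>) \<and> set_integrable lborel \<Theta> \<pi> \<and> (LINT \<theta>:\<Theta>|lborel. \<pi> \<theta>) = 1"

definition marginal_likelihood ::
  "(real^'p) set \<Rightarrow> (real^'p \<Rightarrow> 'y \<Rightarrow> real) \<Rightarrow> (real^'p \<Rightarrow> real) \<Rightarrow> (nat \<Rightarrow> 'y) \<Rightarrow> nat \<Rightarrow> real" where
  "marginal_likelihood \<Theta> f \<pi> \<omega> n = (LINT \<theta>:\<Theta>|lborel. likelihood f \<omega> n \<theta> * \<pi> \<theta>)"

definition bayes_factor ::
  "(real^'p) set \<Rightarrow> (real^'p \<Rightarrow> 'y \<Rightarrow> real) \<Rightarrow> (real^'p \<Rightarrow> real) \<Rightarrow> (real^'p \<Rightarrow> real) \<Rightarrow>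
   (nat \<Rightarrow> 'y) \<Rightarrow> nat \<Rightarrow> real" where
  "bayes_factor \<Theta> f \<pi>\<^sub>1 \<pi>\<^sub>0 \<omega> n =
     marginal_likelihood \<Theta> f \<pi>\<^sub>1 \<omega> n / marginal_likelihood \<Theta> f \<pi>\<^sub>0 \<omega> n"


section \<open>The bias term\<close>

text \<open>The moments \<open>E[Q\<^sup>a Q\<^sup>b \<dots>]\<close> of \<open>Q \<sim> \<N>(0, I(\<theta>)\<^sup>-\<^sup>1)\<close>.\<close>

definition mvn_moment ::
  "(real^'p \<Rightarrow> 'y::euclidean_space \<Rightarrow> real) \<Rightarrow> real^'p \<Rightarrow> 'p list \<Rightarrow> real" where
  "mvn_moment f \<theta> as =
     (LINT q|mvn (matrix_inv (fisher_info f \<theta>)). prod_list (map (\<lambda>a. q $ a) as))"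

definition C1 ::
  "(real^'p \<Rightarrow> 'y::euclidean_space \<Rightarrow> real) \<Rightarrow> (real^'p \<Rightarrow> real) \<Rightarrow> real^'p \<Rightarrow> real" where
  "C1 f \<pi> \<theta> =
     (let h = exp_nld f \<theta>; s = mvn_moment f \<theta>; D = (\<lambda>as. partials as \<pi> \<theta>); p = \<pi> \<theta> in
        (\<Sum>(a,b)\<in>UNIV. D [a,b] / (2 * p) * s [a,b])
      - (\<Sum>(a,b,c,d)\<in>UNIV. (h [a,b,c,d] / 24 + h [a,b,c] * D [d] / (6 * p)) * s [a,b,c,d])
      + (\<Sum>(a,b,c,d,e,g)\<in>UNIV. h [a,b,c] * h [d,e,g] / 72 * s [a,b,c,d,e,g]))"

definition C2 ::
  "(real^'p \<Rightarrow> 'y::euclidean_space \<Rightarrow> real) \<Rightarrow> (real^'p \<Rightarrow> real) \<Rightarrow> real^'p \<Rightarrow> real" where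
  "C2 f \<pi> \<theta> =
     (let h = exp_nld f \<theta>; s = mvn_moment f \<theta>; D = (\<lambda>as. partials as \<pi> \<theta>); p = \<pi> \<theta> in
        (\<Sum>(a,b,c,d)\<in>UNIV. D [a,b,c,d] / (24 * p) * s [a,b,c,d])
      - (\<Sum>(a1,a2,a3,a4,a5,a6)\<in>UNIV.
           (p * h [a1,a2,a3,a4,a5,a6] + 6 * h [a1,a2,a3,a4,a5] * D [a6]
             + 15 * h [a1,a2,a3,a4] * D [a5,a6] + 20 * h [a1,a2,a3] * D [a4,a5,a6]) / (720 * p)
           * s [a1,a2,a3,a4,a5,a6])
      + (\<Sum>(a1,a2,a3,a4,a5,a6,a7,a8)\<in>UNIV.
           (5 * p * h [a1,a2,a3,a4] * h [a5,a6,a7,a8] + 8 * p * h [a1,a2,a3,a4,a5] * h [a6,a7,a8]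
             + 40 * h [a1,a2,a3] * (h [a4,a5,a6,a7] * D [a8] + h [a4,a5,a6] * D [a7,a8])) / (5760 * p)
           * s [a1,a2,a3,a4,a5,a6,a7,a8])
      - (\<Sum>(a1,a2,a3,a4,a5,a6,a7,a8,a9,a10)\<in>UNIV.
           (3 * p * h [a1,a2,a3,a4] * h [a5,a6,a7] * h [a8,a9,a10]
             + 4 * h [a1,a2,a3] * h [a4,a5,a6] * h [a7,a8,a9] * D [a10]) / (5184 * p)
           * s [a1,a2,a3,a4,a5,a6,a7,a8,a9,a10])
      + (\<Sum>(a1,a2,a3,a4,a5,a6,a7,a8,a9,a10,a11,a12)\<in>UNIV.
           h [a1,a2,a3] * h [a4,a5,a6] * h [a7,a8,a9] * h [a10,a11,a12] / 31104
           * s [a1,a2,a3,a4,a5,a6,a7,a8,a9,a10,a11,a12]))"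

definition bias_term ::
  "(real^'p \<Rightarrow> 'y::euclidean_space \<Rightarrow> real) \<Rightarrow> (real^'p \<Rightarrow> real) \<Rightarrow> (real^'p \<Rightarrow> real) \<Rightarrow>
   real^'p \<Rightarrow> nat \<Rightarrow> real" where
  "bias_term f \<pi>\<^sub>1 \<pi>\<^sub>0 \<theta> n =
     ln ((1 + C1 f \<pi>\<^sub>1 \<theta> / real n + C2 f \<pi>\<^sub>1 \<theta> / (real n)\<^sup>2) /
         (1 + C1 f \<pi>\<^sub>0 \<theta> / real n + C2 f \<pi>\<^sub>0 \<theta> / (real n)\<^sup>2))"

definition log_prior_ratio :: "(real^'p \<Rightarrow> real) \<Rightarrow> (real^'p \<Rightarrow> real) \<Rightarrow> real^'p \<Rightarrow> real" where
  "log_prior_ratio \<pi>\<^sub>1 \<pi>\<^sub>0 \<theta> = ln (\<pi>\<^sub>1 \<theta> / \<pi>\<^sub>0 \<theta>)"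

text \<open>The centred log Bayes factor \<open>log BF - log (\<pi>\<^sub>1 / \<pi>\<^sub>0) - E(\<theta>, n)\<close>.\<close>

definition centred_log_bf ::
  "(real^'p) set \<Rightarrow> (real^'p \<Rightarrow> 'y::euclidean_space \<Rightarrow> real) \<Rightarrow> (real^'p \<Rightarrow> real) \<Rightarrow>
   (real^'p \<Rightarrow> real) \<Rightarrow> real^'p \<Rightarrow> nat \<Rightarrow> (nat \<Rightarrow> 'y) \<Rightarrow> real" where
  "centred_log_bf \<Theta> f \<pi>\<^sub>1 \<pi>\<^sub>0 \<theta> n \<omega> =
     ln (bayes_factor \<Theta> f \<pi>\<^sub>1 \<pi>\<^sub>0 \<omega> n) - log_prior_ratio \<pi>\<^sub>1 \<pi>\<^sub>0 \<theta> - bias_term f \<pi>\<^sub>1 \<pi>\<^sub>0 \<theta> n"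

end

theory Submission
  imports Defs
begin

text \<open>
  Put \<open>r = \<pi>\<^sub>1(\<theta>) / \<pi>\<^sub>0(\<theta>)\<close> and \<open>q = \<pi>\<^sub>1 - r
  \<pi>\<^sub>0\<close>, so that, with the maximum likelihood estimator \<open>T\<close>, the difference
  \<open>BF - r\<close> is the quotient of the integrals of \<open>exp (\<ell>\<^sub>n - \<ell>\<^sub>n(T)) q\<close> and \<open>exp
  (\<ell>\<^sub>n - \<ell>\<^sub>n(T)) \<pi>\<^sub>0\<close>. Near \<open>\<theta>\<close> the function
  \<open>q\<close> equals \<open>R(u - \<theta>)\<close> up to smaller terms, where \<open>R\<close> is
  homogeneous of degree \<open>d = 1\<close> (gradient of the log prior ratio nonzero) or \<open>d = 2\<close>
  (gradient zero). Substituting \<open>u = T + x / \<surd>n\<close> and writing \<open>w = \<surd>n (T -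
  \<theta>)\<close>, both integrals converge by dominated convergence to Gaussian integrals, the numerator to
  that of \<open>R(w + x)\<close> after scaling by \<open>n\<^bsup>d/2\<^esup>\<close>. All errors are bounded
  relative to \<open>1 + |w|\<^sup>d\<close>, which is harmless because \<open>w\<close> is tight. Only this
  first-order Laplace expansion is needed: for \<open>d = 1\<close> the bias is negligible at scale
  \<open>\<surd>n\<close>, and for \<open>d = 2\<close> the terms of \<open>C\<^sup>1\<close> that involve
  third and fourth derivatives of the likelihood cancel in the difference for the two priors, leaving half the
  trace of \<open>H J\<close>, which is the Gaussian expectation of \<open>\<onehalf> x \<bullet> H x\<close>.

  The convergence of the observed to the expected information is a weak law of large numbers; the required
  integrability is extracted from the almost sure bounds in Laplace regularity by the converse of the strong
  law. It holds in \<open>L\<^sup>1\<close>, hence almost surely along subsequences, and on each such sample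
  the Laplace argument is deterministic.
\<close>

section \<open>Partial derivatives and Taylor expansions\<close>

text \<open>Expanding each marginal likelihood separately would not do with a first-order argument:
  at scale n the relative 1/n terms survive, with third and fourth derivatives of the
  log-likelihood. They multiply the value and the gradient of the prior at \<theta>, and for d = 2
  both vanish for \<open>q\<close>. On a single sample w need not stay bounded. Hence the expansion
  is a difference that tends to 0 after division by 1 + |w|^d, and tightness enters only in the
  passage to the limit in law. Nothing in \<open>mvn\<close> forces unit mass or a definite matrix.
  Mass one is read off from the assumed convergence of the estimator by testing with the constant 1;
  symmetry and positivity of the information are inherited in the limit from the observed
  log-likelihoods. The Jacobian of a linear substitution is then fixed by comparing total
  masses.\<close>

lemma partial_has_derivative:
  assumes "Ck_on k g U" "x + s *\<^sub>R axis a 1 \<in> U" "length as < k"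
  shows "((\<lambda>t. partials as g (x + t *\<^sub>R axis a 1)) has_real_derivative
           partials (a # as) g (x + s *\<^sub>R axis a 1)) (at s)"
proof -
  \<comment> \<open>\<open>Ck_on\<close> asserts differentiability along a line only at parameter 0,
    so the line is re-based at the point with parameter s.\<close>
  let ?y = "x + s *\<^sub>R axis a 1"
  have "(\<lambda>t. partials as g (?y + t *\<^sub>R axis a 1)) field_differentiable at 0"
    using assms unfolding Ck_on_def by blast
  then have "((\<lambda>t. partials as g (?y + t *\<^sub>R axis a 1)) has_real_derivative
      partials (a # as) g ?y) (at (s - s))"
    by (simp add: DERIV_deriv_iff_field_differentiable)
  then have "((\<lambda>t. partials as g (?y + (t - s) *\<^sub>R axis a 1)) has_real_derivative
      partials (a # as) g ?y * 1) (at s)"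
    by (intro DERIV_chain2[where g = "\<lambda>t. t - s"]) (auto intro!: derivative_eq_intros)
  then show ?thesis
    by (simp add: algebra_simps)
qed

text \<open>The coordinates of the increment are switched on one at a time. Each switch is a
  one-dimensional increment, controlled by the mean value inequality, and every intermediate point
  stays in a ball where the partial derivatives are nearly those at x.\<close>

lemma has_derivative_from_partials:
  fixes F :: "real^'p \<Rightarrow> real"
  assumes "open U" "x \<in> U"
    and deriv: "\<And>y s a. y + s *\<^sub>R axis a 1 \<in> U \<Longrightarrow>
      ((\<lambda>t. F (y + t *\<^sub>R axis a 1)) has_real_derivative G a (y + s *\<^sub>R axis a 1)) (at s)"
    and cont: "\<And>a. continuous_on U (G a)"
  shows "(F has_derivative (\<lambda>h. \<Sum>a\<in>UNIV. h $ a * G a x)) (at x)"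
  unfolding has_derivative_at_alt
proof (intro conjI allI impI)
  show "bounded_linear (\<lambda>h. \<Sum>a\<in>UNIV. h $ a * G a x)"
    by (intro bounded_linear_sum bounded_linear_mult_const bounded_linear_vec_nth)
  fix e :: real assume "0 < e"
  \<comment> \<open>Each of the p coordinates contributes an error of at most e' times the norm of
    h.\<close>
  define e' where "e' = e / real CARD('p)"
  have "e' > 0" using \<open>0 < e\<close> by (simp add: e'_def)
  have "\<exists>d>0. ball x d \<subseteq> U \<and> (\<forall>y\<in>ball x d. \<bar>G a y - G a x\<bar> \<le> e')" for a
  proof -
    obtain r where r: "r > 0" "ball x r \<subseteq> U" using assms(1,2) openE by blast
    obtain s where s: "s > 0" "\<And>y. y \<in> U \<Longrightarrow> dist y x < s \<Longrightarrow> dist (G a y) (G a x) < e'"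
      using cont[of a] assms(2) \<open>e' > 0\<close> unfolding continuous_on_iff by meson
    have "\<bar>G a y - G a x\<bar> \<le> e'" if "y \<in> ball x (min r s)" for y
      using s(2)[of y] r that by (fastforce simp: dist_real_def dist_commute)
    moreover have "min r s > 0" "ball x (min r s) \<subseteq> U" using r s by auto
    ultimately show ?thesis by blast
  qed
  then have "\<forall>a. \<exists>d>0. ball x d \<subseteq> U \<and> (\<forall>y\<in>ball x d. \<bar>G a y - G a x\<bar> \<le> e')" ..
  from choice[OF this] obtain d
    where "\<forall>a. d a > 0 \<and> ball x (d a) \<subseteq> U \<and> (\<forall>y\<in>ball x (d a). \<bar>G a y - G a x\<bar> \<le> e')" ..
  then have d: "\<And>a. d a > 0" "\<And>a. ball x (d a) \<subseteq> U"
      "\<And>a y. y \<in> ball x (d a) \<Longrightarrow> \<bar>G a y - G a x\<bar> \<le> e'" by blast+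
  define D where "D = Min (range d)"
  have D: "D > 0" "\<And>a. D \<le> d a" unfolding D_def using d(1) by (auto simp: Min_gr_iff)
  show "\<exists>D>0. \<forall>y. norm (y - x) < D \<longrightarrow>
      norm (F y - F x - (\<Sum>a\<in>UNIV. (y - x) $ a * G a x)) \<le> e * norm (y - x)"
  proof (intro exI[of _ D] conjI allI impI D(1))
    fix y assume y: "norm (y - x) < D"
    define h where "h = y - x"
    \<comment> \<open>\<open>P A\<close> keeps the coordinates of h in A and zeroes the others, so
      its norm never exceeds that of h.\<close>
    define P where "P A = (\<Sum>a\<in>A. h $ a *\<^sub>R axis a (1::real))" for A
    have Pnth: "P A $ b = (if b \<in> A then h $ b else 0)" for A b
      unfolding P_def by (simp add: axis_def if_distrib cong: if_cong)
    have "\<bar>F (x + P A) - F x - (\<Sum>a\<in>A. h $ a * G a x)\<bar> \<le> (\<Sum>a\<in>A. e' * \<bar>h $ a\<bar>)"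
      if "finite A" for A
      using that
    proof (induction A)
      case empty
      then show ?case by (simp add: P_def)
    next
      case (insert b A)
      have PI: "P (insert b A) = P A + h $ b *\<^sub>R axis b 1"
        using insert(1,2) by (simp add: P_def add.commute)
      \<comment> \<open>Subtracting the linear part turns the wanted estimate into a bound on the
        increment of a function whose derivative is at most e' in absolute value.\<close>
      define \<phi> where "\<phi> = (\<lambda>t. F (x + P A + t *\<^sub>R axis b 1) - t * G b x)"
      have inball: "x + P A + t *\<^sub>R axis b 1 \<in> ball x (d c)" if "\<bar>t\<bar> \<le> \<bar>h $ b\<bar>" for t c
      proof -
        have "norm (P A + t *\<^sub>R axis b 1) \<le> norm h"
          by (rule norm_le_componentwise_cart) (use that insert in \<open>auto simp: Pnth axis_def\<close>)
        also have "\<dots> < d c" using y D(2)[of c] by (simp add: h_def)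
        finally show ?thesis by (metis add.assoc add_diff_cancel_left' dist_commute dist_norm mem_ball)
      qed
      have der: "(\<phi> has_real_derivative (G b (x + P A + t *\<^sub>R axis b 1) - G b x)) (at t)"
        if "\<bar>t\<bar> \<le> \<bar>h $ b\<bar>" for t
      proof -
        have "x + P A + t *\<^sub>R axis b 1 \<in> U" using inball[OF that] d(2) by blast
        from DERIV_diff[OF deriv[OF this] DERIV_cmult_right[OF DERIV_ident, of "G b x"]]
        show ?thesis by (simp add: \<phi>_def)
      qed
      have "norm (\<phi> (h $ b) - \<phi> 0) \<le> e' * norm (h $ b - 0)"
      proof (rule differentiable_bound[of "closed_segment 0 (h $ b)" \<phi> "\<lambda>t u. u * (G b (x + P A + t *\<^sub>R axis b 1) - G b x)"])
        fix t assume t: "t \<in> closed_segment 0 (h $ b)"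
        then have t': "\<bar>t\<bar> \<le> \<bar>h $ b\<bar>"
          by (auto simp: closed_segment_eq_real_ivl split: if_splits)
        show "(\<phi> has_derivative (\<lambda>u. u * (G b (x + P A + t *\<^sub>R axis b 1) - G b x))) (at t within closed_segment 0 (h $ b))"
          using der[OF t'] by (simp add: has_field_derivative_def has_derivative_at_withinI mult.commute[of _ "_ - _"])
        have "\<bar>G b (x + P A + t *\<^sub>R axis b 1) - G b x\<bar> \<le> e'"
          using d(3)[OF inball[OF t']] .
        then show "onorm (\<lambda>u. u * (G b (x + P A + t *\<^sub>R axis b 1) - G b x)) \<le> e'"
          by (intro onorm_bound) (use \<open>e' > 0\<close> in \<open>auto simp: abs_mult mult.commute[of e'] intro: mult_left_mono\<close>)
      qed auto
      then have "\<bar>F (x + P (insert b A)) - F (x + P A) - h $ b * G b x\<bar> \<le> e' * \<bar>h $ b\<bar>"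
        by (simp add: \<phi>_def PI add.assoc)
      then show ?case using insert by simp
    qed
    from this[of UNIV] have "\<bar>F (x + P UNIV) - F x - (\<Sum>a\<in>UNIV. h $ a * G a x)\<bar> \<le> (\<Sum>a\<in>UNIV. e' * \<bar>h $ a\<bar>)"
      by simp
    also have "\<dots> \<le> (\<Sum>a\<in>(UNIV::'p set). e' * norm h)"
      using \<open>e' > 0\<close> by (intro sum_mono mult_left_mono component_le_norm_cart) auto
    also have "\<dots> = e * norm h" by (simp add: e'_def)
    finally have *: "\<bar>F (x + P UNIV) - F x - (\<Sum>a\<in>UNIV. h $ a * G a x)\<bar> \<le> e * norm h" .
    show "norm (F y - F x - (\<Sum>a\<in>UNIV. (y - x) $ a * G a x)) \<le> e * norm (y - x)"
    proof -
      have "P UNIV = h" by (simp add: vec_eq_iff Pnth)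
      then show ?thesis using * by (simp add: h_def)
    qed
  qed
qed

lemma Ck_on_has_derivative:
  assumes "open U" "Ck_on k g U" "x \<in> U" "length as < k"
  shows "(partials as g has_derivative (\<lambda>h. \<Sum>a\<in>UNIV. h $ a * partials (a # as) g x)) (at x)"
proof (rule has_derivative_from_partials[where G = "\<lambda>a. partials (a # as) g", OF assms(1,3)])
  show "continuous_on U (partials (a # as) g)" for a
    using assms unfolding Ck_on_def by (simp add: Suc_leI del: partials.simps)
qed (rule partial_has_derivative[OF assms(2) _ assms(4)])

lemma Ck_on_mono: "Ck_on k g U \<Longrightarrow> j \<le> k \<Longrightarrow> V \<subseteq> U \<Longrightarrow> Ck_on j g V"
  unfolding Ck_on_def by (auto intro: continuous_on_subset dest: le_trans)

lemma Ck_on_continuous: "Ck_on k g U \<Longrightarrow> length as \<le> k \<Longrightarrow> continuous_on U (partials as g)"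
  unfolding Ck_on_def by blast

lemma Ck_on_isCont:
  assumes "open U" "Ck_on k g U" "x \<in> U" "length as \<le> k"
  shows "isCont (partials as g) x"
proof -
  have "continuous_on U (partials as g)" using assms(2,4) by (rule Ck_on_continuous)
  with assms(1,3) show ?thesis using continuous_on_eq_continuous_at by blast
qed

section \<open>Symmetry of mixed second partial derivatives\<close>

lemma mixed_difference:
  assumes U: "open U" "Ck_on 2 g U" and ball: "ball x d \<subseteq> U" and s: "0 < s" "2 * s < d"
  shows "\<exists>y. dist x y \<le> 2 * s \<and>
    g (x + s *\<^sub>R axis a 1 + s *\<^sub>R axis b 1) - g (x + s *\<^sub>R axis a 1) - g (x + s *\<^sub>R axis b 1) + g x
      = s\<^sup>2 * partials [b, a] g y"
proof -
  \<comment> \<open>The second difference over a square of side s is an increment of \<phi>. The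
    mean value theorem in direction a, and then in direction b, turns it into s squared times one
    mixed derivative. All points met lie within 2 s of x.\<close>
  define \<phi> where "\<phi> = (\<lambda>\<sigma>. g (x + s *\<^sub>R axis b 1 + \<sigma> *\<^sub>R axis a 1) - g (x + \<sigma> *\<^sub>R axis a 1))"
  have near: "dist x (x + \<sigma> *\<^sub>R axis a 1 + \<tau> *\<^sub>R axis b 1) \<le> 2 * s" if "0 \<le> \<sigma>" "\<sigma> \<le> s" "0 \<le> \<tau>" "\<tau> \<le> s" for \<sigma> \<tau>
  proof -
    have "norm (\<sigma> *\<^sub>R axis a 1 + \<tau> *\<^sub>R axis b (1::real)) \<le> \<sigma> + \<tau>"
      using norm_triangle_ineq[of "\<sigma> *\<^sub>R axis a 1" "\<tau> *\<^sub>R axis b (1::real)"] that by (simp add: norm_axis_1)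
    also have "\<dots> \<le> 2 * s" using that by simp
    finally have "norm (\<sigma> *\<^sub>R axis a 1 + \<tau> *\<^sub>R axis b (1::real)) \<le> 2 * s" .
    then show ?thesis by (metis add.assoc add_diff_cancel_left' dist_commute dist_norm)
  qed
  have inU: "x + \<sigma> *\<^sub>R axis a 1 + \<tau> *\<^sub>R axis b 1 \<in> U" if "0 \<le> \<sigma>" "\<sigma> \<le> s" "0 \<le> \<tau>" "\<tau> \<le> s" for \<sigma> \<tau>
    using near[OF that] s ball by fastforce
  have "\<exists>z. 0 < z \<and> z < s \<and> \<phi> s - \<phi> 0 = (s - 0) *
     (partials [a] g (x + s *\<^sub>R axis b 1 + z *\<^sub>R axis a 1) - partials [a] g (x + z *\<^sub>R axis a 1))"
  proof (rule MVT2[OF s(1)])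
    fix z assume z: "0 \<le> z" "z \<le> s"
    have 1: "x + s *\<^sub>R axis b 1 + z *\<^sub>R axis a 1 \<in> U" using inU[of z s] z s by (simp add: add_ac)
    have 2: "x + z *\<^sub>R axis a 1 \<in> U" using inU[of z 0] z s by simp
    from partial_has_derivative[OF U(2) 1, of "[]"] partial_has_derivative[OF U(2) 2, of "[]"]
    show "(\<phi> has_real_derivative partials [a] g (x + s *\<^sub>R axis b 1 + z *\<^sub>R axis a 1) - partials [a] g (x + z *\<^sub>R axis a 1)) (at z)"
      unfolding \<phi>_def by (intro DERIV_diff) auto
  qed
  then obtain z where z: "0 < z" "z < s" and e1: "\<phi> s - \<phi> 0 = s *
     (partials [a] g (x + s *\<^sub>R axis b 1 + z *\<^sub>R axis a 1) - partials [a] g (x + z *\<^sub>R axis a 1))" by auto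
  have "\<exists>t. 0 < t \<and> t < s \<and> partials [a] g (x + z *\<^sub>R axis a 1 + s *\<^sub>R axis b 1) - partials [a] g (x + z *\<^sub>R axis a 1 + 0 *\<^sub>R axis b 1)
    = (s - 0) * partials [b, a] g (x + z *\<^sub>R axis a 1 + t *\<^sub>R axis b 1)"
  proof (rule MVT2[OF s(1)])
    fix t assume t: "0 \<le> t" "t \<le> s"
    show "((\<lambda>t. partials [a] g (x + z *\<^sub>R axis a 1 + t *\<^sub>R axis b 1)) has_real_derivative partials [b, a] g (x + z *\<^sub>R axis a 1 + t *\<^sub>R axis b 1)) (at t)"
      by (rule partial_has_derivative[OF U(2)]) (use inU[of z t] t z s in auto)
  qed
  then obtain t where t: "0 < t" "t < s" and e2: "partials [a] g (x + z *\<^sub>R axis a 1 + s *\<^sub>R axis b 1) - partials [a] g (x + z *\<^sub>R axis a 1)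
    = s * partials [b, a] g (x + z *\<^sub>R axis a 1 + t *\<^sub>R axis b 1)" by auto
  have "\<phi> s - \<phi> 0 = s\<^sup>2 * partials [b, a] g (x + z *\<^sub>R axis a 1 + t *\<^sub>R axis b 1)"
    unfolding e1 using e2 by (simp add: power2_eq_square add_ac)
  moreover have "\<phi> s - \<phi> 0 = g (x + s *\<^sub>R axis a 1 + s *\<^sub>R axis b 1) - g (x + s *\<^sub>R axis a 1) - g (x + s *\<^sub>R axis b 1) + g x"
    by (simp add: \<phi>_def add_ac)
  ultimately show ?thesis using near[of z t] z t by (metis less_imp_le)
qed

lemma mixed_difference_tendsto:
  assumes U: "open U" "Ck_on 2 g U" "x \<in> U" and d: "d > 0" "ball x d \<subseteq> U"
    and s: "\<And>n. 0 < s n" "\<And>n. 2 * s n < d" "s \<longlonglongrightarrow> 0"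
  shows "(\<lambda>n. (g (x + s n *\<^sub>R axis a 1 + s n *\<^sub>R axis b 1) - g (x + s n *\<^sub>R axis a 1)
      - g (x + s n *\<^sub>R axis b 1) + g x) / (s n)\<^sup>2) \<longlonglongrightarrow> partials [b, a] g x"
    (is "?D \<longlonglongrightarrow> _")
proof -
  have "\<exists>y. dist x y \<le> 2 * s n \<and> ?D n = partials [b, a] g y" for n
  proof -
    obtain y where y: "dist x y \<le> 2 * s n"
      "g (x + s n *\<^sub>R axis a 1 + s n *\<^sub>R axis b 1) - g (x + s n *\<^sub>R axis a 1)
      - g (x + s n *\<^sub>R axis b 1) + g x = (s n)\<^sup>2 * partials [b, a] g y"
      using mixed_difference[OF U(1,2) d(2) s(1,2)[of n], of a b] by (elim exE conjE)
    have "(s n)\<^sup>2 \<noteq> 0" using s(1)[of n] by simp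
    then have "?D n = partials [b, a] g y" unfolding y(2) by (rule nonzero_mult_div_cancel_left)
    with y show ?thesis by blast
  qed
  then have "\<forall>n. \<exists>y. dist x y \<le> 2 * s n \<and> ?D n = partials [b, a] g y" ..
  from choice[OF this] obtain y where "\<forall>n. dist x (y n) \<le> 2 * s n \<and> ?D n = partials [b, a] g (y n)" ..
  then have y: "dist x (y n) \<le> 2 * s n" "?D n = partials [b, a] g (y n)" for n by blast+
  have cont: "isCont (partials [b, a] g) x"
    by (rule Ck_on_isCont[OF U]) simp
  have "y \<longlonglongrightarrow> x"
  proof -
    have lim: "(\<lambda>n. 2 * s n) \<longlonglongrightarrow> 0" using tendsto_mult_right_zero[OF s(3)] by simp
    have "norm (dist (y n) x) \<le> 2 * s n" for n using y(1)[of n] by (simp only: dist_commute) simp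
    then have "(\<lambda>n. dist (y n) x) \<longlonglongrightarrow> 0"
      by (rule Lim_null_comparison[OF always_eventually, OF allI lim])
    then show ?thesis by (simp only: tendsto_dist_iff[of y])
  qed
  then have *: "(\<lambda>n. partials [b, a] g (y n)) \<longlonglongrightarrow> partials [b, a] g x"
    by (rule isCont_tendsto_compose[OF cont])
  have "?D = (\<lambda>n. partials [b, a] g (y n))" by (rule ext) (rule y(2))
  then show ?thesis by (rule ssubst) (rule *)
qed

text \<open>The second difference is symmetric in the two directions, and divided by s squared it
  tends to the mixed derivative in either order.\<close>

lemma partials_commute:
  assumes U: "open U" "Ck_on 2 g U" "x \<in> U"
  shows "partials [a, b] g x = partials [b, a] g x"
proof -
  obtain d where d: "d > 0" "ball x d \<subseteq> U" using U openE by blast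
  \<comment> \<open>The shift by 3 gives 2 s < d already for n = 0.\<close>
  define s where "s n = d / (real n + 3)" for n :: nat
  have s: "0 < s n" "2 * s n < d" for n using d by (auto simp: s_def field_simps intro!: add_pos_nonneg)
  have s0: "s \<longlonglongrightarrow> 0"     unfolding s_def using tendsto_mult[OF tendsto_const LIMSEQ_inverse_real_of_nat[THEN LIMSEQ_ignore_initial_segment, of 2], of d]
    by (simp add: field_simps)
  show ?thesis
  proof (rule LIMSEQ_unique)
    show "(\<lambda>n. (g (x + s n *\<^sub>R axis b 1 + s n *\<^sub>R axis a 1) - g (x + s n *\<^sub>R axis b 1)
      - g (x + s n *\<^sub>R axis a 1) + g x) / (s n)\<^sup>2) \<longlonglongrightarrow> partials [a, b] g x"
      by (rule mixed_difference_tendsto[OF U d s s0])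
    have eq: "g (x + s n *\<^sub>R axis b 1 + s n *\<^sub>R axis a 1) - g (x + s n *\<^sub>R axis b 1) - g (x + s n *\<^sub>R axis a 1) + g x
      = g (x + s n *\<^sub>R axis a 1 + s n *\<^sub>R axis b 1) - g (x + s n *\<^sub>R axis a 1) - g (x + s n *\<^sub>R axis b 1) + g x" for n
      by (simp only: add.assoc add.commute[of "s n *\<^sub>R axis b 1"])
    show "(\<lambda>n. (g (x + s n *\<^sub>R axis b 1 + s n *\<^sub>R axis a 1) - g (x + s n *\<^sub>R axis b 1)
      - g (x + s n *\<^sub>R axis a 1) + g x) / (s n)\<^sup>2) \<longlonglongrightarrow> partials [b, a] g x"
      unfolding eq by (rule mixed_difference_tendsto[OF U d s s0])
  qed
qed

section \<open>Taylor expansion of second order\<close>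

lemma inner_grad: "grad g x \<bullet> h = (\<Sum>a\<in>UNIV. h $ a * partials [a] g x)"
  by (simp add: inner_vec_def grad_def mult.commute)

lemma inner_matrix_vector: "h \<bullet> (A *v h') = (\<Sum>a\<in>UNIV. \<Sum>b\<in>UNIV. h $ a * h' $ b * A $ a $ b)" for A :: "real^'p^'p"
  by (simp add: inner_vec_def matrix_vector_mult_def sum_distrib_left mult_ac)

lemma hessian_quadratic:
  "h \<bullet> (hessian g x *v h) = (\<Sum>b\<in>UNIV. \<Sum>a\<in>UNIV. h $ b * h $ a * partials [b, a] g x)"
  by (simp add: inner_matrix_vector hessian_def)

lemma taylor2:
  assumes U: "open U" "Ck_on 2 g U" and seg: "closed_segment x (x + h) \<subseteq> U"
  obtains t where "0 < t" "t < 1"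
    "g (x + h) = g x + grad g x \<bullet> h + (h \<bullet> (hessian g (x + t *\<^sub>R h) *v h)) / 2"
proof -
  \<comment> \<open>For m \<le> 2, \<open>D m\<close> is the m-th derivative of t \<mapsto> g (x + t
    h), in the form that \<open>Maclaurin\<close> expects.\<close>
  define D where "D m t = (if m = 0 then g (x + t *\<^sub>R h) else if m = 1 then grad g (x + t *\<^sub>R h) \<bullet> h
    else h \<bullet> (hessian g (x + t *\<^sub>R h) *v h))" for m :: nat and t :: real
  have inU: "x + t *\<^sub>R h \<in> U" if "0 \<le> t" "t \<le> 1" for t
    using that seg by (auto simp: closed_segment_image_interval algebra_simps image_subset_iff)
  have line: "((\<lambda>t. x + t *\<^sub>R h) has_derivative (\<lambda>u. u *\<^sub>R h)) (at t)" for t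
    by (auto intro!: derivative_eq_intros)
  have der: "((\<lambda>t. partials as g (x + t *\<^sub>R h)) has_real_derivative (\<Sum>a\<in>UNIV. h $ a * partials (a # as) g (x + t *\<^sub>R h))) (at t)"
    if "0 \<le> t" "t \<le> 1" "length as < 2" for t as
  proof -
    from has_derivative_compose[OF line Ck_on_has_derivative[OF U inU[OF that(1,2)] that(3)]]
    show ?thesis
      unfolding has_field_derivative_def
      by (rule has_derivative_eq_rhs) (simp add: fun_eq_iff sum_distrib_left mult_ac)
  qed
  have "\<forall>m t. m < 2 \<and> 0 \<le> t \<and> t \<le> 1 \<longrightarrow> DERIV (D m) t :> D (Suc m) t"
  proof (intro allI impI)
    fix m t assume mt: "(m::nat) < 2 \<and> 0 \<le> t \<and> (t::real) \<le> 1"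
    then consider "m = 0" | "m = 1" by linarith
    then show "DERIV (D m) t :> D (Suc m) t"
    proof cases
      case 1
      then show ?thesis using der[of t "[]"] mt by (simp add: D_def[abs_def] inner_grad)
    next
      case 2
      have *: "((\<lambda>t. \<Sum>a\<in>UNIV. h $ a * partials [a] g (x + t *\<^sub>R h)) has_real_derivative
        (\<Sum>a\<in>UNIV. h $ a * (\<Sum>b\<in>UNIV. h $ b * partials [b, a] g (x + t *\<^sub>R h)))) (at t)"
        using mt by (intro DERIV_sum DERIV_cmult der) auto
      have eq: "(\<Sum>a\<in>UNIV. h $ a * (\<Sum>b\<in>UNIV. h $ b * partials [b, a] g (x + t *\<^sub>R h)))
          = h \<bullet> (hessian g (x + t *\<^sub>R h) *v h)"
        unfolding hessian_quadratic sum_distrib_left by (subst sum.swap) (simp add: mult_ac)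
      show ?thesis using * 2 unfolding eq by (simp add: D_def[abs_def] inner_grad)
    qed
  qed
  moreover have "D 0 = (\<lambda>t. g (x + t *\<^sub>R h))" by (simp add: D_def fun_eq_iff)
  ultimately have "\<exists>t>0. t < 1 \<and> g (x + 1 *\<^sub>R h) = (\<Sum>m<2. D m 0 / fact m * 1 ^ m) + D 2 t / fact 2 * 1 ^ 2"
    using Maclaurin[of 1 2 D "\<lambda>t. g (x + t *\<^sub>R h)"] by simp
  then show ?thesis using that by (auto simp: D_def numeral_2_eq_2)
qed

lemma matrix_quadratic_bound:
  fixes A :: "real^'p^'p"
  assumes "\<And>a b. \<bar>A $ a $ b\<bar> \<le> e"
  shows "\<bar>h \<bullet> (A *v h)\<bar> \<le> e * (real CARD('p))\<^sup>2 * (norm h)\<^sup>2"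
proof -
  have "\<bar>h \<bullet> (A *v h)\<bar> \<le> (\<Sum>a\<in>(UNIV::'p set). \<Sum>b\<in>(UNIV::'p set). norm h * norm h * e)"
    unfolding inner_matrix_vector
  proof (intro order_trans[OF sum_abs] sum_mono)
    fix a b
    have "\<bar>h $ a\<bar> * \<bar>h $ b\<bar> * \<bar>A $ a $ b\<bar> \<le> norm h * norm h * e"
      by (intro mult_mono assms component_le_norm_cart) auto
    then show "\<bar>h $ a * h $ b * A $ a $ b\<bar> \<le> norm h * norm h * e" by (simp add: abs_mult)
  qed
  also have "\<dots> = e * (real CARD('p))\<^sup>2 * (norm h)\<^sup>2" by (simp add: power2_eq_square)
  finally show ?thesis .
qed

lemma taylor2_peano:
  fixes x :: "real^'p"
  assumes "Ck_at k g x" "2 \<le> k" "0 < e"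
  shows "\<exists>d>0. \<forall>h. norm h < d \<longrightarrow>
    \<bar>g (x + h) - (g x + grad g x \<bullet> h + (h \<bullet> (hessian g x *v h)) / 2)\<bar> \<le> e * (norm h)\<^sup>2"
proof -
  obtain U where U: "open U" "x \<in> U" "Ck_on 2 g U"
    using assms Ck_on_mono unfolding Ck_at_def by blast
  \<comment> \<open>Passing from entries to a quadratic form with
    \<open>matrix_quadratic_bound\<close> costs a factor p squared.\<close>
  define e' where "e' = e / (real CARD('p))\<^sup>2"
  have "e' > 0" using assms by (simp add: e'_def)
  have "\<forall>\<^sub>F y in nhds x. \<bar>partials [a, b] g y - partials [a, b] g x\<bar> < e'" for a b
  proof -
    have "isCont (partials [a, b] g) x"
      by (rule Ck_on_isCont[OF U(1,3,2)]) simp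
    then have "(partials [a, b] g \<longlongrightarrow> partials [a, b] g x) (nhds x)"
      by (simp only: isCont_def tendsto_at_iff_tendsto_nhds)
    from tendstoD[OF this \<open>e' > 0\<close>] show ?thesis by (simp add: dist_real_def)
  qed
  then have "\<forall>\<^sub>F y in nhds x. \<forall>a b. \<bar>partials [a, b] g y - partials [a, b] g x\<bar> < e'"
    by (intro eventually_all_finite)
  with eventually_nhds_in_open[OF U(1,2)] have "\<forall>\<^sub>F y in nhds x. y \<in> U \<and> (\<forall>a b. \<bar>partials [a, b] g y - partials [a, b] g x\<bar> < e')"
    by eventually_elim auto
  then obtain d where d: "d > 0" "\<And>y. dist y x < d \<Longrightarrow> y \<in> U \<and> (\<forall>a b. \<bar>partials [a, b] g y - partials [a, b] g x\<bar> < e')"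
    unfolding eventually_nhds_metric by blast
  show ?thesis
  proof (intro exI[of _ d] conjI allI impI d(1))
    fix h :: "real^'p" assume h: "norm h < d"
    have seg: "dist (x + t *\<^sub>R h) x < d" if "0 \<le> t" "t \<le> 1" for t
    proof -
      have "\<bar>t\<bar> * norm h \<le> 1 * norm h" using that by (intro mult_right_mono) auto
      then show ?thesis using h by (simp add: dist_norm)
    qed
    have "closed_segment x (x + h) \<subseteq> U"
    proof
      fix y assume "y \<in> closed_segment x (x + h)"
      then obtain t where "0 \<le> t" "t \<le> 1" "y = x + t *\<^sub>R h"
        by (auto simp: closed_segment_def algebra_simps)
      then show "y \<in> U" using d(2)[OF seg] by simp
    qed
    from taylor2[OF U(1,3) this] obtain t where t: "0 < t" "t < 1"
      and eq: "g (x + h) = g x + grad g x \<bullet> h + (h \<bullet> (hessian g (x + t *\<^sub>R h) *v h)) / 2" .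
    have "\<bar>h \<bullet> ((hessian g (x + t *\<^sub>R h) - hessian g x) *v h)\<bar> \<le> e' * (real CARD('p))\<^sup>2 * (norm h)\<^sup>2"
      by (rule matrix_quadratic_bound) (use d(2)[OF seg[of t]] t in \<open>auto simp: hessian_def less_imp_le\<close>)
    also have "\<dots> = e * (norm h)\<^sup>2" by (simp add: e'_def)
    finally have "\<bar>h \<bullet> (hessian g (x + t *\<^sub>R h) *v h) - h \<bullet> (hessian g x *v h)\<bar> \<le> e * (norm h)\<^sup>2"
      by (simp add: matrix_vector_mult_diff_rdistrib inner_diff_right)
    then show "\<bar>g (x + h) - (g x + grad g x \<bullet> h + (h \<bullet> (hessian g x *v h)) / 2)\<bar> \<le> e * (norm h)\<^sup>2"
      unfolding eq abs_le_iff by linarith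
  qed
qed

section \<open>Square roots of positive semidefinite matrices\<close>

text \<open>Near t = 0 the linear term dominates the quadratic one, and its sign follows that of t.
  Applied to x \<bullet> f x at a maximiser and to null vectors of a semidefinite form.\<close>

lemma quadratic_nonneg_imp_linear_zero:
  fixes b c :: real
  assumes "\<And>t. 0 \<le> 2 * t * b + t\<^sup>2 * c"
  shows "b = 0"
proof (rule ccontr)
  assume "b \<noteq> 0"
  \<comment> \<open>Since k > c, the value at t = - b / k is (b^2 / k) (c / k - 2) < 0.\<close>
  define k where "k = \<bar>c\<bar> + 1"
  have "k > 0" by (simp add: k_def)
  have "0 \<le> 2 * (- b / k) * b + (- b / k)\<^sup>2 * c" by (rule assms)
  also have "\<dots> = (b\<^sup>2 / k) * (c / k - 2)"
    using \<open>k > 0\<close> by (simp add: power2_eq_square field_simps)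
  finally have "0 \<le> (b\<^sup>2 / k) * (c / k - 2)" .
  moreover have "b\<^sup>2 / k > 0" using \<open>b \<noteq> 0\<close> by (simp add: k_def)
  moreover have "c / k - 2 < 0" by (simp add: k_def field_simps abs_if)
  ultimately show False by (meson linorder_not_le mult_pos_neg)
qed

text \<open>Spectral theorem by induction on the dimension: a maximiser of x \<bullet> f x on the
  unit sphere of V is an eigenvector, and self-adjointness makes its orthogonal complement in V
  invariant.\<close>

lemma selfadjoint_orthonormal_eigenbasis:
  fixes f :: "'a::euclidean_space \<Rightarrow> 'a"
  assumes "linear f" and self: "\<And>x y. f x \<bullet> y = x \<bullet> f y"
    and "subspace V" and "f ` V \<subseteq> V"
  shows "\<exists>B\<subseteq>V. pairwise orthogonal B \<and> (\<forall>b\<in>B. norm b = 1 \<and> (\<exists>l. f b = l *\<^sub>R b)) \<and> span B = V"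
  using assms(3,4)
proof (induction "dim V" arbitrary: V rule: less_induct)
  case (less V)
  interpret f: linear f by fact
  show ?case
  proof (cases "V = {0}")
    case True
    then show ?thesis by (intro exI[of _ "{}"]) auto
  next
    case False
    then obtain u where u: "u \<in> V" "u \<noteq> 0" using subspace_0[OF less.prems(1)] by blast
    define K where "K = V \<inter> sphere 0 1"
    have "compact K" unfolding K_def
      by (intro closed_Int_compact closed_subspace less.prems compact_sphere)
    moreover have "(1 / norm u) *\<^sub>R u \<in> K"
      using u less.prems by (simp add: K_def subspace_scale)
    moreover have "continuous_on K (\<lambda>x. x \<bullet> f x)"
      by (intro continuous_on_inner continuous_on_id linear_continuous_on linear_linear[THEN iffD2] f.linear_axioms)
    ultimately obtain v where v: "v \<in> K" "\<And>y. y \<in> K \<Longrightarrow> y \<bullet> f y \<le> v \<bullet> f v"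
      using continuous_attains_sup[of K "\<lambda>x. x \<bullet> f x"] by blast
    have vV: "v \<in> V" "norm v = 1" "f v \<in> V" using v(1) less.prems by (auto simp: K_def)
    define l where "l = v \<bullet> f v"
    have max: "y \<bullet> f y \<le> l * (y \<bullet> y)" if "y \<in> V" for y
    proof (cases "y = 0")
      case False
      have "(1 / norm y) *\<^sub>R y \<in> K" using False that less.prems by (simp add: K_def subspace_scale)
      from v(2)[OF this] have "(y \<bullet> f y) / (norm y)\<^sup>2 \<le> l"
        by (simp add: l_def f.scale power2_eq_square)
      then show ?thesis using False by (simp add: field_simps power2_norm_eq_inner)
    qed simp
    have eig: "f v = l *\<^sub>R v"
    proof -
      \<comment> \<open>y is the residual of the eigenvector equation. Varying v in direction y, the
        maximum property forces l (v \<bullet> y) - f v \<bullet> y = 0, and this number is y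
        \<bullet> y.\<close>
      define y where "y = l *\<^sub>R v - f v"
      have yV: "y \<in> V" unfolding y_def
        using vV less.prems by (intro subspace_diff subspace_scale)
      have vv: "v \<bullet> v = 1" using vV by (simp add: power2_norm_eq_inner[symmetric])
      have "l * (v \<bullet> y) - f v \<bullet> y = 0"
      proof (rule quadratic_nonneg_imp_linear_zero)
        fix t
        have "v + t *\<^sub>R y \<in> V" using vV yV less.prems by (intro subspace_add subspace_scale)
        from max[OF this] have e0: "(v + t *\<^sub>R y) \<bullet> f (v + t *\<^sub>R y) \<le> l * ((v + t *\<^sub>R y) \<bullet> (v + t *\<^sub>R y))" .
        have e1: "(v + t *\<^sub>R y) \<bullet> f (v + t *\<^sub>R y) = l + 2 * t * (f v \<bullet> y) + t\<^sup>2 * (y \<bullet> f y)"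
          using self[of v y] by (simp add: f.add f.scale inner_add_left inner_add_right l_def power2_eq_square inner_commute algebra_simps)
        have e2: "(v + t *\<^sub>R y) \<bullet> (v + t *\<^sub>R y) = 1 + 2 * t * (v \<bullet> y) + t\<^sup>2 * (y \<bullet> y)"
          using vv by (simp add: inner_add_left inner_add_right power2_eq_square inner_commute algebra_simps)
        show "0 \<le> 2 * t * (l * (v \<bullet> y) - f v \<bullet> y) + t\<^sup>2 * (l * (y \<bullet> y) - y \<bullet> f y)"
          using e0 unfolding e1 e2
          by (simp add: algebra_simps)
      qed
      then have "y \<bullet> y = 0" by (simp add: y_def inner_diff_left)
      then show ?thesis by (simp add: y_def)
    qed
    define V' where "V' = V \<inter> {y. v \<bullet> y = 0}"
    have sub': "subspace V'" unfolding V'_def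
      by (intro subspace_inter less.prems(1) subspace_hyperplane)
    have inv': "f ` V' \<subseteq> V'"
    proof -
      have "v \<bullet> f y = 0" if "v \<bullet> y = 0" for y using self[of v y] that by (simp add: eig)
      then show ?thesis using less.prems(2) by (auto simp: V'_def)
    qed
    have "v \<notin> V'" using vV by (auto simp: V'_def)
    moreover have "V' \<subseteq> V" by (simp add: V'_def)
    ultimately have "V' \<subset> V" using vV by blast
    then have "dim V' < dim V" using sub' less.prems(1)
      by (metis dim_psubset span_eq_iff)
    from less.hyps[OF this sub' inv'] obtain B where B: "B \<subseteq> V'" "pairwise orthogonal B"
      "\<forall>b\<in>B. norm b = 1 \<and> (\<exists>l. f b = l *\<^sub>R b)" "span B = V'" by blast
    have "span (insert v B) = V"
    proof
      show "span (insert v B) \<subseteq> V"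
        using vV B(1) less.prems(1) by (intro span_minimal) (auto simp: V'_def)
      show "V \<subseteq> span (insert v B)"
      proof
        fix y assume y: "y \<in> V"
        have vv: "v \<bullet> v = 1" using vV by (simp add: power2_norm_eq_inner[symmetric])
        have "y - (v \<bullet> y) *\<^sub>R v \<in> V'"
          using y vV vv less.prems(1) by (auto simp: V'_def inner_diff_right intro!: subspace_diff subspace_scale)
        then have "y - (v \<bullet> y) *\<^sub>R v \<in> span (insert v B)"
          using B(4) span_mono[of B "insert v B"] by blast
        moreover have "(v \<bullet> y) *\<^sub>R v \<in> span (insert v B)"
          by (intro span_scale span_base) simp
        ultimately have "(y - (v \<bullet> y) *\<^sub>R v) + (v \<bullet> y) *\<^sub>R v \<in> span (insert v B)"
          by (rule span_add)
        then show "y \<in> span (insert v B)" by simp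
      qed
    qed
    moreover have "pairwise orthogonal (insert v B)"
      using B(1,2) by (auto simp: pairwise_insert V'_def orthogonal_def inner_commute)
    ultimately show ?thesis
      using B vV eig by (intro exI[of _ "insert v B"]) (auto simp: V'_def)
  qed
qed

lemma transpose_eq_imp_selfadjoint:
  fixes A :: "real^'p^'p"
  assumes "transpose A = A"
  shows "(A *v x) \<bullet> y = x \<bullet> (A *v y)"
  using dot_lmul_matrix[of x A y] assms by (simp add: transpose_matrix_vector[of A x, symmetric] inner_commute)

text \<open>In an orthonormal eigenbasis the root is obtained by replacing each eigenvalue by its
  square root.\<close>

lemma psd_sqrt_exists:
  fixes A :: "real^'p^'p"
  assumes sym: "transpose A = A" and psd: "\<And>x. 0 \<le> x \<bullet> (A *v x)"
  shows "\<exists>S :: real^'p^'p. transpose S = S \<and> (\<forall>x. 0 \<le> x \<bullet> (S *v x)) \<and> S ** S = A"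
proof -
  have "\<exists>B\<subseteq>UNIV. pairwise orthogonal B \<and> (\<forall>b\<in>B. norm b = 1 \<and> (\<exists>l. A *v b = l *\<^sub>R b)) \<and> span B = UNIV"
    by (intro selfadjoint_orthonormal_eigenbasis transpose_eq_imp_selfadjoint sym matrix_vector_mul_linear) auto
  then obtain B where B: "pairwise orthogonal B" "\<forall>b\<in>B. norm b = 1 \<and> (\<exists>l. A *v b = l *\<^sub>R b)" "span B = UNIV"
    by blast
  then obtain l where l: "\<And>b. b \<in> B \<Longrightarrow> A *v b = l b *\<^sub>R b" by metis
  have "finite B" using B by (intro pairwise_orthogonal_imp_finite)
  have on: "b \<bullet> c = (if b = c then 1 else 0)" if "b \<in> B" "c \<in> B" for b c
    using B(1,2) that by (auto simp: pairwise_def orthogonal_def power2_norm_eq_inner[symmetric])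
  have expand: "(\<Sum>b\<in>B. (x \<bullet> b) *\<^sub>R b) = x" for x
    using B \<open>finite B\<close> by (intro orthonormal_basis_expand) auto
  have lpos: "0 \<le> l b" if "b \<in> B" for b
    using psd[of b] l[OF that] on[OF that that] by simp
  define s where "s x = (\<Sum>b\<in>B. (sqrt (l b) * (x \<bullet> b)) *\<^sub>R b)" for x
  have "linear s" unfolding s_def
    by (intro linearI) (auto simp: inner_add_left algebra_simps sum.distrib scaleR_sum_right)
  define S where "S = matrix s"
  have S: "S *v x = s x" for x unfolding S_def using \<open>linear s\<close> by (simp add: matrix_works)
  have "s x \<bullet> y = x \<bullet> s y" for x y
    unfolding s_def by (simp add: inner_sum_left inner_sum_right mult_ac inner_commute)
  then have "transpose S = S"
    unfolding matrix_eq
    by (metis (no_types) S adjoint_matrix adjoint_unique matrix_of_matrix_vector_mul vector_matrix_mul_rid matrix_vector_mul_linear)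
  moreover have "0 \<le> x \<bullet> (S *v x)" for x
    unfolding S s_def inner_sum_right
    by (intro sum_nonneg) (use lpos in \<open>auto simp: mult.assoc intro!: mult_nonneg_nonneg\<close>)
  moreover have "S ** S = A"
    unfolding matrix_eq
  proof
    fix x
    have sb: "s x \<bullet> b = sqrt (l b) * (x \<bullet> b)" if "b \<in> B" for b x
    proof -
      have "s x \<bullet> b = (\<Sum>c\<in>B. if c = b then sqrt (l b) * (x \<bullet> b) else 0)"
        unfolding s_def inner_sum_left by (intro sum.cong) (use on that in auto)
      then show ?thesis using that \<open>finite B\<close> by simp
    qed
    have "(S ** S) *v x = s (s x)" by (simp add: matrix_vector_mul_assoc[symmetric] S)
    also have "\<dots> = (\<Sum>b\<in>B. (l b * (x \<bullet> b)) *\<^sub>R b)"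
      unfolding s_def[of "s x"] by (intro sum.cong refl) (use sb lpos in \<open>simp add: mult.assoc[symmetric]\<close>)
    also have "\<dots> = A *v (\<Sum>b\<in>B. (x \<bullet> b) *\<^sub>R b)"
      by (simp add: matrix_vector_mult_scaleR l mult.commute linear_sum[OF matrix_vector_mul_linear])
    finally show "(S ** S) *v x = A *v x" by (simp add: expand)
  qed
  ultimately show ?thesis by blast
qed

lemma psd_sqrt:
  fixes A :: "real^'p^'p"
  assumes "transpose A = A" "\<And>x. 0 \<le> x \<bullet> (A *v x)"
  shows "transpose (psd_sqrt A) = psd_sqrt A" "psd_sqrt A ** psd_sqrt A = A"
  using someI_ex[OF psd_sqrt_exists[OF assms]] unfolding psd_sqrt_def by auto

lemma matrix_inv:
  fixes A :: "real^'p^'p"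
  assumes "invertible A"
  shows "A ** matrix_inv A = mat 1" "matrix_inv A ** A = mat 1"
  using someI_ex[OF assms[unfolded invertible_def]] unfolding matrix_inv_def by auto

lemma matrix_inv_mat_1: "matrix_inv (mat 1) = (mat 1 :: real^'p^'p)"
  using matrix_inv[of "mat 1 :: real^'p^'p"] by (simp add: invertible_def)

section \<open>Gaussian laws\<close>

abbreviation std_normal :: "real measure" where
  "std_normal \<equiv> density lborel (\<lambda>x. ennreal (std_normal_density x))"

lemma mvn_mat_1:
  "mvn (mat 1) = density lborel (\<lambda>x::real^'p. \<Prod>b\<in>Basis. ennreal (std_normal_density (x \<bullet> b)))"
proof -
  have "exp (- (x \<bullet> x) / 2) / sqrt ((2 * pi) ^ CARD('p)) = (\<Prod>b\<in>Basis. std_normal_density (x \<bullet> b))" for x :: "real^'p"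
  proof -
    have "(\<Prod>b\<in>(Basis::(real^'p) set). std_normal_density (x \<bullet> b)) = (1 / sqrt (2 * pi)) ^ CARD('p) * exp (\<Sum>b\<in>Basis. - (x \<bullet> b)\<^sup>2 / 2)"
      unfolding std_normal_density_def prod.distrib by (simp add: exp_sum power_one_over)
    also have "(\<Sum>b\<in>(Basis::(real^'p) set). - (x \<bullet> b)\<^sup>2 / 2) = - (x \<bullet> x) / 2"
      by (subst (2) euclidean_inner) (simp add: sum_negf sum_divide_distrib power2_eq_square)
    finally have eq: "(\<Prod>b\<in>Basis. std_normal_density (x \<bullet> b)) = (1 / sqrt (2 * pi)) ^ CARD('p) * exp (- (x \<bullet> x) / 2)" .
    show ?thesis unfolding eq real_sqrt_power power_one_over by simp
  qed
  then show ?thesis unfolding mvn_def matrix_inv_mat_1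
    by (intro density_cong) (auto simp: prod_ennreal)
qed

lemma emeasure_mvn_mat_1_box:
  assumes [measurable]: "\<And>b. b \<in> Basis \<Longrightarrow> A b \<in> sets borel"
  shows "emeasure (mvn (mat 1)) {x::real^'p. \<forall>b\<in>Basis. x \<bullet> b \<in> A b} = (\<Prod>b\<in>Basis. emeasure std_normal (A b))"
proof -
  have "emeasure (mvn (mat 1)) {x::real^'p. \<forall>b\<in>Basis. x \<bullet> b \<in> A b} =
     (\<integral>\<^sup>+x. (\<Prod>b\<in>Basis. ennreal (std_normal_density (x \<bullet> b))) * indicator {x. \<forall>b\<in>Basis. x \<bullet> b \<in> A b} x \<partial>lborel)"
    unfolding mvn_mat_1 by (subst emeasure_density) auto
  also have "\<dots> = (\<integral>\<^sup>+x. (\<Prod>b\<in>Basis. ennreal (std_normal_density (x \<bullet> b)) * indicator (A b) (x \<bullet> b)) \<partial>lborel)"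
    by (intro nn_integral_cong) (auto simp: prod.distrib indicator_def intro: prod_zero)
  also have "\<dots> = (\<Prod>b\<in>(Basis::(real^'p) set). \<integral>\<^sup>+x. ennreal (std_normal_density x) * indicator (A b) x \<partial>lborel)"
    by (rule nn_integral_lborel_prod) auto
  also have "\<dots> = (\<Prod>b\<in>(Basis::(real^'p) set). emeasure std_normal (A b))"
    by (intro prod.cong refl) (simp add: emeasure_density)
  finally show ?thesis .
qed

lemma prob_space_std_normal: "prob_space std_normal"
  by (rule prob_space_normal_density) simp

lemma prob_space_mvn_mat_1: "prob_space (mvn (mat 1 :: real^'p^'p))"
proof
  have "emeasure (mvn (mat 1)) {x::real^'p. \<forall>b\<in>Basis. x \<bullet> b \<in> UNIV} = 1"
    by (subst emeasure_mvn_mat_1_box) (auto intro!: prod.neutral simp: prob_space.emeasure_space_1[OF prob_space_std_normal, simplified])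
  then show "emeasure (mvn (mat 1)) (space (mvn (mat 1 :: real^'p^'p))) = 1" by (simp add: mvn_def)
qed

lemma sets_mvn [simp, measurable_cong]: "sets (mvn A) = sets borel"
  and space_mvn [simp]: "space (mvn A) = UNIV"
  by (simp_all add: mvn_def)

lemma distr_mvn_mat_1_component:
  assumes "c \<in> Basis"
  shows "distr (mvn (mat 1)) borel (\<lambda>x::real^'p. x \<bullet> c) = std_normal"
proof (rule measure_eqI)
  fix A assume "A \<in> sets (distr (mvn (mat 1)) borel (\<lambda>x::real^'p. x \<bullet> c))"
  then have [measurable]: "A \<in> sets borel" by simp
  define A' where "A' b = (if b = c then A else UNIV)" for b :: "real^'p"
  have "emeasure (distr (mvn (mat 1)) borel (\<lambda>x::real^'p. x \<bullet> c)) A = emeasure (mvn (mat 1)) {x::real^'p. \<forall>b\<in>Basis. x \<bullet> b \<in> A' b}"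
    using assms by (subst emeasure_distr) (auto intro!: arg_cong[where f = "emeasure _"] simp: A'_def)
  also have "\<dots> = (\<Prod>b\<in>(Basis::(real^'p) set). emeasure std_normal (A' b))"
    by (rule emeasure_mvn_mat_1_box) (simp add: A'_def)
  also have "\<dots> = (\<Prod>b\<in>(Basis::(real^'p) set). if b = c then emeasure std_normal A else 1)"
    using prob_space.emeasure_space_1[OF prob_space_std_normal] by (intro prod.cong) (auto simp: A'_def)
  also have "\<dots> = emeasure std_normal A" using assms by simp
  finally show "emeasure (distr (mvn (mat 1)) borel (\<lambda>x::real^'p. x \<bullet> c)) A = emeasure std_normal A" .
qed simp

text \<open>A joint law is determined by its values on boxes. There the product density factorises,
  so the joint law of the coordinates is the product of its marginals.\<close>

lemma indep_vars_mvn_mat_1: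
  "prob_space.indep_vars (mvn (mat 1)) (\<lambda>_. borel) (\<lambda>b (x::real^'p). x \<bullet> b) Basis"
proof -
  interpret prob_space "mvn (mat 1 :: real^'p^'p)" by (rule prob_space_mvn_mat_1)
  interpret std: prob_space std_normal by (rule prob_space_std_normal)
  interpret product_sigma_finite "\<lambda>_. std_normal" ..
  have "distr (mvn (mat 1)) (\<Pi>\<^sub>M b\<in>Basis. borel) (\<lambda>x. \<lambda>b\<in>Basis. (x::real^'p) \<bullet> b) = (\<Pi>\<^sub>M b\<in>Basis. std_normal)"
  proof (rule PiM_eqI)
    show "finite (Basis :: (real^'p) set)" by simp
    show "sets (distr (mvn (mat 1)) (\<Pi>\<^sub>M b\<in>Basis. borel) (\<lambda>x. \<lambda>b\<in>Basis. (x::real^'p) \<bullet> b)) = sets (\<Pi>\<^sub>M b\<in>Basis. std_normal)"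
      by (simp cong: sets_PiM_cong)
    fix A assume A: "\<And>b::real^'p. b \<in> Basis \<Longrightarrow> A b \<in> sets std_normal"
    have "emeasure (distr (mvn (mat 1)) (\<Pi>\<^sub>M b\<in>Basis. borel) (\<lambda>x. \<lambda>b\<in>Basis. (x::real^'p) \<bullet> b)) (Pi\<^sub>E Basis A)
        = emeasure (mvn (mat 1)) {x::real^'p. \<forall>b\<in>Basis. x \<bullet> b \<in> A b}"
      using A by (subst emeasure_distr) (auto intro!: arg_cong[where f = "emeasure _"] sets_PiM_I_finite)
    also have "\<dots> = (\<Prod>b\<in>Basis. emeasure std_normal (A b))"
      using A by (intro emeasure_mvn_mat_1_box) simp
    finally show "emeasure (distr (mvn (mat 1)) (\<Pi>\<^sub>M b\<in>Basis. borel) (\<lambda>x. \<lambda>b\<in>Basis. (x::real^'p) \<bullet> b)) (Pi\<^sub>E Basis A)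
        = (\<Prod>b\<in>Basis. emeasure std_normal (A b))" .
  qed
  also have "\<dots> = (\<Pi>\<^sub>M b\<in>Basis. distr (mvn (mat 1)) borel (\<lambda>x::real^'p. x \<bullet> b))"
    by (intro PiM_cong) (auto simp: distr_mvn_mat_1_component)
  finally show ?thesis
    by (subst indep_vars_iff_distr_eq_PiM') auto
qed

lemma distr_mvn_mat_1_inner:
  fixes a :: "real^'p"
  assumes "a \<noteq> 0"
  shows "distr (mvn (mat 1)) borel (\<lambda>x. a \<bullet> x) = density lborel (normal_density 0 (norm a))"
proof -
  interpret prob_space "mvn (mat 1 :: real^'p^'p)" by (rule prob_space_mvn_mat_1)
  \<comment> \<open>Only coordinates with a nonzero coefficient are kept: a normal variable
    multiplied by 0 has no density.\<close>
  define I where "I = {b \<in> Basis. a \<bullet> b \<noteq> 0}"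
  have "I \<noteq> {}" using assms by (auto simp: I_def euclidean_eq_iff[of a 0])
  have "distributed (mvn (mat 1)) lborel (\<lambda>x. \<Sum>b\<in>I. 0 + (a \<bullet> b) * (x \<bullet> b)) (normal_density (\<Sum>b\<in>I. 0 + (a \<bullet> b) * 0) (sqrt (\<Sum>b\<in>I. (\<bar>a \<bullet> b\<bar> * 1)\<^sup>2)))"
  proof (intro sum_indep_normal normal_density_affine)
    show "finite I" by (simp add: I_def)
    show "I \<noteq> {}" by fact
    have "indep_vars (\<lambda>_. borel) (\<lambda>b (x::real^'p). x \<bullet> b) I"
      by (rule indep_vars_subset[OF indep_vars_mvn_mat_1]) (auto simp: I_def)
    then show "indep_vars (\<lambda>_. borel) (\<lambda>b x. 0 + (a \<bullet> b) * (x \<bullet> b)) I"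
      by (rule indep_vars_compose2) simp
    fix b assume b: "b \<in> I"
    then show "a \<bullet> b \<noteq> 0" "0 < \<bar>a \<bullet> b\<bar> * 1" by (auto simp: I_def)
    show "distributed (mvn (mat 1)) lborel (\<lambda>x. x \<bullet> b) (normal_density 0 1)"
      using distr_mvn_mat_1_component[of b] b unfolding distributed_def
      by (auto simp: I_def cong: distr_cong)
  qed simp
  moreover have "(\<Sum>b\<in>I. (\<bar>a \<bullet> b\<bar> * 1)\<^sup>2) = (norm a)\<^sup>2"
    unfolding power2_norm_eq_inner euclidean_inner[of a a]
    by (rule sum.mono_neutral_cong_left) (auto simp: I_def power2_eq_square)
  moreover have "(\<Sum>b\<in>I. 0 + (a \<bullet> b) * (x \<bullet> b)) = a \<bullet> x" for x
    unfolding euclidean_inner[of a x]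
    by (rule sum.mono_neutral_cong_left) (auto simp: I_def)
  ultimately have "distributed (mvn (mat 1)) lborel (\<lambda>x. a \<bullet> x) (normal_density 0 (norm a))"
    by simp
  then show ?thesis by (simp add: distributed_def cong: distr_cong)
qed

text \<open>The change of variables theorem of the library requires a well-ordered index type, so linear
  images are handled through the uniqueness of translation-invariant measures.\<close>

lemma translation_invariant_nn_integral:
  fixes \<mu> :: "'a::euclidean_space measure"
  assumes sets [measurable_cong]: "sets \<mu> = sets borel" and "sigma_finite_measure \<mu>"
    and inv: "\<And>a. distr \<mu> borel ((+) a) = \<mu>"
  shows "\<exists>c. \<forall>f\<in>borel_measurable borel. (\<integral>\<^sup>+x. f x \<partial>\<mu>) = c * (\<integral>\<^sup>+x. f x \<partial>lborel)"
proof -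
  interpret \<mu>: sigma_finite_measure \<mu> by fact
  interpret pair_sigma_finite \<mu> lborel ..
  \<comment> \<open>B has positive finite Lebesgue measure, so that one can divide by it, and is
    symmetric about 0, so that y - x \<in> B iff x - y \<in> B.\<close>
  define B where "B = ball (0::'a) 1"
  have [measurable]: "B \<in> sets borel" by (simp add: B_def)
  have B: "emeasure lborel B \<noteq> 0" "emeasure lborel B \<noteq> \<infinity>"
    using content_ball_pos[of 1 "0::'a"] emeasure_lborel_ball_finite[of "0::'a" 1]
    by (auto simp: B_def measure_def)
  have shift\<mu>: "(\<integral>\<^sup>+x. f (a + x) \<partial>\<mu>) = (\<integral>\<^sup>+x. f x \<partial>\<mu>)" if [measurable]: "f \<in> borel_measurable borel" for f a
    by (subst (2) inv[of a, symmetric]) (simp add: nn_integral_distr)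
  have shift: "(\<integral>\<^sup>+x. f (a + x) \<partial>lborel) = (\<integral>\<^sup>+x. f x \<partial>lborel)" if [measurable]: "f \<in> borel_measurable borel" for f :: "'a \<Rightarrow> ennreal" and a
    by (subst (2) lborel_distr_plus[of a, symmetric]) (simp add: nn_integral_distr)
  \<comment> \<open>Uniqueness of an invariant measure: the integral of f (y + x), over x with
    respect to \<mu> and over y in B, is computed once by shifting x and once, after Fubini, by
    shifting y.\<close>
  have eq: "(\<integral>\<^sup>+x. f x \<partial>\<mu>) * emeasure lborel B = emeasure \<mu> B * (\<integral>\<^sup>+x. f x \<partial>lborel)"
    if [measurable]: "f \<in> borel_measurable borel" for f
  proof -
    have "(\<integral>\<^sup>+x. f x \<partial>\<mu>) * emeasure lborel B = (\<integral>\<^sup>+y. (\<integral>\<^sup>+x. f x \<partial>\<mu>) * indicator B y \<partial>lborel)"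
      by (simp add: nn_integral_cmult)
    also have "\<dots> = (\<integral>\<^sup>+y. (\<integral>\<^sup>+x. f (y + x) * indicator B y \<partial>\<mu>) \<partial>lborel)"
      by (intro nn_integral_cong) (simp add: nn_integral_multc shift\<mu>)
    also have "\<dots> = (\<integral>\<^sup>+x. (\<integral>\<^sup>+y. f (y + x) * indicator B y \<partial>lborel) \<partial>\<mu>)"
      by (rule Fubini') simp
    also have "\<dots> = (\<integral>\<^sup>+x. (\<integral>\<^sup>+y. f y * indicator B (y - x) \<partial>lborel) \<partial>\<mu>)"
    proof (rule nn_integral_cong)
      fix x
      show "(\<integral>\<^sup>+y. f (y + x) * indicator B y \<partial>lborel) = (\<integral>\<^sup>+y. f y * indicator B (y - x) \<partial>lborel)"
        using shift[of "\<lambda>y. f y * indicator B (y - x)" x] by (simp add: add.commute)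
    qed
    also have "\<dots> = (\<integral>\<^sup>+y. (\<integral>\<^sup>+x. f y * indicator B (y - x) \<partial>\<mu>) \<partial>lborel)"
      by (rule Fubini'[symmetric]) simp
    also have "\<dots> = (\<integral>\<^sup>+y. f y * emeasure \<mu> B \<partial>lborel)"
    proof (rule nn_integral_cong)
      fix y
      have "(\<integral>\<^sup>+x. f y * indicator B (y - x) \<partial>\<mu>) = f y * (\<integral>\<^sup>+x. indicator B (- y + x) \<partial>\<mu>)"
        by (subst nn_integral_cmult[symmetric])
           (auto intro!: nn_integral_cong simp: B_def indicator_def norm_minus_commute)
      also have "(\<integral>\<^sup>+x. indicator B (- y + x) \<partial>\<mu>) = emeasure \<mu> B"
        by (subst shift\<mu>) (simp_all add: sets)
      finally show "(\<integral>\<^sup>+x. f y * indicator B (y - x) \<partial>\<mu>) = f y * emeasure \<mu> B" .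
    qed
    also have "\<dots> = emeasure \<mu> B * (\<integral>\<^sup>+x. f x \<partial>lborel)"
      by (subst nn_integral_multc) (auto simp: mult.commute)
    finally show ?thesis .
  qed
  have "(\<integral>\<^sup>+x. f x \<partial>\<mu>) = (emeasure \<mu> B / emeasure lborel B) * (\<integral>\<^sup>+x. f x \<partial>lborel)"
    if f: "f \<in> borel_measurable borel" for f
  proof -
    have "(\<integral>\<^sup>+x. f x \<partial>\<mu>) = (\<integral>\<^sup>+x. f x \<partial>\<mu>) * emeasure lborel B / emeasure lborel B"
      using B by (simp add: ennreal_mult_divide_eq)
    also have "\<dots> = emeasure \<mu> B * (\<integral>\<^sup>+x. f x \<partial>lborel) / emeasure lborel B"
      by (simp only: eq[OF f])
    finally show ?thesis by (simp add: ennreal_times_divide mult.commute)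
  qed
  then show ?thesis by blast
qed

lemma borel_measurable_matrix_vector_mult [measurable]:
  "(\<lambda>x. (A :: real^'p^'q) *v x) \<in> borel_measurable borel"
  by (intro borel_measurable_continuous_onI continuous_intros)

text \<open>The image of Lebesgue measure under S is translation invariant, and sigma-finite because
  its image under R is Lebesgue measure again. The constant is the inverse of |det S|; it stays
  anonymous and is determined later by comparing total masses.\<close>

lemma nn_integral_linear_image:
  fixes S R :: "real^'p^'p"
  assumes RS: "R ** S = mat 1" and SR: "S ** R = mat 1"
  shows "\<exists>c. \<forall>f\<in>borel_measurable borel. (\<integral>\<^sup>+z. f (S *v z) \<partial>lborel) = c * (\<integral>\<^sup>+x. f x \<partial>lborel)"
proof -
  define \<mu> where "\<mu> = distr lborel borel (\<lambda>z. S *v z)"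
  have sets: "sets \<mu> = sets borel" by (simp add: \<mu>_def)
  have "distr \<mu> borel (\<lambda>z. R *v z) = distr lborel borel (\<lambda>z. z)"
    unfolding \<mu>_def by (subst distr_distr) (auto simp: comp_def matrix_vector_mul_assoc RS)
  also have "\<dots> = lborel" by (rule distr_id2) simp
  finally have "sigma_finite_measure (distr \<mu> borel (\<lambda>z. R *v z))"
    using sigma_finite_lborel by simp
  then have "sigma_finite_measure \<mu>"
    by (rule sigma_finite_measure_distr) (simp add: sets cong: measurable_cong_sets)
  moreover have "distr \<mu> borel ((+) a) = \<mu>" for a
  proof -
    have "distr \<mu> borel ((+) a) = distr lborel borel (\<lambda>z. S *v (R *v a + z))"
      unfolding \<mu>_def by (subst distr_distr) (auto simp: comp_def matrix_vector_right_distrib matrix_vector_mul_assoc SR)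
    also have "\<dots> = distr (distr lborel borel ((+) (R *v a))) borel (\<lambda>z. S *v z)"
      by (subst distr_distr) (auto simp: comp_def)
    also have "\<dots> = \<mu>" by (simp add: lborel_distr_plus \<mu>_def)
    finally show ?thesis .
  qed
  ultimately obtain c where "\<forall>f\<in>borel_measurable borel. (\<integral>\<^sup>+x. f x \<partial>\<mu>) = c * (\<integral>\<^sup>+x. f x \<partial>lborel)"
    using translation_invariant_nn_integral[OF sets] by blast
  then show ?thesis unfolding \<mu>_def by (intro exI[of _ c]) (simp add: nn_integral_distr)
qed

text \<open>If the determinant is not positive, the real square root is at most 0 and so is the
  quotient (division by 0 gives 0). Then \<open>ennreal\<close> produces the zero density, which
  contradicts mass 1.\<close>

lemma mvn_normaliser_pos:
  fixes J :: "real^'p^'p"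
  assumes "emeasure (mvn J) UNIV = 1"
  shows "0 < sqrt ((2 * pi) ^ CARD('p) * det J)"
proof (rule ccontr)
  assume "\<not> ?thesis"
  then have "exp (- (x \<bullet> (matrix_inv J *v x)) / 2) / sqrt ((2 * pi) ^ CARD('p) * det J) \<le> 0" for x
    by (intro divide_nonneg_nonpos) auto
  then have "mvn J = density lborel (\<lambda>x. 0)"
    unfolding mvn_def by (intro density_cong) (auto simp: ennreal_eq_0_iff)
  then show False using assms by (simp add: emeasure_density)
qed

text \<open>Unit mass is assumed in place of det J > 0: it is what weak convergence to
  \<open>mvn J\<close> supplies, and it already makes the normalising constant positive.\<close>

locale gaussian =
  fixes J :: "real^'p^'p"
  assumes sym: "transpose J = J" and psd: "\<And>x. 0 \<le> x \<bullet> (J *v x)"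
    and inv: "invertible J" and mass: "measure (mvn J) UNIV = 1"
begin

lemma mass': "emeasure (mvn J) UNIV = 1"
  using mass by (metis emeasure_eq_ennreal_measure ennreal_1 measure_def one_neq_zero zero_ennreal.rep_eq enn2real_top)

definition normaliser :: real where
  "normaliser = sqrt ((2 * pi) ^ CARD('p) * det J)"

lemma normaliser_pos: "0 < normaliser"
  unfolding normaliser_def by (rule mvn_normaliser_pos[OF mass'])

lemma mvn_density: "mvn J = density lborel (\<lambda>x. ennreal (exp (- (x \<bullet> (matrix_inv J *v x)) / 2) / normaliser))"
  unfolding mvn_def normaliser_def ..

sublocale prob_space "mvn J"
  by standard (simp add: mass')

text \<open>The substitution x = S z with S S = J turns the exponent into - z \<bullet> z / 2, so
  the two laws are proportional. Both have mass 1, so the factor \<open>k\<close> is 1.\<close>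

lemma mvn_distr: "mvn J = distr (mvn (mat 1)) borel (\<lambda>z. psd_sqrt J *v z)"
proof -
  define S where "S = psd_sqrt J"
  have S: "transpose S = S" "S ** S = J" unfolding S_def using psd_sqrt[OF sym psd] by auto
  \<comment> \<open>Because S S = J, this is a left inverse of S, and for square matrices a
    two-sided one.\<close>
  define R where "R = matrix_inv J ** S"
  have RS: "R ** S = mat 1" using matrix_inv(2)[OF inv] S(2) by (simp add: R_def matrix_mul_assoc[symmetric])
  then have SR: "S ** R = mat 1" using matrix_left_right_inverse by blast
  have quad: "(S *v z) \<bullet> (matrix_inv J *v (S *v z)) = z \<bullet> z" for z
  proof -
    have "(S *v z) \<bullet> (matrix_inv J *v (S *v z)) = (S *v z) \<bullet> (R *v z)" by (simp add: R_def matrix_vector_mul_assoc)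
    also have "\<dots> = z \<bullet> (S *v (R *v z))" by (rule transpose_eq_imp_selfadjoint[OF S(1)])
    finally show ?thesis by (simp add: matrix_vector_mul_assoc SR)
  qed
  interpret std: prob_space "mvn (mat 1 :: real^'p^'p)" by (rule prob_space_mvn_mat_1)
  define D1 where "D1 = sqrt ((2 * pi) ^ CARD('p) * det (mat 1 :: real^'p^'p))"
  have D1: "0 < D1" by (simp add: D1_def)
  from nn_integral_linear_image[OF RS SR] obtain c where
    c: "\<And>f. f \<in> borel_measurable borel \<Longrightarrow> (\<integral>\<^sup>+z. f (S *v z) \<partial>lborel) = c * (\<integral>\<^sup>+x. f x \<partial>lborel)" by blast
  define k where "k = ennreal (normaliser / D1) * c"
  have scale: "emeasure (distr (mvn (mat 1)) borel (\<lambda>z. S *v z)) A = k * emeasure (mvn J) A" if [measurable]: "A \<in> sets borel" for A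
  proof -
    have [measurable]: "(\<lambda>z. S *v z) -` A \<in> sets borel"
      by (rule measurable_sets_borel[OF borel_measurable_matrix_vector_mult]) fact
    have "emeasure (distr (mvn (mat 1)) borel (\<lambda>z. S *v z)) A = emeasure (mvn (mat 1)) ((\<lambda>z. S *v z) -` A)"
      by (subst emeasure_distr) auto
    also have "\<dots> = (\<integral>\<^sup>+z. ennreal (exp (- (z \<bullet> z) / 2) / D1) * indicator A (S *v z) \<partial>lborel)"
      unfolding mvn_def matrix_inv_mat_1 D1_def
      by (subst emeasure_density) (auto intro!: nn_integral_cong simp: indicator_def measurable_sets_borel)
    also have "\<dots> = (\<integral>\<^sup>+z. ennreal (normaliser / D1) * (ennreal (exp (- ((S *v z) \<bullet> (matrix_inv J *v (S *v z))) / 2) / normaliser) * indicator A (S *v z)) \<partial>lborel)"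
      unfolding quad using normaliser_pos D1
      by (intro nn_integral_cong) (auto simp: indicator_def ennreal_mult'[symmetric])
    also have "\<dots> = k * (\<integral>\<^sup>+x. ennreal (exp (- (x \<bullet> (matrix_inv J *v x)) / 2) / normaliser) * indicator A x \<partial>lborel)"
      by (subst nn_integral_cmult, measurable)
         (subst c[of "\<lambda>x. ennreal (exp (- (x \<bullet> (matrix_inv J *v x)) / 2) / normaliser) * indicator A x"], auto simp: k_def mult.assoc)
    also have "\<dots> = k * emeasure (mvn J) A"
      unfolding mvn_density by (subst emeasure_density) auto
    finally show ?thesis .
  qed
  have "emeasure (distr (mvn (mat 1)) borel (\<lambda>z. S *v z)) UNIV = 1"
    using std.emeasure_space_1 by (subst emeasure_distr) auto
  then have "k = 1" using scale[of UNIV] mass' by simp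
  show ?thesis
    by (rule measure_eqI) (use scale \<open>k = 1\<close> in \<open>auto simp: S_def\<close>)
qed

text \<open>Moving S = \<open>psd_sqrt J\<close> across the inner product turns the linear form into
  (S v) \<bullet> z with z standard normal, of variance |S v|^2. Invertibility of J keeps S v
  nonzero.\<close>

lemma distr_inner:
  assumes "v \<noteq> 0"
  shows "distr (mvn J) borel (\<lambda>w. v \<bullet> w) = density lborel (normal_density 0 (sqrt (v \<bullet> (J *v v))))"
    and "0 < v \<bullet> (J *v v)"
proof -
  define S where "S = psd_sqrt J"
  have S: "transpose S = S" "S ** S = J" unfolding S_def using psd_sqrt[OF sym psd] by auto
  have norm: "v \<bullet> (J *v v) = (norm (S *v v))\<^sup>2"
    using transpose_eq_imp_selfadjoint[OF S(1), of v "S *v v"] S(2)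
    by (simp add: power2_norm_eq_inner matrix_vector_mul_assoc)
  have "S *v v \<noteq> 0"
  proof
    assume "S *v v = 0"
    then have "J *v v = 0" using S(2) by (metis matrix_vector_mul_assoc matrix_vector_mult_0_right)
    then have "matrix_inv J *v (J *v v) = 0" by simp
    then show False using assms matrix_inv(2)[OF inv] by (simp add: matrix_vector_mul_assoc)
  qed
  then show "0 < v \<bullet> (J *v v)" unfolding norm by simp
  have eq: "(\<lambda>z. v \<bullet> (S *v z)) = (\<lambda>z. (S *v v) \<bullet> z)"
    by (simp add: fun_eq_iff transpose_eq_imp_selfadjoint[OF S(1)])
  have "distr (mvn J) borel (\<lambda>w. v \<bullet> w) = distr (mvn (mat 1)) borel (\<lambda>z. (S *v v) \<bullet> z)"
    unfolding mvn_distr S_def[symmetric] by (subst distr_distr) (auto simp: comp_def eq)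
  also have "\<dots> = density lborel (normal_density 0 (norm (S *v v)))"
    by (rule distr_mvn_mat_1_inner) fact
  finally show "distr (mvn J) borel (\<lambda>w. v \<bullet> w) = density lborel (normal_density 0 (sqrt (v \<bullet> (J *v v))))"
    by (simp add: norm)
qed

lemma inner_moments:
  shows "integrable (mvn J) (\<lambda>w. v \<bullet> w)" "(LINT w|mvn J. v \<bullet> w) = 0"
    and "integrable (mvn J) (\<lambda>w. (v \<bullet> w)\<^sup>2)" "(LINT w|mvn J. (v \<bullet> w)\<^sup>2) = v \<bullet> (J *v v)"
proof -
  have "integrable (mvn J) (\<lambda>w. v \<bullet> w) \<and> (LINT w|mvn J. v \<bullet> w) = 0 \<and>
    integrable (mvn J) (\<lambda>w. (v \<bullet> w)\<^sup>2) \<and> (LINT w|mvn J. (v \<bullet> w)\<^sup>2) = v \<bullet> (J *v v)"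
  \<comment> \<open>The zero form has variance 0 and no normal density, so it is treated
    apart.\<close>
  proof (cases "v = 0")
    case False
    note d = distr_inner[OF this]
    define s where "s = sqrt (v \<bullet> (J *v v))"
    have s: "0 < s" "s\<^sup>2 = v \<bullet> (J *v v)" using d(2) by (auto simp: s_def)
    let ?N = "density lborel (\<lambda>x. ennreal (normal_density 0 s x))"
    have d': "distr (mvn J) borel (\<lambda>w. v \<bullet> w) = ?N" using d(1) by (simp add: s_def)
    have tr: "integrable (mvn J) (\<lambda>w. g (v \<bullet> w)) \<longleftrightarrow> integrable lborel (\<lambda>x. normal_density 0 s x * g x)"
      "(LINT w|mvn J. g (v \<bullet> w)) = (LINT x|lborel. normal_density 0 s x * g x)"
      if [measurable]: "g \<in> borel_measurable borel" for g :: "real \<Rightarrow> real"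
    proof -
      show "integrable (mvn J) (\<lambda>w. g (v \<bullet> w)) \<longleftrightarrow> integrable lborel (\<lambda>x. normal_density 0 s x * g x)"
        using integrable_distr_eq[of "\<lambda>w. v \<bullet> w" "mvn J" borel g] unfolding d'
        by (simp add: integrable_density)
      show "(LINT w|mvn J. g (v \<bullet> w)) = (LINT x|lborel. normal_density 0 s x * g x)"
        using integral_distr[of "\<lambda>w. v \<bullet> w" "mvn J" borel g] unfolding d'
        by (simp add: integral_density)
    qed
    show ?thesis
      using tr[of "\<lambda>x. x"] tr[of "\<lambda>x. x\<^sup>2"] s
        integrable_normal_moment_nz_1[OF s(1), of 0] integral_normal_moment_nz_1[OF s(1), of 0]
        integrable_normal_moment[OF s(1), of 0 2] integral_normal_moment_even[OF s(1), of 0 1]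
      by (auto simp: numeral_2_eq_2)
  qed simp
  then show "integrable (mvn J) (\<lambda>w. v \<bullet> w)" "(LINT w|mvn J. v \<bullet> w) = 0"
    "integrable (mvn J) (\<lambda>w. (v \<bullet> w)\<^sup>2)" "(LINT w|mvn J. (v \<bullet> w)\<^sup>2) = v \<bullet> (J *v v)" by blast+
qed

lemma component_moments:
  shows "integrable (mvn J) (\<lambda>w. w $ a)" "(LINT w|mvn J. w $ a) = 0"
    and "integrable (mvn J) (\<lambda>w. w $ a * w $ b)" "(LINT w|mvn J. w $ a * w $ b) = J $ a $ b"
proof -
  show "integrable (mvn J) (\<lambda>w. w $ a)" "(LINT w|mvn J. w $ a) = 0"
    using inner_moments(1,2)[of "axis a 1"] by (auto simp: inner_axis')
  \<comment> \<open>Polarisation: a mixed moment is a difference of second moments of linear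
    forms.\<close>
  have eq: "w $ a * w $ b = (((axis a 1 + axis b 1) \<bullet> w)\<^sup>2 - ((axis a 1 - axis b 1) \<bullet> w)\<^sup>2) / 4" for w :: "real^'p"
    by (simp add: inner_axis' inner_add_left inner_diff_left power2_eq_square algebra_simps)
  show "integrable (mvn J) (\<lambda>w. w $ a * w $ b)"
    unfolding eq by (intro integrable_divide_zero Bochner_Integration.integrable_diff inner_moments(3))
  have J: "J $ b $ a = J $ a $ b" using sym by (metis transpose_def vec_lambda_beta)
  have "(LINT w|mvn J. w $ a * w $ b) = ((axis a 1 + axis b 1) \<bullet> (J *v (axis a 1 + axis b 1)) - (axis a 1 - axis b 1) \<bullet> (J *v (axis a 1 - axis b 1))) / 4"
    unfolding eq using inner_moments(3,4)[of "axis a 1 + axis b 1"] inner_moments(3,4)[of "axis a 1 - axis b 1"]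
    by simp
  also have "\<dots> = J $ a $ b"
    using J by (simp add: matrix_vector_right_distrib matrix_vector_mult_diff_distrib inner_add_left inner_diff_left
        inner_axis' matrix_vector_mul_component row_def inner_axis)
  finally show "(LINT w|mvn J. w $ a * w $ b) = J $ a $ b" .
qed

text \<open>The terms linear in w have mean 0, so the shift contributes only its own value. The
  remaining sum is the trace of D J, the source of the constant that the bias term removes at scale
  n.\<close>

lemma shifted_quadratic_moment:
  "(LINT w|mvn J. (x + w) \<bullet> (D *v (x + w))) = x \<bullet> (D *v x) + (\<Sum>a\<in>UNIV. \<Sum>b\<in>UNIV. D $ a $ b * J $ a $ b)"
proof -
  have "(x + w) \<bullet> (D *v (x + w)) = x \<bullet> (D *v x) + (\<Sum>a\<in>UNIV. \<Sum>b\<in>UNIV. (x $ a * D $ a $ b) * w $ b)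
      + (\<Sum>a\<in>UNIV. \<Sum>b\<in>UNIV. (x $ b * D $ a $ b) * w $ a) + (\<Sum>a\<in>UNIV. \<Sum>b\<in>UNIV. D $ a $ b * (w $ a * w $ b))" for w
    unfolding inner_matrix_vector by (simp add: sum.distrib[symmetric] algebra_simps)
  then show ?thesis
    by (simp add: component_moments mass)
qed

lemma integrable_one_plus_norm_sq: "integrable (mvn J) (\<lambda>w. 1 + (norm w)\<^sup>2)"
  unfolding power2_norm_eq_inner inner_vec_def by (simp add: component_moments)

lemma lborel_integral:
  assumes [measurable]: "F \<in> borel_measurable borel"
  shows "(LINT x|lborel. exp (- (x \<bullet> (matrix_inv J *v x)) / 2) * F x) = normaliser * (LINT x|mvn J. F x)"
proof -
  have "(LINT x|mvn J. F x) = (LINT x|lborel. (exp (- (x \<bullet> (matrix_inv J *v x)) / 2) / normaliser) * F x)"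
    unfolding mvn_density using normaliser_pos by (subst integral_density) auto
  also have "\<dots> = (LINT x|lborel. exp (- (x \<bullet> (matrix_inv J *v x)) / 2) * F x) / normaliser"
    by (simp add: field_simps)
  finally show ?thesis using normaliser_pos by simp
qed

end

section \<open>Laplace's method along a sequence of log-likelihoods\<close>

text \<open>Stated without a measurability hypothesis: if f is not measurable, neither side is
  integrable and both integrals are 0 by convention.\<close>

lemma lborel_rescale:
  fixes f :: "'a::euclidean_space \<Rightarrow> real"
  assumes "0 < c"
  shows "integrable lborel (\<lambda>x. f (t + c *\<^sub>R x)) \<longleftrightarrow> integrable lborel f" (is ?int)
    and "(LINT u|lborel. f u) = c ^ DIM('a) * (LINT x|lborel. f (t + c *\<^sub>R x))" (is ?eq)
proof -
  have meas: "f \<in> borel_measurable borel" if "(\<lambda>x. f (t + c *\<^sub>R x)) \<in> borel_measurable borel"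
  proof -
    have "(\<lambda>u. f (t + c *\<^sub>R ((1 / c) *\<^sub>R (u - t)))) \<in> borel_measurable borel"
      by (rule measurable_compose[OF _ that]) measurable
    then show ?thesis using assms by simp
  qed
  have dens: "lborel = density (distr lborel borel (\<lambda>x. t + c *\<^sub>R x)) (\<lambda>_. ennreal (c ^ DIM('a)))"
    using lborel_affine[of c t] assms by (simp add: ennreal_power)
  have *: "integrable lborel f \<longleftrightarrow> integrable lborel (\<lambda>x. f (t + c *\<^sub>R x))"
    "(LINT u|lborel. f u) = c ^ DIM('a) * (LINT x|lborel. f (t + c *\<^sub>R x))"
    if [measurable]: "f \<in> borel_measurable borel"
  proof -
    let ?D = "density (distr lborel borel (\<lambda>x. t + c *\<^sub>R x)) (\<lambda>_. ennreal (c ^ DIM('a)))"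
    have "integrable lborel f = integrable ?D f" by (subst dens) (rule refl)
    also have "\<dots> = integrable lborel (\<lambda>x. f (t + c *\<^sub>R x))"
      using assms by (simp add: integrable_density integrable_distr_eq)
    finally show "integrable lborel f \<longleftrightarrow> integrable lborel (\<lambda>x. f (t + c *\<^sub>R x))" .
    have "(LINT u|lborel. f u) = (LINT u|?D. f u)" by (subst dens) (rule refl)
    also have "\<dots> = c ^ DIM('a) * (LINT x|lborel. f (t + c *\<^sub>R x))"
      using assms by (simp add: integral_density integral_distr)
    finally show "(LINT u|lborel. f u) = c ^ DIM('a) * (LINT x|lborel. f (t + c *\<^sub>R x))" .
  qed
  have not: "\<not> integrable lborel f" "\<not> integrable lborel (\<lambda>x. f (t + c *\<^sub>R x))"
    if f: "f \<notin> borel_measurable borel"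
  proof -
    show "\<not> integrable lborel f"
      using f borel_measurable_integrable[of lborel f] by auto
    show "\<not> integrable lborel (\<lambda>x. f (t + c *\<^sub>R x))"
    proof
      assume "integrable lborel (\<lambda>x. f (t + c *\<^sub>R x))"
      from borel_measurable_integrable[OF this] have "(\<lambda>x. f (t + c *\<^sub>R x)) \<in> borel_measurable borel" by simp
      from meas[OF this] f show False by contradiction
    qed
  qed
  show ?int
  proof (cases "f \<in> borel_measurable borel")
    case True
    then show ?thesis by (rule *(1)[symmetric])
  next
    case False
    show ?thesis by (simp only: not[OF False])
  qed
  show ?eq
  proof (cases "f \<in> borel_measurable borel")
    case True
    then show ?thesis by (rule *(2))
  next
    case False
    show ?thesis using not[OF False] by (simp add: not_integrable_integral_eq)
  qed
qed

lemma gaussian_mat_1: "gaussian (mat 1 :: real^'p^'p)"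
proof
  show "measure (mvn (mat 1 :: real^'p^'p)) UNIV = 1"
    using prob_space.prob_space[OF prob_space_mvn_mat_1] by simp
qed (auto simp: transpose_mat invertible_def)

text \<open>The dominating function of the Laplace argument. Rescaling reduces it to the second
  moment of the standard normal law.\<close>

lemma integrable_quadratic_exp:
  fixes a :: real
  assumes "0 < a"
  shows "integrable lborel (\<lambda>x::real^'p. exp (- (a * (norm x)\<^sup>2)) * (1 + (norm x)\<^sup>2))"
proof -
  interpret gaussian "mat 1 :: real^'p^'p" by (rule gaussian_mat_1)
  have "integrable lborel (\<lambda>x::real^'p. (exp (- (x \<bullet> x) / 2) / normaliser) * (1 + (norm x)\<^sup>2))"
    using integrable_one_plus_norm_sq normaliser_pos unfolding mvn_density matrix_inv_mat_1
    by (simp add: integrable_density)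
  then have int0: "integrable lborel (\<lambda>x::real^'p. normaliser * ((exp (- (x \<bullet> x) / 2) / normaliser) * (1 + (norm x)\<^sup>2)))"
    by (rule integrable_mult_right)
  have int: "integrable lborel (\<lambda>x::real^'p. exp (- (x \<bullet> x) / 2) * (1 + (norm x)\<^sup>2))"
  proof -
    have "normaliser * (e / normaliser * p) = e * p" for e p :: real using normaliser_pos by simp
    with int0 show ?thesis by (simp only:)
  qed
  \<comment> \<open>Replacing x by c x turns exp (- x \<bullet> x / 2) into exp (- a |x|^2).\<close>
  define c where "c = sqrt (2 * a)"
  have c: "0 < c" "c\<^sup>2 = 2 * a" using assms by (auto simp: c_def)
  have "integrable lborel (\<lambda>x::real^'p. exp (- ((0 + c *\<^sub>R x) \<bullet> (0 + c *\<^sub>R x)) / 2) * (1 + (norm (0 + c *\<^sub>R x))\<^sup>2))"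
    by (subst lborel_rescale(1)[OF c(1)]) (rule int)
  then have int2: "integrable lborel (\<lambda>x::real^'p. exp (- (a * (norm x)\<^sup>2)) * (1 + c\<^sup>2 * (norm x)\<^sup>2))"
    using c by (simp add: power2_norm_eq_inner power_mult_distrib mult.assoc[symmetric] power2_eq_square[symmetric])
  have "integrable lborel (\<lambda>x::real^'p. (1 + 1 / c\<^sup>2) * (exp (- (a * (norm x)\<^sup>2)) * (1 + c\<^sup>2 * (norm x)\<^sup>2)))"
    using int2 by (rule integrable_mult_right)
  then show ?thesis
  proof (rule Bochner_Integration.integrable_bound)
    show "AE x::real^'p in lborel. norm (exp (- (a * (norm x)\<^sup>2)) * (1 + (norm x)\<^sup>2))
      \<le> norm ((1 + 1 / c\<^sup>2) * (exp (- (a * (norm x)\<^sup>2)) * (1 + c\<^sup>2 * (norm x)\<^sup>2)))"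
    proof (rule AE_I2)
      fix x :: "real^'p"
      have "1 + (norm x)\<^sup>2 \<le> (1 + 1 / c\<^sup>2) * (1 + c\<^sup>2 * (norm x)\<^sup>2)"
        using c(1) by (simp add: field_simps)
      then have "exp (- (a * (norm x)\<^sup>2)) * (1 + (norm x)\<^sup>2) \<le> exp (- (a * (norm x)\<^sup>2)) * ((1 + 1 / c\<^sup>2) * (1 + c\<^sup>2 * (norm x)\<^sup>2))"
        by (intro mult_left_mono) auto
      then show "norm (exp (- (a * (norm x)\<^sup>2)) * (1 + (norm x)\<^sup>2))
        \<le> norm ((1 + 1 / c\<^sup>2) * (exp (- (a * (norm x)\<^sup>2)) * (1 + c\<^sup>2 * (norm x)\<^sup>2)))"
        using c(1) by (simp add: abs_mult mult_ac)
    qed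
  qed simp
qed

text \<open>A single sample viewed along a subsequence: \<open>L k\<close> is its log-likelihood at
  sample size \<open>N k\<close>, and \<open>T k\<close> a maximiser for large k. Convergence of the
  Hessians is asked for at \<theta> alone; the bound on third derivatives carries it to a
  neighbourhood.\<close>

locale laplace_sequence =
  fixes \<Theta> :: "(real^'p) set" and \<theta> :: "real^'p" and I :: "real^'p^'p"
    and L :: "nat \<Rightarrow> real^'p \<Rightarrow> real" and N :: "nat \<Rightarrow> real" and T :: "nat \<Rightarrow> real^'p"
    and \<epsilon> M :: real
  assumes open_\<Theta>: "open \<Theta>" and \<theta>: "\<theta> \<in> \<Theta>"
    and smooth: "\<And>k. Ck_on 3 (L k) \<Theta>"
    and N: "filterlim N at_top sequentially"
    and ball: "0 < \<epsilon>" "ball \<theta> \<epsilon> \<subseteq> \<Theta>"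
    and third: "\<forall>\<^sub>F k in sequentially. \<forall>u\<in>ball \<theta> \<epsilon>. \<forall>a b c. \<bar>partials [a, b, c] (L k) u\<bar> \<le> M * N k"
    and hess: "\<And>a b. (\<lambda>k. partials [a, b] (L k) \<theta> / N k) \<longlonglongrightarrow> - I $ a $ b"
    and outer: "\<And>\<delta>. 0 < \<delta> \<Longrightarrow> ball \<theta> \<delta> \<subseteq> \<Theta> \<Longrightarrow>
      \<exists>c>0. \<forall>\<^sub>F k in sequentially. \<forall>u\<in>\<Theta> - ball \<theta> \<delta>. L k u - L k \<theta> \<le> - c * N k"
    and max: "\<forall>\<^sub>F k in sequentially. T k \<in> \<Theta> \<and> (\<forall>u\<in>\<Theta>. L k u \<le> L k (T k))"
    and inv: "invertible I"
begin

lemma N_pos: "\<forall>\<^sub>F k in sequentially. 0 < N k"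
  using N eventually_gt_at_top filterlim_iff by blast

text \<open>By \<open>outer\<close>, a maximiser outside a ball around \<theta> would have a smaller
  likelihood than \<theta> itself.\<close>

lemma T_tendsto: "T \<longlonglongrightarrow> \<theta>"
proof (rule tendstoI)
  fix e :: real assume "0 < e"
  define \<delta> where "\<delta> = min e \<epsilon>"
  have \<delta>: "0 < \<delta>" "ball \<theta> \<delta> \<subseteq> \<Theta>" using \<open>0 < e\<close> ball by (auto simp: \<delta>_def)
  from outer[OF this] obtain c where "0 < c" and
    c: "\<forall>\<^sub>F k in sequentially. \<forall>u\<in>\<Theta> - ball \<theta> \<delta>. L k u - L k \<theta> \<le> - c * N k" by blast
  from max N_pos c show "\<forall>\<^sub>F k in sequentially. dist (T k) \<theta> < e"
  proof eventually_elim
    case (elim k)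
    have "T k \<in> ball \<theta> \<delta>"
    proof (rule ccontr)
      assume "T k \<notin> ball \<theta> \<delta>"
      then have "L k (T k) - L k \<theta> \<le> - c * N k" using elim by blast
      moreover have "- c * N k < 0" using elim \<open>0 < c\<close> by simp
      moreover have "L k \<theta> \<le> L k (T k)" using elim \<theta> by blast
      ultimately show False by linarith
    qed
    then show ?case by (simp add: \<delta>_def dist_commute)
  qed
qed

lemma T_ball: "0 < \<delta> \<Longrightarrow> \<forall>\<^sub>F k in sequentially. T k \<in> ball \<theta> \<delta>"
  using tendstoD[OF T_tendsto, of \<delta>] by (simp add: dist_commute)

lemma M_nonneg: "0 \<le> M"
proof -
  have "\<forall>\<^sub>F k in sequentially. 0 \<le> M"
    using third N_pos
  proof eventually_elim
    case (elim k)
    have "0 \<le> M * N k" using elim(1) ball(1) by (meson abs_ge_zero centre_in_ball order_trans)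
    then show ?case using elim(2) by (simp add: zero_le_mult_iff)
  qed
  then show ?thesis by simp
qed

text \<open>Mean value inequality with the third derivatives; each of the p directions contributes
  at most M N to the derivative of an entry.\<close>

lemma hess_near: "\<forall>\<^sub>F k in sequentially. \<forall>u\<in>ball \<theta> \<epsilon>. \<forall>a b.
    \<bar>partials [a, b] (L k) u / N k - partials [a, b] (L k) \<theta> / N k\<bar> \<le> M * CARD('p) * norm (u - \<theta>)"
  using third N_pos
proof eventually_elim
  case (elim k)
  show ?case
  proof (intro ballI allI)
    fix u a b assume u: "u \<in> ball \<theta> \<epsilon>"
    have "norm (partials [a, b] (L k) u - partials [a, b] (L k) \<theta>) \<le> (M * N k * CARD('p)) * norm (u - \<theta>)"
    proof (rule differentiable_bound[of "ball \<theta> \<epsilon>" "partials [a, b] (L k)" "\<lambda>x h. \<Sum>c\<in>UNIV. h $ c * partials [c, a, b] (L k) x"])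
      fix x assume x: "x \<in> ball \<theta> \<epsilon>"
      have "(partials [a, b] (L k) has_derivative (\<lambda>h. \<Sum>c\<in>UNIV. h $ c * partials [c, a, b] (L k) x)) (at x)"
        by (rule Ck_on_has_derivative[OF open_\<Theta> smooth]) (use x ball in auto)
      then show "(partials [a, b] (L k) has_derivative (\<lambda>h. \<Sum>c\<in>UNIV. h $ c * partials [c, a, b] (L k) x)) (at x within ball \<theta> \<epsilon>)"
        by (rule has_derivative_at_withinI)
      show "onorm (\<lambda>h. \<Sum>c\<in>UNIV. h $ c * partials [c, a, b] (L k) x) \<le> M * N k * CARD('p)"
      proof (rule onorm_bound)
        show "0 \<le> M * N k * CARD('p)" using M_nonneg elim(2) by simp
        fix h :: "real^'p"
        have "norm (\<Sum>c\<in>UNIV. h $ c * partials [c, a, b] (L k) x) \<le> (\<Sum>c\<in>(UNIV::'p set). norm h * (M * N k))"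
        proof (rule sum_norm_le)
          fix c
          have "\<bar>h $ c\<bar> * \<bar>partials [c, a, b] (L k) x\<bar> \<le> norm h * (M * N k)"
            using elim(1) x by (intro mult_mono component_le_norm_cart) auto
          then show "norm (h $ c * partials [c, a, b] (L k) x) \<le> norm h * (M * N k)"
            by (simp only: real_norm_def abs_mult)
        qed
        then show "norm (\<Sum>c\<in>UNIV. h $ c * partials [c, a, b] (L k) x) \<le> M * N k * CARD('p) * norm h"
          by (simp add: mult_ac del: partials.simps)
      qed
    qed (use u ball in \<open>simp_all del: partials.simps\<close>)
    then have "\<bar>partials [a, b] (L k) u - partials [a, b] (L k) \<theta>\<bar> / N k \<le> (M * N k * CARD('p)) * norm (u - \<theta>) / N k"
      using elim(2) by (intro divide_right_mono) (auto simp del: partials.simps)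
    then show "\<bar>partials [a, b] (L k) u / N k - partials [a, b] (L k) \<theta> / N k\<bar> \<le> M * CARD('p) * norm (u - \<theta>)"
      using elim(2) by (simp add: diff_divide_distrib[symmetric] del: partials.simps)
  qed
qed

lemma hess_uniform:
  assumes "0 < e"
  shows "\<exists>\<delta>>0. \<delta> \<le> \<epsilon> \<and> (\<forall>\<^sub>F k in sequentially. \<forall>u\<in>ball \<theta> \<delta>. \<forall>x.
    \<bar>x \<bullet> (hessian (L k) u *v x) / N k + x \<bullet> (I *v x)\<bar> \<le> e * (norm x)\<^sup>2)"
proof -
  define e' where "e' = e / (2 * (real CARD('p))\<^sup>2)"
  have "0 < e'" using assms by (simp add: e'_def)
  \<comment> \<open>Half of the entrywise tolerance 2 e' is spent on moving from u to \<theta>, half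
    on the convergence at \<theta>. The added 1 covers M = 0.\<close>
  define \<delta> where "\<delta> = min \<epsilon> (e' / (M * CARD('p) + 1))"
  have K: "0 < M * CARD('p) + 1" using M_nonneg by (simp add: add_nonneg_pos)
  have \<delta>: "0 < \<delta>" "\<delta> \<le> \<epsilon>" using ball K \<open>0 < e'\<close> by (auto simp: \<delta>_def)
  have "M * CARD('p) * \<delta> \<le> (M * CARD('p) + 1) * (e' / (M * CARD('p) + 1))"
    using M_nonneg K \<delta> by (intro mult_mono) (auto simp: \<delta>_def)
  then have \<delta>': "M * CARD('p) * \<delta> \<le> e'" using K by simp
  have "\<forall>\<^sub>F k in sequentially. \<forall>a b. \<bar>partials [a, b] (L k) \<theta> / N k + I $ a $ b\<bar> < e'"
    using tendstoD[OF hess \<open>0 < e'\<close>]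
    by (intro eventually_all_finite) (simp add: dist_real_def del: partials.simps)
  with hess_near have "\<forall>\<^sub>F k in sequentially. \<forall>u\<in>ball \<theta> \<delta>. \<forall>x.
    \<bar>x \<bullet> (hessian (L k) u *v x) / N k + x \<bullet> (I *v x)\<bar> \<le> e * (norm x)\<^sup>2"
  proof eventually_elim
    case (elim k)
    show ?case
    proof (intro ballI allI)
      fix u x assume u: "u \<in> ball \<theta> \<delta>"
      have "x \<bullet> (hessian (L k) u *v x) / N k + x \<bullet> (I *v x) = x \<bullet> (((1 / N k) *\<^sub>R hessian (L k) u + I) *v x)"
        by (simp add: matrix_vector_mult_add_rdistrib scaleR_matrix_vector_assoc[symmetric] inner_add_right)
      also have "\<bar>\<dots>\<bar> \<le> (2 * e') * (real CARD('p))\<^sup>2 * (norm x)\<^sup>2"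
      proof (rule matrix_quadratic_bound)
        fix a b
        have "u \<in> ball \<theta> \<epsilon>" using u \<delta> by auto
        then have "\<bar>partials [a, b] (L k) u / N k - partials [a, b] (L k) \<theta> / N k\<bar> \<le> M * CARD('p) * norm (u - \<theta>)"
          using elim(1) by blast
        also have "\<dots> \<le> M * CARD('p) * \<delta>"
          using u M_nonneg by (intro mult_left_mono) (auto simp: dist_norm norm_minus_commute)
        also note \<delta>'
        finally show "\<bar>((1 / N k) *\<^sub>R hessian (L k) u + I) $ a $ b\<bar> \<le> 2 * e'"
          using elim(2)[rule_format, of a b] by (simp add: hessian_def del: partials.simps)
      qed
      also have "\<dots> = e * (norm x)\<^sup>2" by (simp add: e'_def)
      finally show "\<bar>x \<bullet> (hessian (L k) u *v x) / N k + x \<bullet> (I *v x)\<bar> \<le> e * (norm x)\<^sup>2" .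
    qed
  qed
  with \<delta> show ?thesis by blast
qed

lemma hess_tendsto:
  assumes "u \<longlonglongrightarrow> \<theta>"
  shows "(\<lambda>k. x \<bullet> (hessian (L k) (u k) *v x) / N k) \<longlonglongrightarrow> - (x \<bullet> (I *v x))"
proof (rule tendstoI)
  fix e :: real assume "0 < e"
  define e' where "e' = e / (1 + (norm x)\<^sup>2)"
  have e': "0 < e'" "e' * (norm x)\<^sup>2 < e"
  proof -
    have "0 < 1 + (norm x)\<^sup>2" by (simp add: add_pos_nonneg)
    then show "0 < e'" "e' * (norm x)\<^sup>2 < e" using \<open>0 < e\<close> by (auto simp: e'_def field_simps)
  qed
  from hess_uniform[OF this(1)] obtain \<delta> where \<delta>: "0 < \<delta>"
    "\<forall>\<^sub>F k in sequentially. \<forall>u\<in>ball \<theta> \<delta>. \<forall>x.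
      \<bar>x \<bullet> (hessian (L k) u *v x) / N k + x \<bullet> (I *v x)\<bar> \<le> e' * (norm x)\<^sup>2" by blast
  have "\<forall>\<^sub>F k in sequentially. u k \<in> ball \<theta> \<delta>"
    using tendstoD[OF assms \<delta>(1)] by (simp add: dist_commute)
  with \<delta>(2) show "\<forall>\<^sub>F k in sequentially. dist (x \<bullet> (hessian (L k) (u k) *v x) / N k) (- (x \<bullet> (I *v x))) < e"
  proof eventually_elim
    case (elim k)
    then have "\<bar>x \<bullet> (hessian (L k) (u k) *v x) / N k + x \<bullet> (I *v x)\<bar> \<le> e' * (norm x)\<^sup>2" by blast
    with e'(2) show ?case by (simp add: dist_real_def)
  qed
qed

text \<open>Inherited in the limit from the symmetric Hessians of \<open>L k\<close>.\<close>

lemma I_sym: "transpose I = I"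
proof -
  have "I $ b $ a = I $ a $ b" for a b
  proof -
    have "partials [b, a] (L k) \<theta> = partials [a, b] (L k) \<theta>" for k
      by (rule partials_commute[OF open_\<Theta> Ck_on_mono[OF smooth] \<theta>]) auto
    then have "(\<lambda>k. partials [b, a] (L k) \<theta> / N k) = (\<lambda>k. partials [a, b] (L k) \<theta> / N k)"
      by (simp only:)
    with hess[of b a] hess[of a b] have "- I $ b $ a = - I $ a $ b"
      by (metis LIMSEQ_unique)
    then show ?thesis by simp
  qed
  then show ?thesis by (simp add: transpose_def vec_eq_iff)
qed

text \<open>At the maximiser the gradient vanishes, so only the quadratic Taylor term remains.\<close>

lemma taylor_at_max:
  "\<forall>\<^sub>F k in sequentially. \<forall>u\<in>ball \<theta> \<epsilon>. \<exists>t. 0 < t \<and> t < 1 \<and>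
    L k u - L k (T k) = ((u - T k) \<bullet> (hessian (L k) (T k + t *\<^sub>R (u - T k)) *v (u - T k))) / 2"
  using max T_ball[OF ball(1)]
proof eventually_elim
  case (elim k)
  have C2: "Ck_on 2 (L k) \<Theta>" using Ck_on_mono[OF smooth] by simp
  have "(L k has_derivative (\<lambda>h. \<Sum>a\<in>UNIV. h $ a * partials [a] (L k) (T k))) (at (T k))"
    using Ck_on_has_derivative[OF open_\<Theta> C2, of "T k" "[]"] elim by simp
  then have "(\<lambda>h. \<Sum>a\<in>UNIV. h $ a * partials [a] (L k) (T k)) = (\<lambda>h. 0)"
    using elim open_\<Theta> by (intro differential_zero_maxmin[of "T k" \<Theta> "L k"]) auto
  then have grad: "grad (L k) (T k) \<bullet> h = 0" for h
    unfolding inner_grad by (rule fun_cong)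
  show ?case
  proof
    fix u assume u: "u \<in> ball \<theta> \<epsilon>"
    have "closed_segment (T k) (T k + (u - T k)) \<subseteq> \<Theta>"
      using closed_segment_subset[OF elim(2) u convex_ball] ball(2) by auto
    from taylor2[OF open_\<Theta> C2 this] obtain t where "0 < t" "t < 1"
      "L k (T k + (u - T k)) = L k (T k) + grad (L k) (T k) \<bullet> (u - T k)
        + ((u - T k) \<bullet> (hessian (L k) (T k + t *\<^sub>R (u - T k)) *v (u - T k))) / 2" .
    then show "\<exists>t. 0 < t \<and> t < 1 \<and>
      L k u - L k (T k) = ((u - T k) \<bullet> (hessian (L k) (T k + t *\<^sub>R (u - T k)) *v (u - T k))) / 2"
      by (intro exI[of _ t]) (simp add: grad)
  qed
qed

lemma local_tendsto: "(\<lambda>k. T k + (1 / sqrt (N k)) *\<^sub>R x) \<longlonglongrightarrow> \<theta>"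
proof -
  have "(\<lambda>k. 1 / sqrt (N k)) \<longlonglongrightarrow> 0"
    by (intro tendsto_divide_0[OF tendsto_const] filterlim_at_top_imp_at_infinity
        filterlim_compose[OF sqrt_at_top N])
  then have "(\<lambda>k. T k + (1 / sqrt (N k)) *\<^sub>R x) \<longlonglongrightarrow> \<theta> + 0 *\<^sub>R x"
    by (intro tendsto_intros T_tendsto)
  then show ?thesis by simp
qed

text \<open>In the Taylor formula at the maximiser the displacement x / sqrt (N k), entering
  quadratically, contributes exactly the factor 1 / N k that normalises the Hessian.\<close>

lemma loglik_increment_tendsto:
  "(\<lambda>k. L k (T k + (1 / sqrt (N k)) *\<^sub>R x) - L k (T k)) \<longlonglongrightarrow> - (x \<bullet> (I *v x)) / 2"
proof -
  define u where "u k = T k + (1 / sqrt (N k)) *\<^sub>R x" for k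
  have u: "u \<longlonglongrightarrow> \<theta>" unfolding u_def by (rule local_tendsto)
  have "\<forall>\<^sub>F k in sequentially. u k \<in> ball \<theta> \<epsilon>"
    using tendstoD[OF u ball(1)] by (simp add: dist_commute)
  with taylor_at_max have ev: "\<forall>\<^sub>F k in sequentially. \<exists>t. 0 < t \<and> t < 1 \<and>
      L k (u k) - L k (T k) = ((u k - T k) \<bullet> (hessian (L k) (T k + t *\<^sub>R (u k - T k)) *v (u k - T k))) / 2"
    by eventually_elim blast
  \<comment> \<open>The bounds 0 < t < 1 keep the intermediate point between T and u, so it tends to
    \<theta> as well.\<close>
  define t where "t k = (SOME t. 0 < t \<and> t < 1 \<and>
      L k (u k) - L k (T k) = ((u k - T k) \<bullet> (hessian (L k) (T k + t *\<^sub>R (u k - T k)) *v (u k - T k))) / 2)" for k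
  have t: "\<forall>\<^sub>F k in sequentially. 0 < t k \<and> t k < 1 \<and>
      L k (u k) - L k (T k) = ((u k - T k) \<bullet> (hessian (L k) (T k + t k *\<^sub>R (u k - T k)) *v (u k - T k))) / 2"
    using ev by eventually_elim (unfold t_def, rule someI_ex)
  have diff: "(\<lambda>k. u k - T k) \<longlonglongrightarrow> 0" using tendsto_diff[OF u T_tendsto] by simp
  have "(\<lambda>k. t k *\<^sub>R (u k - T k)) \<longlonglongrightarrow> 0"
  proof (rule Lim_null_comparison)
    show "(\<lambda>k. norm (u k - T k)) \<longlonglongrightarrow> 0" using diff by (rule tendsto_norm_zero)
    show "\<forall>\<^sub>F k in sequentially. norm (t k *\<^sub>R (u k - T k)) \<le> norm (u k - T k)"
      using t by eventually_elim (simp add: mult_left_le_one_le)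
  qed
  then have "(\<lambda>k. T k + t k *\<^sub>R (u k - T k)) \<longlonglongrightarrow> \<theta>"
    using tendsto_add[OF T_tendsto] by fastforce
  from hess_tendsto[OF this, of x]
  have "(\<lambda>k. x \<bullet> (hessian (L k) (T k + t k *\<^sub>R (u k - T k)) *v x) / N k / 2) \<longlonglongrightarrow> - (x \<bullet> (I *v x)) / 2"
    by (intro tendsto_divide[OF _ tendsto_const]) simp_all
  then have "(\<lambda>k. L k (u k) - L k (T k)) \<longlonglongrightarrow> - (x \<bullet> (I *v x)) / 2"
  proof (rule Lim_transform_eventually)
    show "\<forall>\<^sub>F k in sequentially. x \<bullet> (hessian (L k) (T k + t k *\<^sub>R (u k - T k)) *v x) / N k / 2 = L k (u k) - L k (T k)"
      using t N_pos
    proof eventually_elim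
      case (elim k)
      have "u k - T k = (1 / sqrt (N k)) *\<^sub>R x" by (simp add: u_def)
      then show ?case using elim
        by (simp add: matrix_vector_mult_scaleR)
    qed
  qed
  then show ?thesis by (simp add: u_def)
qed

text \<open>The limit in \<open>loglik_increment_tendsto\<close> is one of increments measured from
  the maximum, which eventually are never positive.\<close>

lemma I_psd: "0 \<le> x \<bullet> (I *v x)"
proof -
  have "- (x \<bullet> (I *v x)) / 2 \<le> 0"
  proof (rule tendsto_upperbound[OF loglik_increment_tendsto])
    have "\<forall>\<^sub>F k in sequentially. T k + (1 / sqrt (N k)) *\<^sub>R x \<in> ball \<theta> \<epsilon>"
      using tendstoD[OF local_tendsto ball(1)] by (simp add: dist_commute)
    with max show "\<forall>\<^sub>F k in sequentially. L k (T k + (1 / sqrt (N k)) *\<^sub>R x) - L k (T k) \<le> 0"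
      by eventually_elim (use ball(2) in auto)
  qed simp
  then show ?thesis by simp
qed

text \<open>A null vector of a semidefinite form lies in the kernel of its matrix, and I is
  invertible.\<close>

lemma I_pos:
  assumes "x \<noteq> 0"
  shows "0 < x \<bullet> (I *v x)"
proof (rule ccontr)
  assume "\<not> ?thesis"
  then have 0: "x \<bullet> (I *v x) = 0" using I_psd[of x] by simp
  have "(I *v x) \<bullet> y = 0" for y
  proof (rule quadratic_nonneg_imp_linear_zero)
    fix t
    have "0 \<le> (x + t *\<^sub>R y) \<bullet> (I *v (x + t *\<^sub>R y))" by (rule I_psd)
    also have "\<dots> = 2 * t * ((I *v x) \<bullet> y) + t\<^sup>2 * (y \<bullet> (I *v y))"
      using 0 transpose_eq_imp_selfadjoint[OF I_sym, of x y]
      by (simp add: matrix_vector_right_distrib matrix_vector_mult_scaleR inner_add_left inner_add_right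
          inner_commute power2_eq_square algebra_simps)
    finally show "0 \<le> 2 * t * ((I *v x) \<bullet> y) + t\<^sup>2 * (y \<bullet> (I *v y))" .
  qed
  then have "I *v x = 0" using inner_eq_zero_iff by blast
  then have "matrix_inv I *v (I *v x) = 0" by simp
  then show False using assms matrix_inv(2)[OF inv] by (simp add: matrix_vector_mul_assoc)
qed

lemma I_lower: "\<exists>l>0. \<forall>x. l * (norm x)\<^sup>2 \<le> x \<bullet> (I *v x)"
proof -
  have "continuous_on (sphere 0 1) (\<lambda>x. x \<bullet> (I *v x))" by (intro continuous_intros)
  moreover have "sphere (0::real^'p) 1 \<noteq> {}" by simp
  ultimately obtain v where v: "v \<in> sphere 0 1" "\<And>x. x \<in> sphere 0 1 \<Longrightarrow> v \<bullet> (I *v v) \<le> x \<bullet> (I *v x)"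
    using continuous_attains_inf[OF compact_sphere] by blast
  have "(v \<bullet> (I *v v)) * (norm x)\<^sup>2 \<le> x \<bullet> (I *v x)" for x
  proof (cases "x = 0")
    case False
    from v(2)[of "(1 / norm x) *\<^sub>R x"] False
    have "v \<bullet> (I *v v) \<le> (x \<bullet> (I *v x)) / (norm x)\<^sup>2"
      by (simp add: matrix_vector_mult_scaleR power2_eq_square)
    then show ?thesis using False by (simp add: field_simps)
  qed simp
  moreover have "0 < v \<bullet> (I *v v)" by (rule I_pos) (use v(1) in auto)
  ultimately show ?thesis by blast
qed

end

text \<open>The bound separates the drift x from the integration variable y, so that division by 1 +
  |x|^d leaves one integrable function of y for all k. The constant 4 covers d = 0, 1 and 2 at
  once.\<close>

lemma power_le_2_sum_bound:
  fixes x y :: "'a::real_normed_vector"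
  assumes "d \<le> 2"
  shows "norm (x + y) ^ d \<le> 4 * (1 + norm x ^ d) * (1 + (norm y)\<^sup>2)"
proof -
  define a b where "a = norm x" and "b = norm y"
  have ab: "0 \<le> a" "0 \<le> b" by (auto simp: a_def b_def)
  have le: "norm (x + y) \<le> a + b" unfolding a_def b_def by (rule norm_triangle_ineq)
  have b1: "b \<le> 1 + b\<^sup>2" using sum_squares_bound[of b 1] ab by (simp add: power2_eq_square)
  consider "d = 0" | "d = 1" | "d = 2" using assms by linarith
  then have "norm (x + y) ^ d \<le> 4 * (1 + a ^ d) * (1 + b\<^sup>2)"
  proof cases
    case 1
    have "0 \<le> b\<^sup>2" by simp
    then have "1 \<le> 4 * (1 + 1) * (1 + b\<^sup>2)" by (simp add: algebra_simps)
    then show ?thesis using 1 by simp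
  next
    case 2
    have "a + b \<le> a * (1 + b\<^sup>2) + (1 + b\<^sup>2)"
    proof -
      have "0 \<le> a * b\<^sup>2" using ab by simp
      then show ?thesis using b1 by (simp add: algebra_simps)
    qed
    also have "\<dots> = 1 * ((1 + a) * (1 + b\<^sup>2))" by (simp add: algebra_simps)
    also have "\<dots> \<le> 4 * ((1 + a) * (1 + b\<^sup>2))" using ab by (intro mult_right_mono) auto
    finally have "norm (x + y) \<le> 4 * ((1 + a) * (1 + b\<^sup>2))" using le by linarith
    then show ?thesis using 2 by (simp only: power_one_right mult.assoc)
  next
    case 3
    have "norm (x + y) ^ 2 \<le> (a + b)\<^sup>2" using le by (intro power_mono) auto
    also have "\<dots> \<le> 2 * a\<^sup>2 + 2 * b\<^sup>2" using sum_squares_bound[of a b] by (simp add: power2_eq_square algebra_simps)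
    also have "\<dots> \<le> 4 * ((1 + a\<^sup>2) * (1 + b\<^sup>2))"
      using mult_nonneg_nonneg[of "a\<^sup>2" "b\<^sup>2"] zero_le_power2[of a] zero_le_power2[of b] by (simp add: algebra_simps)
    finally show ?thesis using 3 by (simp only: mult.assoc)
  qed
  then show ?thesis by (simp add: a_def b_def)
qed

text \<open>f may fail to be measurable: then its integral is 0 by convention, while the dominating
  integral is nonnegative.\<close>

lemma norm_integral_le_dominating:
  fixes f :: "'a \<Rightarrow> real"
  assumes g: "integrable M g" and le: "\<And>x. norm (f x) \<le> g x"
  shows "norm (integral\<^sup>L M f) \<le> integral\<^sup>L M g"
proof (cases "integrable M f")
  case True
  then show ?thesis
    by (intro order_trans[OF integral_norm_bound] integral_mono integrable_norm g le)
next
  case False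
  have "0 \<le> g x" for x using le[of x] norm_ge_zero order_trans by blast
  then show ?thesis using False by (simp add: not_integrable_integral_eq)
qed

section \<open>Dominated convergence for the Laplace integrals\<close>

context laplace_sequence
begin

text \<open>Supplies one rate a for two dominations: of the likelihood near its maximum and, through
  2 a |x|^2 \<le> x \<bullet> I x, of its Gaussian limit.\<close>

lemma quadratic_upper:
  "\<exists>\<delta>>0. \<exists>a>0. \<delta> \<le> \<epsilon> \<and> (\<forall>x. 2 * a * (norm x)\<^sup>2 \<le> x \<bullet> (I *v x)) \<and>
     (\<forall>\<^sub>F k in sequentially. \<forall>u\<in>ball \<theta> \<delta>. L k u - L k (T k) \<le> - (a * N k * (norm (u - T k))\<^sup>2))"
proof -
  obtain l where l: "0 < l" "\<And>x. l * (norm x)\<^sup>2 \<le> x \<bullet> (I *v x)" using I_lower by blast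
  \<comment> \<open>The Hessian form divided by N is kept within (l / 2) |x|^2 of the form of - I,
    hence at most - (l / 2) |x|^2. The factor 1/2 of Taylor's formula then gives l / 4.\<close>
  define a where "a = l / 4"
  have a: "0 < a" using l by (simp add: a_def)
  obtain \<delta> where \<delta>: "0 < \<delta>" "\<delta> \<le> \<epsilon>" and ev: "\<forall>\<^sub>F k in sequentially. \<forall>u\<in>ball \<theta> \<delta>. \<forall>x.
      \<bar>x \<bullet> (hessian (L k) u *v x) / N k + x \<bullet> (I *v x)\<bar> \<le> (l / 2) * (norm x)\<^sup>2"
    using hess_uniform[of "l / 2"] l(1) by auto
  have "\<forall>\<^sub>F k in sequentially. \<forall>u\<in>ball \<theta> \<delta>. L k u - L k (T k) \<le> - (a * N k * (norm (u - T k))\<^sup>2)"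
    using ev taylor_at_max N_pos T_ball[OF \<delta>(1)]
  proof eventually_elim
    case (elim k)
    show ?case
    proof
      fix u assume u: "u \<in> ball \<theta> \<delta>"
      define x where "x = u - T k"
      have "u \<in> ball \<theta> \<epsilon>" using u \<delta> by auto
      then obtain t where t: "0 < t" "t < 1"
        and eq: "L k u - L k (T k) = (x \<bullet> (hessian (L k) (T k + t *\<^sub>R x) *v x)) / 2"
        using elim(2) unfolding x_def by blast
      have "T k + t *\<^sub>R x = (1 - t) *\<^sub>R T k + t *\<^sub>R u" by (simp add: x_def algebra_simps)
      then have "T k + t *\<^sub>R x \<in> ball \<theta> \<delta>"
        using convexD_alt[OF convex_ball elim(4) u, of t] t by simp
      then have "\<bar>x \<bullet> (hessian (L k) (T k + t *\<^sub>R x) *v x) / N k + x \<bullet> (I *v x)\<bar> \<le> (l / 2) * (norm x)\<^sup>2"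
        using elim(1) by blast
      then have "x \<bullet> (hessian (L k) (T k + t *\<^sub>R x) *v x) / N k \<le> - (l / 2) * (norm x)\<^sup>2"
        using l(2)[of x] unfolding minus_mult_left[symmetric] abs_le_iff by linarith
      then have "x \<bullet> (hessian (L k) (T k + t *\<^sub>R x) *v x) \<le> - (l / 2) * (norm x)\<^sup>2 * N k"
        using elim(3) by (simp add: field_simps)
      then show "L k u - L k (T k) \<le> - (a * N k * (norm (u - T k))\<^sup>2)"
        unfolding eq a_def x_def[symmetric] by (simp add: mult_ac)
    qed
  qed
  moreover have "2 * a * (norm x)\<^sup>2 \<le> x \<bullet> (I *v x)" for x
  proof -
    have "0 \<le> l * (norm x)\<^sup>2" using l(1) by simp
    moreover have "2 * a * (norm x)\<^sup>2 = (l * (norm x)\<^sup>2) / 2" by (simp add: a_def)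
    ultimately show ?thesis using l(2)[of x] by linarith
  qed
  ultimately show ?thesis using \<delta> a by blast
qed

text \<open>Dividing by the maximal likelihood bounds the integrand by |q| and cancels in the Bayes
  factor.\<close>

definition laplace_int :: "nat \<Rightarrow> (real^'p \<Rightarrow> real) \<Rightarrow> real" where
  "laplace_int k q = (LINT u:\<Theta>|lborel. exp (L k u - L k (T k)) * q u)"

definition scaled_error :: "nat \<Rightarrow> real^'p" where
  "scaled_error k = sqrt (N k) *\<^sub>R (T k - \<theta>)"

lemma likelihood_measurable:
  assumes "Ck_on 3 g \<Theta>"
  shows "(\<lambda>u. indicator \<Theta> u * exp (g u - c)) \<in> borel_measurable borel"
proof -
  have "continuous_on \<Theta> (partials [] g)" by (rule Ck_on_continuous[OF assms]) simp
  then have "continuous_on \<Theta> (\<lambda>u. exp (g u - c))" by (auto intro!: continuous_intros)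
  then have "(\<lambda>u. indicator \<Theta> u *\<^sub>R exp (g u - c)) \<in> borel_measurable borel"
    using open_\<Theta> by (intro borel_measurable_continuous_on_indicator) auto
  then show ?thesis by simp
qed

lemma laplace_int_split:
  assumes q: "set_integrable lborel \<Theta> q" and max: "\<forall>u\<in>\<Theta>. L k u \<le> L k (T k)"
    and B: "B \<subseteq> \<Theta>" "B \<in> sets borel"
  shows "laplace_int k q = (LINT u|lborel. indicator B u * (exp (L k u - L k (T k)) * q u))
     + (LINT u|lborel. indicator (\<Theta> - B) u * (exp (L k u - L k (T k)) * q u))"
    and "set_integrable lborel \<Theta> (\<lambda>u. exp (L k u - L k (T k)) * q u)"
proof -
  have [measurable]: "\<Theta> \<in> sets borel" using open_\<Theta> by simp
  have [measurable]: "B \<in> sets borel" by fact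
  have [measurable]: "(\<lambda>u. indicator \<Theta> u * exp (L k u - L k (T k))) \<in> borel_measurable borel"
    by (rule likelihood_measurable[OF smooth])
  have [measurable]: "(\<lambda>u. indicator \<Theta> u * q u) \<in> borel_measurable borel"
    using q borel_measurable_integrable unfolding set_integrable_def by fastforce
  have bnd: "integrable lborel (\<lambda>u. indicator A u * (exp (L k u - L k (T k)) * q u))"
    if A: "A \<in> sets borel" "A \<subseteq> \<Theta>" for A
  proof (rule Bochner_Integration.integrable_bound)
    show "integrable lborel (\<lambda>u. indicator \<Theta> u *\<^sub>R q u)" using q unfolding set_integrable_def .
    have [measurable]: "A \<in> sets borel" by fact
    \<comment> \<open>Both factors are known to be measurable only on \<Theta>, so each carries its
      own indicator.\<close>
    have "(\<lambda>u. indicator A u * ((indicator \<Theta> u * exp (L k u - L k (T k))) * (indicator \<Theta> u * q u))) \<in> borel_measurable borel"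
      by measurable
    also have "(\<lambda>u. indicator A u * ((indicator \<Theta> u * exp (L k u - L k (T k))) * (indicator \<Theta> u * q u)))
        = (\<lambda>u. indicator A u * (exp (L k u - L k (T k)) * q u))"
      using A(2) by (auto simp: fun_eq_iff split: split_indicator)
    finally show "(\<lambda>u. indicator A u * (exp (L k u - L k (T k)) * q u)) \<in> borel_measurable lborel" by simp
    show "AE u in lborel. norm (indicator A u * (exp (L k u - L k (T k)) * q u)) \<le> norm (indicator \<Theta> u *\<^sub>R q u)"
      using A(2) max by (intro AE_I2) (auto simp: indicator_def abs_mult intro!: mult_left_le_one_le)
  qed
  have "laplace_int k q = (LINT u|lborel. indicator B u * (exp (L k u - L k (T k)) * q u)
     + indicator (\<Theta> - B) u * (exp (L k u - L k (T k)) * q u))"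
    unfolding laplace_int_def set_lebesgue_integral_def using B(1)
    by (intro Bochner_Integration.integral_cong) (auto simp: indicator_def)
  then show "laplace_int k q = (LINT u|lborel. indicator B u * (exp (L k u - L k (T k)) * q u))
     + (LINT u|lborel. indicator (\<Theta> - B) u * (exp (L k u - L k (T k)) * q u))"
    using bnd[of B] bnd[of "\<Theta> - B"] B by (simp add: Bochner_Integration.integral_add)
  show "set_integrable lborel \<Theta> (\<lambda>u. exp (L k u - L k (T k)) * q u)"
    using bnd[of \<Theta>] unfolding set_integrable_def by simp
qed

text \<open>Away from \<theta> the normalised likelihood is at most exp (- c N), which beats every
  power of sqrt N.\<close>

lemma far_part:
  assumes q: "set_integrable lborel \<Theta> q" and "0 < \<delta>" "ball \<theta> \<delta> \<subseteq> \<Theta>"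
  shows "(\<lambda>k. sqrt (N k) ^ m * (LINT u|lborel. indicator (\<Theta> - ball \<theta> \<delta>) u * (exp (L k u - L k (T k)) * q u))) \<longlonglongrightarrow> 0"
proof -
  obtain c where c: "0 < c" and ev: "\<forall>\<^sub>F k in sequentially. \<forall>u\<in>\<Theta> - ball \<theta> \<delta>. L k u - L k \<theta> \<le> - c * N k"
    using outer[OF assms(2,3)] by blast
  define K where "K = (LINT u|lborel. indicator \<Theta> u * \<bar>q u\<bar>)"
  have int: "integrable lborel (\<lambda>u. indicator \<Theta> u * \<bar>q u\<bar>)"
    using integrable_abs[OF q[unfolded set_integrable_def]] by (simp add: abs_mult)
  have "((\<lambda>x. sqrt x ^ m * exp (- c * x)) \<longlongrightarrow> 0) at_top"
    using c by real_asymp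
  then have "(\<lambda>k. sqrt (N k) ^ m * exp (- c * N k)) \<longlonglongrightarrow> 0"
    by (rule filterlim_compose[OF _ N])
  then have lim: "(\<lambda>k. sqrt (N k) ^ m * exp (- c * N k) * K) \<longlonglongrightarrow> 0"
    by (rule tendsto_mult_left_zero)
  have "\<forall>\<^sub>F k in sequentially. norm (sqrt (N k) ^ m * (LINT u|lborel. indicator (\<Theta> - ball \<theta> \<delta>) u * (exp (L k u - L k (T k)) * q u)))
    \<le> sqrt (N k) ^ m * exp (- c * N k) * K"
    using ev max N_pos
  proof eventually_elim
    case (elim k)
    have "norm (LINT u|lborel. indicator (\<Theta> - ball \<theta> \<delta>) u * (exp (L k u - L k (T k)) * q u))
      \<le> (LINT u|lborel. exp (- c * N k) * (indicator \<Theta> u * \<bar>q u\<bar>))"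
    proof (rule norm_integral_le_dominating)
      show "integrable lborel (\<lambda>u. exp (- c * N k) * (indicator \<Theta> u * \<bar>q u\<bar>))" using int by simp
      show "norm (indicator (\<Theta> - ball \<theta> \<delta>) u * (exp (L k u - L k (T k)) * q u)) \<le> exp (- c * N k) * (indicator \<Theta> u * \<bar>q u\<bar>)"
        for u
      proof (cases "u \<in> \<Theta> - ball \<theta> \<delta>")
        case True
        have "L k u - L k \<theta> \<le> - c * N k" "L k \<theta> \<le> L k (T k)" using elim(1,2) True \<theta> by blast+
        then have "L k u - L k (T k) \<le> - c * N k" by linarith
        then show ?thesis using True by (auto simp: abs_mult intro!: mult_right_mono)
      qed (auto simp: indicator_def)
    qed
    also have "\<dots> = exp (- c * N k) * K" by (simp add: K_def)
    finally show ?case using elim(3) by (simp add: abs_mult mult.assoc mult_left_mono)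
  qed
  then show ?thesis by (rule Lim_null_comparison[OF _ lim])
qed

lemma scaled_displacement:
  assumes "0 < N k"
  shows "T k + (1 / sqrt (N k)) *\<^sub>R x = \<theta> + (1 / sqrt (N k)) *\<^sub>R (scaled_error k + x)"
  using assms by (simp add: scaled_error_def algebra_simps)

text \<open>The Gaussian integral moves with w = \<open>scaled_error k\<close>, so the statement is
  a vanishing difference instead of a limit. Division by 1 + |w|^d gives both integrands a common
  dominating function even when w is unbounded along the sample. Used with d = 0 for the denominator
  and with d = 1, 2 for the numerator of BF - r.\<close>

lemma laplace_main:
  assumes q: "set_integrable lborel \<Theta> q" and d: "d \<le> 2"
    and R [measurable]: "R \<in> borel_measurable borel"
    and R_bound: "\<And>h. \<bar>R h\<bar> \<le> C * norm h ^ d"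
    and R_scale: "\<And>c h. 0 < c \<Longrightarrow> R (c *\<^sub>R h) = c ^ d * R h"
    and q_R: "\<And>e. 0 < e \<Longrightarrow> \<exists>\<delta>>0. \<forall>h. norm h < \<delta> \<longrightarrow> \<bar>q (\<theta> + h) - R h\<bar> \<le> e * norm h ^ d"
  shows "(\<lambda>k. sqrt (N k) ^ d * (sqrt (N k) ^ CARD('p) * laplace_int k q) / (1 + norm (scaled_error k) ^ d)
     - (LINT x|lborel. exp (- (x \<bullet> (I *v x)) / 2) * R (scaled_error k + x)) / (1 + norm (scaled_error k) ^ d)) \<longlonglongrightarrow> 0"
proof -
  obtain \<delta>0 a where \<delta>0: "0 < \<delta>0" "\<delta>0 \<le> \<epsilon>" and a: "0 < a"
    and I_a: "\<And>x. 2 * a * (norm x)\<^sup>2 \<le> x \<bullet> (I *v x)"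
    and quad0: "\<forall>\<^sub>F k in sequentially. \<forall>u\<in>ball \<theta> \<delta>0. L k u - L k (T k) \<le> - (a * N k * (norm (u - T k))\<^sup>2)"
    using quadratic_upper by blast
  \<comment> \<open>The approximation with e = 1 gives |q| \<le> (C + 1) |h|^d near \<theta>, which
    suffices for domination.\<close>
  obtain \<delta>1 where \<delta>1: "0 < \<delta>1" "\<And>h. norm h < \<delta>1 \<Longrightarrow> \<bar>q (\<theta> + h) - R h\<bar> \<le> 1 * norm h ^ d"
    using q_R[of 1] by auto
  define \<delta> where "\<delta> = min \<delta>0 \<delta>1"
  have \<delta>: "0 < \<delta>" "ball \<theta> \<delta> \<subseteq> \<Theta>" "ball \<theta> \<delta> \<subseteq> ball \<theta> \<delta>0" using \<delta>0 \<delta>1 ball by (auto simp: \<delta>_def)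
  have quad: "\<forall>\<^sub>F k in sequentially. \<forall>u\<in>ball \<theta> \<delta>. L k u - L k (T k) \<le> - (a * N k * (norm (u - T k))\<^sup>2)"
    using quad0 by eventually_elim (use \<delta>(3) in blast)
  have C: "0 \<le> C"
  proof -
    have "0 \<le> C * norm (axis undefined 1 :: real^'p) ^ d" using R_bound abs_ge_zero order_trans by blast
    then show ?thesis by simp
  qed
  have q_bound: "\<bar>q (\<theta> + h)\<bar> \<le> (C + 1) * norm h ^ d" if "norm h < \<delta>" for h
    using \<delta>1(2)[of h] R_bound[of h] that by (simp add: \<delta>_def algebra_simps)
  define B where "B = ball \<theta> \<delta>"
  have [measurable]: "B \<in> sets borel" by (simp add: B_def)
  define \<nu> where "\<nu> k = 1 + norm (scaled_error k) ^ d" for k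
  have \<nu>: "0 < \<nu> k" "1 \<le> \<nu> k" for k by (simp_all add: \<nu>_def add_pos_nonneg)
  define u where "u k x = T k + (1 / sqrt (N k)) *\<^sub>R x" for k x
  define E where "E k x = exp (L k (u k x) - L k (T k))" for k x
  define g where "g k x = indicator B (u k x) * (E k x * q (u k x))" for k x
  define f where "f k x = exp (- (x \<bullet> (I *v x)) / 2) * R (scaled_error k + x)" for k x
  define G where "G x = exp (- (a * (norm x)\<^sup>2)) * (1 + (norm x)\<^sup>2)" for x :: "real^'p"
  have G_int: "integrable lborel G" unfolding G_def by (rule integrable_quadratic_exp[OF a])
  have G_nonneg: "0 \<le> G x" for x by (simp add: G_def)
  have sum_bound: "norm (scaled_error k + x) ^ d \<le> 4 * \<nu> k * (1 + (norm x)\<^sup>2)" for k x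
    unfolding \<nu>_def by (rule power_le_2_sum_bound[OF d])
  have f_bound: "\<bar>f k x / \<nu> k\<bar> \<le> 4 * (C + 1) * G x" for k x
  proof -
    have "\<bar>f k x\<bar> \<le> exp (- (a * (norm x)\<^sup>2)) * ((C + 1) * (4 * \<nu> k * (1 + (norm x)\<^sup>2)))"
      unfolding f_def abs_mult abs_exp_cancel
    proof (intro mult_mono)
      have "2 * (a * (norm x)\<^sup>2) \<le> x \<bullet> (I *v x)" using I_a[of x] by simp
      then show "exp (- (x \<bullet> (I *v x)) / 2) \<le> exp (- (a * (norm x)\<^sup>2))" by simp
      have "\<bar>R (scaled_error k + x)\<bar> \<le> C * norm (scaled_error k + x) ^ d" by (rule R_bound)
      also have "\<dots> \<le> (C + 1) * (4 * \<nu> k * (1 + (norm x)\<^sup>2))" using C sum_bound by (intro mult_mono) auto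
      finally show "\<bar>R (scaled_error k + x)\<bar> \<le> (C + 1) * (4 * \<nu> k * (1 + (norm x)\<^sup>2))" .
    qed auto
    also have "\<dots> = 4 * (C + 1) * G x * \<nu> k" by (simp add: G_def algebra_simps)
    finally show ?thesis using \<nu>(1)[of k] by (simp add: divide_le_eq)
  qed
  have g_bound: "\<forall>\<^sub>F k in sequentially. \<forall>x. \<bar>sqrt (N k) ^ d * g k x / \<nu> k\<bar> \<le> 4 * (C + 1) * G x"
    using quad N_pos
  proof eventually_elim
    case (elim k)
    show ?case
    proof
      fix x
      show "\<bar>sqrt (N k) ^ d * g k x / \<nu> k\<bar> \<le> 4 * (C + 1) * G x"
      proof (cases "u k x \<in> B")
        case True
        define h where "h = (1 / sqrt (N k)) *\<^sub>R (scaled_error k + x)"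
        have uh: "u k x = \<theta> + h" unfolding u_def h_def by (rule scaled_displacement[OF elim(2)])
        have "norm h < \<delta>" using True unfolding uh by (simp add: B_def dist_norm)
        have Nh: "sqrt (N k) ^ d * norm h ^ d = norm (scaled_error k + x) ^ d"
          using elim(2) by (simp add: h_def power_mult_distrib[symmetric])
        have "L k (u k x) - L k (T k) \<le> - (a * N k * (norm (u k x - T k))\<^sup>2)"
          using elim(1) True by (simp add: B_def)
        also have "\<dots> = - (a * (norm x)\<^sup>2)"
          using elim(2) by (simp add: u_def power_mult_distrib power_divide)
        finally have E: "E k x \<le> exp (- (a * (norm x)\<^sup>2))" by (simp add: E_def)
        have "\<bar>sqrt (N k) ^ d * g k x\<bar> = E k x * (sqrt (N k) ^ d * \<bar>q (\<theta> + h)\<bar>)"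
          using True elim(2) by (simp add: g_def abs_mult uh[symmetric] E_def)
        also have "\<dots> \<le> exp (- (a * (norm x)\<^sup>2)) * (sqrt (N k) ^ d * ((C + 1) * norm h ^ d))"
          using elim(2) C by (intro mult_mono E q_bound \<open>norm h < \<delta>\<close>) (auto simp: E_def)
        also have "\<dots> = exp (- (a * (norm x)\<^sup>2)) * ((C + 1) * norm (scaled_error k + x) ^ d)"
          unfolding Nh[symmetric] by (simp add: mult_ac)
        also have "\<dots> \<le> exp (- (a * (norm x)\<^sup>2)) * ((C + 1) * (4 * \<nu> k * (1 + (norm x)\<^sup>2)))"
          using C by (intro mult_left_mono sum_bound) auto
        also have "\<dots> = 4 * (C + 1) * G x * \<nu> k" by (simp add: G_def algebra_simps)
        finally show ?thesis using \<nu>(1)[of k] by (simp add: divide_le_eq)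
      next
        case False
        then show ?thesis using C G_nonneg[of x] by (simp add: g_def)
      qed
    qed
  qed
  have pointwise: "(\<lambda>k. sqrt (N k) ^ d * g k x / \<nu> k - f k x / \<nu> k) \<longlonglongrightarrow> 0" for x
  proof -
    let ?e = "exp (- (x \<bullet> (I *v x)) / 2)"
    have E_lim: "(\<lambda>k. E k x) \<longlonglongrightarrow> ?e"
      unfolding E_def u_def by (intro tendsto_exp loglik_increment_tendsto)
    have u_lim: "(\<lambda>k. u k x) \<longlonglongrightarrow> \<theta>" unfolding u_def by (rule local_tendsto)
    \<comment> \<open>The pointwise error splits in two: \<open>D\<close> comes from replacing q by
      its homogeneous part R, and E k x - ?e from replacing the likelihood by its Gaussian
      limit.\<close>
    define D where "D k = (sqrt (N k) ^ d * q (u k x) - R (scaled_error k + x)) / \<nu> k" for k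
    have D_lim: "D \<longlonglongrightarrow> 0"
    proof (rule tendstoI)
      fix e :: real assume "0 < e"
      \<comment> \<open>\<open>sum_bound\<close> contributes 4 (1 + |x|^2); the further factor 2
        leaves e / 2 and hence a strict bound.\<close>
      define e' where "e' = e / (8 * (1 + (norm x)\<^sup>2))"
      have pos: "0 < 1 + (norm x)\<^sup>2" by (simp add: add_pos_nonneg)
      have "0 < e'" using \<open>0 < e\<close> pos by (simp add: e'_def)
      from q_R[OF this] obtain \<eta> where \<eta>: "0 < \<eta>" "\<And>h. norm h < \<eta> \<Longrightarrow> \<bar>q (\<theta> + h) - R h\<bar> \<le> e' * norm h ^ d"
        by blast
      have "\<forall>\<^sub>F k in sequentially. dist (u k x) \<theta> < \<eta>" by (rule tendstoD[OF u_lim \<eta>(1)])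
      with N_pos show "\<forall>\<^sub>F k in sequentially. dist (D k) 0 < e"
      proof eventually_elim
        case (elim k)
        define h where "h = (1 / sqrt (N k)) *\<^sub>R (scaled_error k + x)"
        have uh: "u k x = \<theta> + h" unfolding u_def h_def by (rule scaled_displacement[OF elim(1)])
        have hR: "R (scaled_error k + x) = sqrt (N k) ^ d * R h"
        proof -
          have "scaled_error k + x = sqrt (N k) *\<^sub>R h" using elim(1) by (simp add: h_def)
          then show ?thesis using R_scale[of "sqrt (N k)" h] elim(1) by simp
        qed
        have Nh: "sqrt (N k) ^ d * norm h ^ d = norm (scaled_error k + x) ^ d"
          using elim(1) by (simp add: h_def power_mult_distrib[symmetric])
        have "\<bar>sqrt (N k) ^ d * q (u k x) - R (scaled_error k + x)\<bar> = sqrt (N k) ^ d * \<bar>q (\<theta> + h) - R h\<bar>"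
          unfolding hR uh using elim(1) by (simp add: abs_mult right_diff_distrib[symmetric])
        also have "\<dots> \<le> sqrt (N k) ^ d * (e' * norm h ^ d)"
          using elim(1,2) by (intro mult_left_mono \<eta>(2)) (auto simp: uh dist_norm)
        also have "\<dots> = e' * norm (scaled_error k + x) ^ d" unfolding Nh[symmetric] by (simp add: mult_ac)
        also have "\<dots> \<le> e' * (4 * \<nu> k * (1 + (norm x)\<^sup>2))" using \<open>0 < e'\<close> by (intro mult_left_mono sum_bound) auto
        also have "\<dots> = (e / 2) * \<nu> k" using pos by (simp add: e'_def field_simps)
        finally have "\<bar>D k\<bar> \<le> e / 2" using \<nu>(1)[of k] by (simp add: D_def divide_le_eq)
        then show ?case using \<open>0 < e\<close> by simp
      qed
    qed
    have "(\<lambda>k. (E k x - ?e) * (R (scaled_error k + x) / \<nu> k)) \<longlonglongrightarrow> 0"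
    proof (rule Lim_null_comparison)
      have "(\<lambda>k. E k x - ?e) \<longlonglongrightarrow> 0" using E_lim by (rule LIM_zero)
      then have "(\<lambda>k. \<bar>E k x - ?e\<bar>) \<longlonglongrightarrow> 0" by (rule tendsto_rabs_zero)
      then show "(\<lambda>k. \<bar>E k x - ?e\<bar> * (C * (4 * (1 + (norm x)\<^sup>2)))) \<longlonglongrightarrow> 0" by (rule tendsto_mult_left_zero)
      have "\<bar>R (scaled_error k + x) / \<nu> k\<bar> \<le> C * (4 * (1 + (norm x)\<^sup>2))" for k
      proof -
        have "\<bar>R (scaled_error k + x)\<bar> \<le> C * (4 * \<nu> k * (1 + (norm x)\<^sup>2))"
          using R_bound[of "scaled_error k + x"] mult_left_mono[OF sum_bound C] by (rule order_trans)
        then show ?thesis using \<nu>(1)[of k] by (simp add: divide_le_eq mult_ac)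
      qed
      then show "\<forall>\<^sub>F k in sequentially. norm ((E k x - ?e) * (R (scaled_error k + x) / \<nu> k)) \<le> \<bar>E k x - ?e\<bar> * (C * (4 * (1 + (norm x)\<^sup>2)))"
        by (intro always_eventually allI) (simp only: real_norm_def abs_mult mult_left_mono abs_ge_zero)
    qed
    moreover have "(\<lambda>k. E k x * D k) \<longlonglongrightarrow> ?e * 0" by (rule tendsto_mult[OF E_lim D_lim])
    ultimately have "(\<lambda>k. E k x * D k + (E k x - ?e) * (R (scaled_error k + x) / \<nu> k)) \<longlonglongrightarrow> ?e * 0 + 0"
      by (rule tendsto_add[rotated])
    then have lim: "(\<lambda>k. E k x * D k + (E k x - ?e) * (R (scaled_error k + x) / \<nu> k)) \<longlonglongrightarrow> 0" by simp
    have "\<forall>\<^sub>F k in sequentially. u k x \<in> B"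
      using tendstoD[OF u_lim \<delta>(1)] by (simp add: B_def dist_commute)
    then have "\<forall>\<^sub>F k in sequentially. E k x * D k + (E k x - ?e) * (R (scaled_error k + x) / \<nu> k)
        = sqrt (N k) ^ d * g k x / \<nu> k - f k x / \<nu> k"
      by eventually_elim (simp add: g_def f_def D_def diff_divide_distrib algebra_simps)
    with lim show ?thesis by (rule Lim_transform_eventually)
  qed
  have meas_g: "\<forall>\<^sub>F k in sequentially. g k \<in> borel_measurable borel"
    using N_pos
  proof eventually_elim
    case (elim k)
    have [measurable]: "\<Theta> \<in> sets borel" using open_\<Theta> by simp
    have [measurable]: "(\<lambda>u. indicator \<Theta> u * exp (L k u - L k (T k))) \<in> borel_measurable borel"
      by (rule likelihood_measurable[OF smooth])
    have [measurable]: "(\<lambda>u. indicator \<Theta> u * q u) \<in> borel_measurable borel"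
      using q borel_measurable_integrable unfolding set_integrable_def by fastforce
    have "(\<lambda>u. indicator B u * ((indicator \<Theta> u * exp (L k u - L k (T k))) * (indicator \<Theta> u * q u))) \<in> borel_measurable borel"
      by measurable
    also have "(\<lambda>u. indicator B u * ((indicator \<Theta> u * exp (L k u - L k (T k))) * (indicator \<Theta> u * q u)))
        = (\<lambda>u. indicator B u * (exp (L k u - L k (T k)) * q u))"
      using \<delta>(2) by (auto simp: fun_eq_iff B_def split: split_indicator)
    finally have m: "(\<lambda>u. indicator B u * (exp (L k u - L k (T k)) * q u)) \<in> borel_measurable borel" .
    have "(\<lambda>x. T k + (1 / sqrt (N k)) *\<^sub>R x) \<in> borel_measurable borel" by measurable
    from measurable_compose[OF this m] show "g k \<in> borel_measurable borel"
      by (simp add: g_def[abs_def] E_def u_def)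
  qed
  \<comment> \<open>Dominated convergence needs its bound at every index, so the sequence is started
    at an index from which the eventual bounds hold.\<close>
  obtain k0 where k0: "\<And>k. k0 \<le> k \<Longrightarrow> (\<forall>x. \<bar>sqrt (N k) ^ d * g k x / \<nu> k\<bar> \<le> 4 * (C + 1) * G x) \<and> g k \<in> borel_measurable borel \<and> 0 < N k"
    using eventually_conj[OF g_bound eventually_conj[OF meas_g N_pos]] unfolding eventually_sequentially by blast
  have f_meas [measurable]: "f k \<in> borel_measurable borel" for k unfolding f_def by measurable
  have K_int: "integrable lborel (\<lambda>x. 4 * (C + 1) * G x)" using G_int by simp
  have int_g: "integrable lborel (\<lambda>x. sqrt (N k) ^ d * g k x / \<nu> k)" if "k0 \<le> k" for k
    by (rule Bochner_Integration.integrable_bound[OF K_int])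
       (use k0[OF that] C G_nonneg in \<open>auto intro!: AE_I2 simp: abs_mult\<close>)
  have int_f: "integrable lborel (\<lambda>x. f k x / \<nu> k)" for k
    by (rule Bochner_Integration.integrable_bound[OF K_int])
       (use f_bound[of k] C G_nonneg in \<open>auto intro!: AE_I2 simp: abs_mult\<close>)
  have "(\<lambda>k. LINT x|lborel. sqrt (N (k + k0)) ^ d * g (k + k0) x / \<nu> (k + k0) - f (k + k0) x / \<nu> (k + k0)) \<longlonglongrightarrow> (LINT x::real^'p|lborel. (0::real))"
  proof (rule integral_dominated_convergence[where w = "\<lambda>x. 4 * (C + 1) * G x + 4 * (C + 1) * G x"])
    show "integrable lborel (\<lambda>x. 4 * (C + 1) * G x + 4 * (C + 1) * G x)" using K_int by simp
    show "AE x in lborel. (\<lambda>k. sqrt (N (k + k0)) ^ d * g (k + k0) x / \<nu> (k + k0) - f (k + k0) x / \<nu> (k + k0)) \<longlonglongrightarrow> 0"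
      by (intro AE_I2 LIMSEQ_ignore_initial_segment pointwise)
    show "AE x in lborel. norm (sqrt (N (k + k0)) ^ d * g (k + k0) x / \<nu> (k + k0) - f (k + k0) x / \<nu> (k + k0))
        \<le> 4 * (C + 1) * G x + 4 * (C + 1) * G x" for k
      using k0[of "k + k0"] f_bound[of "k + k0"]
      by (intro AE_I2 order_trans[OF norm_triangle_ineq4] add_mono) (auto simp only: real_norm_def le_add2)
    show "(\<lambda>x. sqrt (N (k + k0)) ^ d * g (k + k0) x / \<nu> (k + k0) - f (k + k0) x / \<nu> (k + k0)) \<in> borel_measurable lborel" for k
      using borel_measurable_integrable[OF int_g[of "k + k0"]] borel_measurable_integrable[OF int_f[of "k + k0"]] by simp
  qed simp
  then have "(\<lambda>k. LINT x|lborel. sqrt (N k) ^ d * g k x / \<nu> k - f k x / \<nu> k) \<longlonglongrightarrow> (LINT x::real^'p|lborel. (0::real))"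
    by (rule LIMSEQ_offset[where f = "\<lambda>k. LINT x|lborel. sqrt (N k) ^ d * g k x / \<nu> k - f k x / \<nu> k"])
  then have "(\<lambda>k. LINT x|lborel. sqrt (N k) ^ d * g k x / \<nu> k - f k x / \<nu> k) \<longlonglongrightarrow> 0"
    by (simp only: Bochner_Integration.integral_zero)
  moreover have "\<forall>\<^sub>F k in sequentially. (LINT x|lborel. sqrt (N k) ^ d * g k x / \<nu> k - f k x / \<nu> k)
      = sqrt (N k) ^ d * (LINT x|lborel. g k x) / \<nu> k - (LINT x|lborel. f k x) / \<nu> k"
    using eventually_ge_at_top[of k0]
  proof eventually_elim
    case (elim k)
    show ?case by (subst Bochner_Integration.integral_diff[OF int_g[OF elim] int_f]) simp
  qed
  ultimately have near: "(\<lambda>k. sqrt (N k) ^ d * (LINT x|lborel. g k x) / \<nu> k - (LINT x|lborel. f k x) / \<nu> k) \<longlonglongrightarrow> 0"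
    by (rule Lim_transform_eventually)
  define F where "F k = (LINT u|lborel. indicator (\<Theta> - B) u * (exp (L k u - L k (T k)) * q u))" for k
  \<comment> \<open>The exponent is d + p: d from the scale of R and p from the Jacobian of the
    substitution.\<close>
  have far0: "(\<lambda>k. sqrt (N k) ^ (d + CARD('p)) * F k) \<longlonglongrightarrow> 0"
    unfolding F_def B_def by (rule far_part[OF q \<delta>(1,2)])
  have far: "(\<lambda>k. sqrt (N k) ^ (d + CARD('p)) * F k / \<nu> k) \<longlonglongrightarrow> 0"
  proof (rule Lim_null_comparison[OF always_eventually])
    show "(\<lambda>k. \<bar>sqrt (N k) ^ (d + CARD('p)) * F k\<bar>) \<longlonglongrightarrow> 0" using far0 by (rule tendsto_rabs_zero)
    show "\<forall>k. norm (sqrt (N k) ^ (d + CARD('p)) * F k / \<nu> k) \<le> \<bar>sqrt (N k) ^ (d + CARD('p)) * F k\<bar>"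
    proof
      fix k
      have "\<bar>y\<bar> / \<nu> k \<le> \<bar>y\<bar>" for y using \<nu>[of k] mult_left_mono[of 1 "\<nu> k" "\<bar>y\<bar>"] by (simp add: divide_le_eq)
      then show "norm (sqrt (N k) ^ (d + CARD('p)) * F k / \<nu> k) \<le> \<bar>sqrt (N k) ^ (d + CARD('p)) * F k\<bar>"
        using \<nu>(1)[of k] by (simp only: real_norm_def abs_divide abs_of_pos)
    qed
  qed
  have "\<forall>\<^sub>F k in sequentially. (sqrt (N k) ^ d * (LINT x|lborel. g k x) / \<nu> k - (LINT x|lborel. f k x) / \<nu> k)
      + sqrt (N k) ^ (d + CARD('p)) * F k / \<nu> k
    = sqrt (N k) ^ d * (sqrt (N k) ^ CARD('p) * laplace_int k q) / \<nu> k - (LINT x|lborel. f k x) / \<nu> k"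
    using max N_pos
  proof eventually_elim
    case (elim k)
    have "laplace_int k q = (LINT u|lborel. indicator B u * (exp (L k u - L k (T k)) * q u)) + F k"
      unfolding F_def using elim(1) \<delta>(2) by (intro laplace_int_split q) (auto simp: B_def)
    also have "(LINT u|lborel. indicator B u * (exp (L k u - L k (T k)) * q u)) = (1 / sqrt (N k)) ^ DIM(real^'p) * (LINT x|lborel. g k x)"
      unfolding g_def E_def u_def using elim(2) by (intro lborel_rescale(2)) simp
    finally have "sqrt (N k) ^ CARD('p) * laplace_int k q = (LINT x|lborel. g k x) + sqrt (N k) ^ CARD('p) * F k"
      using elim(2) by (simp add: distrib_left power_divide)
    then show ?case by (simp add: power_add algebra_simps add_divide_distrib)
  qed
  then have "(\<lambda>k. sqrt (N k) ^ d * (sqrt (N k) ^ CARD('p) * laplace_int k q) / \<nu> k - (LINT x|lborel. f k x) / \<nu> k) \<longlonglongrightarrow> 0"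
    by (rule Lim_transform_eventually[rotated]) (use tendsto_add[OF near far] in simp)
  then show ?thesis unfolding f_def \<nu>_def .
qed

end

section \<open>The log ratio of two Laplace integrals\<close>

lemma matrix_inv_matrix_inv:
  fixes A :: "real^'p^'p"
  assumes "invertible A"
  shows "invertible (matrix_inv A)" "matrix_inv (matrix_inv A) = A"
proof -
  note m = matrix_inv[OF assms]
  show inv: "invertible (matrix_inv A)" unfolding invertible_def using m by blast
  have "matrix_inv (matrix_inv A) = (A ** matrix_inv A) ** matrix_inv (matrix_inv A)"
    by (simp add: m)
  also have "\<dots> = A ** (matrix_inv A ** matrix_inv (matrix_inv A))" by (simp only: matrix_mul_assoc)
  also have "\<dots> = A" by (simp add: matrix_inv(1)[OF inv])
  finally show "matrix_inv (matrix_inv A) = A" .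
qed

text \<open>Positivity passes to the inverse by writing x = A y, symmetry by transposing the product
  of A with its inverse.\<close>

lemma gaussian_matrix_inv:
  fixes A :: "real^'p^'p"
  assumes sym: "transpose A = A" and psd: "\<And>x. 0 \<le> x \<bullet> (A *v x)" and inv: "invertible A"
    and mass: "measure (mvn (matrix_inv A)) UNIV = 1"
  shows "gaussian (matrix_inv A)"
proof
  note m = matrix_inv[OF inv]
  have "transpose (matrix_inv A) = transpose (matrix_inv A) ** (A ** matrix_inv A)" by (simp add: m)
  also have "\<dots> = transpose (A ** matrix_inv A) ** matrix_inv A"
    by (simp only: matrix_transpose_mul sym matrix_mul_assoc)
  also have "\<dots> = matrix_inv A" by (simp add: m transpose_mat)
  finally show tr: "transpose (matrix_inv A) = matrix_inv A" .
  show "0 \<le> x \<bullet> (matrix_inv A *v x)" for x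
  proof -
    define y where "y = matrix_inv A *v x"
    have "x = A *v y" by (simp add: y_def matrix_vector_mul_assoc m)
    then show ?thesis using psd[of y] unfolding y_def[symmetric] by (metis inner_commute)
  qed
  show "invertible (matrix_inv A)" by (rule matrix_inv_matrix_inv(1)[OF inv])
  show "measure (mvn (matrix_inv A)) UNIV = 1" by (rule mass)
qed

text \<open>X and Y may oscillate without limits of their own; boundedness of Y is what lets the
  denominator be replaced by its limit.\<close>

lemma tendsto_quotient_difference:
  fixes X Y B :: "nat \<Rightarrow> real"
  assumes XY: "(\<lambda>k. X k - Y k) \<longlonglongrightarrow> 0" and Y: "\<And>k. \<bar>Y k\<bar> \<le> K" and B: "B \<longlonglongrightarrow> \<beta>" "\<beta> \<noteq> 0"
  shows "(\<lambda>k. X k / B k - Y k / \<beta>) \<longlonglongrightarrow> 0"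
proof -
  have "(\<lambda>k. inverse (B k) - inverse \<beta>) \<longlonglongrightarrow> 0"
    using tendsto_inverse[OF B] by (rule LIM_zero)
  then have "(\<lambda>k. \<bar>inverse (B k) - inverse \<beta>\<bar> * K) \<longlonglongrightarrow> 0"
    by (intro tendsto_mult_left_zero tendsto_rabs_zero)
  then have "(\<lambda>k. Y k * (inverse (B k) - inverse \<beta>)) \<longlonglongrightarrow> 0"
  proof (rule Lim_null_comparison[rotated], intro always_eventually allI)
    fix k show "norm (Y k * (inverse (B k) - inverse \<beta>)) \<le> \<bar>inverse (B k) - inverse \<beta>\<bar> * K"
      using mult_right_mono[OF Y[of k] abs_ge_zero[of "inverse (B k) - inverse \<beta>"]]
      by (simp only: real_norm_def abs_mult mult.commute)
  qed
  moreover have "(\<lambda>k. (X k - Y k) * inverse (B k)) \<longlonglongrightarrow> 0 * inverse \<beta>"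
    by (rule tendsto_mult[OF XY tendsto_inverse[OF B]])
  ultimately have "(\<lambda>k. (X k - Y k) * inverse (B k) + Y k * (inverse (B k) - inverse \<beta>)) \<longlonglongrightarrow> 0 * inverse \<beta> + 0"
    by (rule tendsto_add[rotated])
  then show ?thesis by (simp add: divide_inverse algebra_simps)
qed

context laplace_sequence
begin

text \<open>With y the relative deviation of the ratio from r, the difference of logarithms is ln (1
  + y) = y + O(y^2). The quadratic remainder is negligible because sqrt N^d y / \<nu> is bounded and
  y tends to 0.\<close>

lemma log_ratio_expansion:
  assumes mass: "measure (mvn (matrix_inv I)) UNIV = 1"
    and \<pi>1: "set_integrable lborel \<Theta> \<pi>1" "0 < \<pi>1 \<theta>"
    and \<pi>0: "set_integrable lborel \<Theta> \<pi>0" "0 < \<pi>0 \<theta>" "isCont \<pi>0 \<theta>"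
    and d: "1 \<le> d" "d \<le> 2"
    and R [measurable]: "R \<in> borel_measurable borel"
    and R_bound: "\<And>h. \<bar>R h\<bar> \<le> C * norm h ^ d"
    and R_scale: "\<And>c h. 0 < c \<Longrightarrow> R (c *\<^sub>R h) = c ^ d * R h"
    and q_R: "\<And>e. 0 < e \<Longrightarrow> \<exists>\<delta>>0. \<forall>h. norm h < \<delta> \<longrightarrow>
      \<bar>(\<pi>1 (\<theta> + h) - \<pi>1 \<theta> / \<pi>0 \<theta> * \<pi>0 (\<theta> + h)) - R h\<bar> \<le> e * norm h ^ d"
  shows "(\<lambda>k. (sqrt (N k) ^ d * (ln (laplace_int k \<pi>1 / laplace_int k \<pi>0) - ln (\<pi>1 \<theta> / \<pi>0 \<theta>))
      - (LINT x|mvn (matrix_inv I). R (scaled_error k + x)) / \<pi>1 \<theta>) / (1 + norm (scaled_error k) ^ d)) \<longlonglongrightarrow> 0"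
proof -
  interpret g: gaussian "matrix_inv I" by (rule gaussian_matrix_inv[OF I_sym I_psd inv mass])
  define r where "r = \<pi>1 \<theta> / \<pi>0 \<theta>"
  have r: "0 < r" using \<pi>1 \<pi>0 by (simp add: r_def)
  define q where "q u = \<pi>1 u - r * \<pi>0 u" for u
  have q_int: "set_integrable lborel \<Theta> q"
    unfolding q_def by (intro set_integral_diff(1) \<pi>1 set_integrable_mult_right \<pi>0)
  define \<nu> where "\<nu> k = 1 + norm (scaled_error k) ^ d" for k
  have \<nu>: "0 < \<nu> k" "1 \<le> \<nu> k" for k by (simp_all add: \<nu>_def add_pos_nonneg)
  define Z where "Z = g.normaliser"
  have Z: "0 < Z" using g.normaliser_pos by (simp add: Z_def)
  have gauss: "(LINT x|lborel. exp (- (x \<bullet> (I *v x)) / 2) * F x) = Z * (LINT x|mvn (matrix_inv I). F x)"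
    if "F \<in> borel_measurable borel" for F
    using g.lborel_integral[OF that] by (simp add: Z_def matrix_inv_matrix_inv(2)[OF inv])
  define m where "m k = (LINT x|mvn (matrix_inv I). R (scaled_error k + x))" for k
  define B where "B k = sqrt (N k) ^ CARD('p) * laplace_int k \<pi>0" for k
  define A where "A k = sqrt (N k) ^ CARD('p) * laplace_int k q" for k
  define \<beta> where "\<beta> = Z * \<pi>0 \<theta>"
  have \<beta>: "0 < \<beta>" using Z \<pi>0 by (simp add: \<beta>_def)

  \<comment> \<open>The case d = 0 with constant R. Here 1 + |w|^0 = 2, whence the halves
    below.\<close>
  have "(\<lambda>k. sqrt (N k) ^ 0 * (sqrt (N k) ^ CARD('p) * laplace_int k \<pi>0) / (1 + norm (scaled_error k) ^ 0)
     - (LINT x|lborel. exp (- (x \<bullet> (I *v x)) / 2) * (\<lambda>_. \<pi>0 \<theta>) (scaled_error k + x)) / (1 + norm (scaled_error k) ^ 0)) \<longlonglongrightarrow> 0"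
  proof (rule laplace_main[OF \<pi>0(1), where C = "\<pi>0 \<theta>"])
    show "\<exists>\<delta>>0. \<forall>h. norm h < \<delta> \<longrightarrow> \<bar>\<pi>0 (\<theta> + h) - \<pi>0 \<theta>\<bar> \<le> e * norm h ^ 0" if "0 < e" for e
    proof -
      obtain \<delta> where "0 < \<delta>" "\<And>y. dist y \<theta> < \<delta> \<Longrightarrow> dist (\<pi>0 y) (\<pi>0 \<theta>) < e"
        using tendstoD[OF \<pi>0(3)[unfolded isCont_def tendsto_at_iff_tendsto_nhds] \<open>0 < e\<close>]
        unfolding eventually_nhds_metric by blast
      then show ?thesis by (intro exI[of _ \<delta>]) (force simp: dist_norm less_imp_le)
    qed
  qed (use \<pi>0 in auto)
  moreover have "(LINT x|lborel. exp (- (x \<bullet> (I *v x)) / 2) * (\<lambda>_. \<pi>0 \<theta>) (scaled_error k + x)) = \<beta>" for k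
    using gauss[of "\<lambda>x. \<pi>0 \<theta>"] by (simp add: \<beta>_def g.mass)
  ultimately have "(\<lambda>k. B k / 2 - \<beta> / 2) \<longlonglongrightarrow> 0" by (simp add: B_def)
  then have "(\<lambda>k. 2 * (B k / 2 - \<beta> / 2) + \<beta>) \<longlonglongrightarrow> 2 * 0 + \<beta>" by (intro tendsto_intros)
  then have B_lim: "B \<longlonglongrightarrow> \<beta>" by simp

  have "(\<lambda>k. sqrt (N k) ^ d * (sqrt (N k) ^ CARD('p) * laplace_int k q) / (1 + norm (scaled_error k) ^ d)
     - (LINT x|lborel. exp (- (x \<bullet> (I *v x)) / 2) * R (scaled_error k + x)) / (1 + norm (scaled_error k) ^ d)) \<longlonglongrightarrow> 0"
    by (rule laplace_main[OF q_int d(2) R R_bound R_scale]) (use q_R in \<open>simp_all add: q_def r_def\<close>)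
  moreover have "(LINT x|lborel. exp (- (x \<bullet> (I *v x)) / 2) * R (scaled_error k + x)) = Z * m k" for k
    unfolding m_def by (rule gauss) simp
  ultimately have A_lim: "(\<lambda>k. sqrt (N k) ^ d * A k / \<nu> k - Z * m k / \<nu> k) \<longlonglongrightarrow> 0"
    by (simp add: A_def \<nu>_def)

  define K where "K = C * 4 * (LINT x|mvn (matrix_inv I). 1 + (norm x)\<^sup>2)"
  have C: "0 \<le> C"
  proof -
    have "0 \<le> C * norm (axis undefined 1 :: real^'p) ^ d" using R_bound abs_ge_zero order_trans by blast
    then show ?thesis by simp
  qed
  have m_bound: "\<bar>m k / \<nu> k\<bar> \<le> K" for k
  proof -
    have "norm (m k) \<le> (LINT x|mvn (matrix_inv I). C * (4 * \<nu> k) * (1 + (norm x)\<^sup>2))"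
      unfolding m_def
    proof (rule norm_integral_le_dominating)
      show "integrable (mvn (matrix_inv I)) (\<lambda>x. C * (4 * \<nu> k) * (1 + (norm x)\<^sup>2))"
        by (intro integrable_mult_right g.integrable_one_plus_norm_sq)
      fix x
      have "\<bar>R (scaled_error k + x)\<bar> \<le> C * norm (scaled_error k + x) ^ d" by (rule R_bound)
      also have "\<dots> \<le> C * (4 * \<nu> k * (1 + (norm x)\<^sup>2))"
        unfolding \<nu>_def by (intro mult_left_mono power_le_2_sum_bound d C)
      finally show "norm (R (scaled_error k + x)) \<le> C * (4 * \<nu> k) * (1 + (norm x)\<^sup>2)" by (simp add: mult_ac)
    qed
    also have "\<dots> = K * \<nu> k"
      unfolding K_def by (subst integral_mult_right_zero) (simp only: mult_ac)
    finally show ?thesis using \<nu>(1)[of k] by (simp add: divide_le_eq)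
  qed
  \<comment> \<open>The common powers of sqrt N cancel, so z is the ratio of the two prior integrals
    minus r.\<close>
  define z where "z k = A k / B k" for k
  have z_lim: "(\<lambda>k. sqrt (N k) ^ d * z k / \<nu> k - m k / \<nu> k / \<pi>0 \<theta>) \<longlonglongrightarrow> 0"
  proof -
    have "(\<lambda>k. (sqrt (N k) ^ d * A k / \<nu> k) / B k - (Z * m k / \<nu> k) / \<beta>) \<longlonglongrightarrow> 0"
    proof (rule tendsto_quotient_difference[OF A_lim _ B_lim, where K = "Z * K"])
      show "\<bar>Z * m k / \<nu> k\<bar> \<le> Z * K" for k
        using mult_left_mono[OF m_bound[of k], of Z] Z by (simp add: abs_mult)
    qed (use \<beta> in simp)
    then show ?thesis using Z by (simp add: z_def \<beta>_def mult_ac)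
  qed
  \<comment> \<open>By \<open>z_lim\<close> the scaled z is eventually within 1 of a quantity
    bounded by the first summand.\<close>
  define Kz where "Kz = K / \<pi>0 \<theta> + 1"
  have z_bound: "\<forall>\<^sub>F k in sequentially. \<bar>sqrt (N k) ^ d * z k / \<nu> k\<bar> \<le> Kz"
    using tendstoD[OF z_lim zero_less_one]
  proof eventually_elim
    case (elim k)
    have "\<bar>m k / \<nu> k / \<pi>0 \<theta>\<bar> \<le> K / \<pi>0 \<theta>"
      unfolding abs_divide[of "m k / \<nu> k" "\<pi>0 \<theta>"] abs_of_pos[OF \<pi>0(2)]
      by (rule divide_right_mono[OF m_bound]) (use \<pi>0(2) in simp)
    then show ?case using elim unfolding Kz_def dist_real_def by linarith
  qed
  \<comment> \<open>Here |z| \<le> Kz \<nu> / sqrt N^d, and this equals Kz (1 / sqrt N^d + |T -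
    \<theta>|^d), which tends to 0 by consistency of T.\<close>
  have z0: "z \<longlonglongrightarrow> 0"
  proof (rule Lim_null_comparison)
    have "(\<lambda>k. 1 / sqrt (N k) ^ d) \<longlonglongrightarrow> 0"
      using d(1) by (intro tendsto_divide_0[OF tendsto_const] filterlim_at_top_imp_at_infinity
          filterlim_pow_at_top filterlim_compose[OF sqrt_at_top N]) simp
    moreover have "(\<lambda>k. norm (T k - \<theta>) ^ d) \<longlonglongrightarrow> norm (\<theta> - \<theta>) ^ d"
      by (intro tendsto_intros T_tendsto)
    ultimately have "(\<lambda>k. Kz * (1 / sqrt (N k) ^ d + norm (T k - \<theta>) ^ d)) \<longlonglongrightarrow> Kz * (0 + norm (\<theta> - \<theta>) ^ d)"
      by (intro tendsto_mult[OF tendsto_const] tendsto_add)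
    then show "(\<lambda>k. Kz * (1 / sqrt (N k) ^ d + norm (T k - \<theta>) ^ d)) \<longlonglongrightarrow> 0"
      using d(1) by (simp add: power_0_left)
    show "\<forall>\<^sub>F k in sequentially. norm (z k) \<le> Kz * (1 / sqrt (N k) ^ d + norm (T k - \<theta>) ^ d)"
      using z_bound N_pos
    proof eventually_elim
      case (elim k)
      have sN: "0 < sqrt (N k) ^ d" using elim(2) by simp
      have "sqrt (N k) ^ d * \<bar>z k\<bar> \<le> Kz * \<nu> k"
        using elim(1) \<nu>(1)[of k] sN by (simp add: abs_mult divide_le_eq)
      then have "\<bar>z k\<bar> \<le> Kz * (\<nu> k / sqrt (N k) ^ d)" using sN by (simp add: field_simps)
      also have "\<nu> k / sqrt (N k) ^ d = 1 / sqrt (N k) ^ d + norm (T k - \<theta>) ^ d"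
        using elim(2) by (simp add: \<nu>_def scaled_error_def power_mult_distrib add_divide_distrib)
      finally show ?case by simp
    qed
  qed
  define y where "y k = z k / r" for k
  have y0: "y \<longlonglongrightarrow> 0" using tendsto_mult_left_zero[OF z0, of "1 / r"] by (simp add: y_def[abs_def])
  have y_bound: "\<forall>\<^sub>F k in sequentially. \<bar>sqrt (N k) ^ d * y k / \<nu> k\<bar> \<le> Kz / r"
    using z_bound by eventually_elim (use r in \<open>simp add: y_def abs_mult field_simps\<close>)
  have ln_lim: "(\<lambda>k. sqrt (N k) ^ d * (ln (1 + y k) - y k) / \<nu> k) \<longlonglongrightarrow> 0"
  proof (rule Lim_null_comparison)
    show "(\<lambda>k. 2 * (Kz / r) * \<bar>y k\<bar>) \<longlonglongrightarrow> 0"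
      by (intro tendsto_mult_right_zero tendsto_rabs_zero y0)
    have "\<forall>\<^sub>F k in sequentially. dist (y k) 0 < 1 / 2" by (rule tendstoD[OF y0]) simp
    with y_bound N_pos show "\<forall>\<^sub>F k in sequentially. norm (sqrt (N k) ^ d * (ln (1 + y k) - y k) / \<nu> k) \<le> 2 * (Kz / r) * \<bar>y k\<bar>"
    proof eventually_elim
      case (elim k)
      have sN: "0 < sqrt (N k) ^ d" using elim(2) by simp
      have "\<bar>ln (1 + y k) - y k\<bar> \<le> 2 * (y k)\<^sup>2"
        by (rule abs_ln_one_plus_x_minus_x_bound) (use elim(3) in simp)
      then have "sqrt (N k) ^ d / \<nu> k * \<bar>ln (1 + y k) - y k\<bar> \<le> sqrt (N k) ^ d / \<nu> k * (2 * (y k)\<^sup>2)"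
        using sN \<nu>(1)[of k] by (intro mult_left_mono) auto
      also have "\<dots> = 2 * \<bar>sqrt (N k) ^ d * y k / \<nu> k\<bar> * \<bar>y k\<bar>"
        using sN \<nu>(1)[of k] by (simp add: abs_mult power2_eq_square)
      also have "\<dots> \<le> 2 * (Kz / r) * \<bar>y k\<bar>"
        using elim(1) by (intro mult_right_mono mult_left_mono) auto
      finally show ?case using sN \<nu>(1)[of k] by (simp add: abs_mult)
    qed
  qed
  have "(\<lambda>k. sqrt (N k) ^ d * (ln (1 + y k) - y k) / \<nu> k + (sqrt (N k) ^ d * z k / \<nu> k - m k / \<nu> k / \<pi>0 \<theta>) * (1 / r)) \<longlonglongrightarrow> 0 + 0 * (1 / r)"
    by (intro tendsto_add ln_lim tendsto_mult z_lim tendsto_const)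
  then have lim: "(\<lambda>k. sqrt (N k) ^ d * (ln (1 + y k) - y k) / \<nu> k + (sqrt (N k) ^ d * z k / \<nu> k - m k / \<nu> k / \<pi>0 \<theta>) * (1 / r)) \<longlonglongrightarrow> 0" by simp
  have "\<forall>\<^sub>F k in sequentially. B k > \<beta> / 2" by (rule order_tendstoD(1)[OF B_lim]) (use \<beta> in simp)
  moreover have "\<forall>\<^sub>F k in sequentially. dist (y k) 0 < 1 / 2" by (rule tendstoD[OF y0]) simp
  ultimately have "\<forall>\<^sub>F k in sequentially.
    sqrt (N k) ^ d * (ln (1 + y k) - y k) / \<nu> k + (sqrt (N k) ^ d * z k / \<nu> k - m k / \<nu> k / \<pi>0 \<theta>) * (1 / r)
    = (sqrt (N k) ^ d * (ln (laplace_int k \<pi>1 / laplace_int k \<pi>0) - ln r) - m k / \<pi>1 \<theta>) / \<nu> k"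
    using max N_pos
  proof eventually_elim
    case (elim k)
    have Bk: "0 < B k" using elim(1) \<beta> by linarith
    then have L0: "0 < laplace_int k \<pi>0" using elim(4) by (simp add: B_def zero_less_mult_iff)
    have "set_integrable lborel \<Theta> (\<lambda>u. exp (L k u - L k (T k)) * \<pi>1 u)" "set_integrable lborel \<Theta> (\<lambda>u. exp (L k u - L k (T k)) * \<pi>0 u)"
      using laplace_int_split(2)[OF \<pi>1(1), of k "{}"] laplace_int_split(2)[OF \<pi>0(1), of k "{}"] elim(3) by auto
    then have "laplace_int k q = laplace_int k \<pi>1 - r * laplace_int k \<pi>0"
      unfolding laplace_int_def q_def
      by (simp add: right_diff_distrib mult.left_commute[of _ r] set_integral_diff set_integral_mult_right)
    then have zk: "z k = laplace_int k \<pi>1 / laplace_int k \<pi>0 - r"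
      using L0 elim(4) by (simp add: z_def A_def B_def diff_divide_distrib)
    then have "laplace_int k \<pi>1 / laplace_int k \<pi>0 = r * (1 + y k)" using r by (simp add: y_def field_simps)
    moreover have "0 < 1 + y k" using elim(2) by (simp add: dist_real_def abs_if split: if_splits)
    ultimately have ln: "ln (laplace_int k \<pi>1 / laplace_int k \<pi>0) - ln r = ln (1 + y k)"
      using r by (simp add: ln_mult)
    have \<pi>r: "\<pi>1 \<theta> = r * \<pi>0 \<theta>" using \<pi>0 by (simp add: r_def)
    show ?case unfolding ln using r \<pi>0(2) \<nu>(1)[of k]
      by (simp add: y_def \<pi>r field_simps)
  qed
  with lim have "(\<lambda>k. (sqrt (N k) ^ d * (ln (laplace_int k \<pi>1 / laplace_int k \<pi>0) - ln r) - m k / \<pi>1 \<theta>) / \<nu> k) \<longlonglongrightarrow> 0"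
    by (rule Lim_transform_eventually)
  then show ?thesis unfolding m_def \<nu>_def r_def .
qed

end

section \<open>Sums and measurability of partial derivatives\<close>

lemma eventually_axis_in_open:
  fixes x :: "real^'p"
  assumes "open U" "x \<in> U"
  shows "\<forall>\<^sub>F t in nhds 0. x + t *\<^sub>R axis a 1 \<in> U"
proof -
  have "open ((\<lambda>t. x + t *\<^sub>R axis a 1) -` U)"
    by (intro open_vimage assms continuous_intros)
  from eventually_nhds_in_open[OF this, of 0] assms show ?thesis by simp
qed

lemma partials_cong:
  assumes "open U" "\<And>u. u \<in> U \<Longrightarrow> g u = h u" "x \<in> U"
  shows "partials as g x = partials as h x"
  using assms(3)
proof (induction as arbitrary: x)
  case (Cons a as)
  have "\<forall>\<^sub>F t in nhds 0. x + t *\<^sub>R axis a 1 \<in> U"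
    using assms(1) Cons.prems by (rule eventually_axis_in_open)
  then have "\<forall>\<^sub>F t in nhds 0. partials as g (x + t *\<^sub>R axis a 1) = partials as h (x + t *\<^sub>R axis a 1)"
    by eventually_elim (rule Cons.IH)
  then show ?case by (simp add: deriv_cong_ev)
qed (use assms(2) in simp)

lemma partials_zero: "partials as (\<lambda>_. 0) x = 0"
  by (induction as arbitrary: x) auto

text \<open>Outside the common support every density vanishes, and ln 0 = 0 makes the log density
  identically 0. With this case smooth as well, its derivatives exist for every observation.\<close>

lemma Ck_on_zero:
  assumes "open U" "\<And>u. u \<in> U \<Longrightarrow> g u = 0"
  shows "Ck_on k g U"
proof -
  have eq: "partials as g x = 0" if "x \<in> U" for as x
    using partials_cong[OF assms(1), of g "\<lambda>_. 0" x as] assms(2) that by (simp add: partials_zero)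
  show ?thesis unfolding Ck_on_def
  proof (intro conjI allI impI ballI)
    fix as :: "'a list" and a x assume x: "x \<in> U"
    have "\<forall>\<^sub>F t in nhds 0. x + t *\<^sub>R axis a 1 \<in> U"
      using assms(1) x by (rule eventually_axis_in_open)
    then have "\<forall>\<^sub>F t in nhds 0. partials as g (x + t *\<^sub>R axis a 1) = 0"
      by eventually_elim (rule eq)
    then have "((\<lambda>t. partials as g (x + t *\<^sub>R axis a 1)) has_field_derivative 0) (at 0)"
      using DERIV_cong_ev[of 0 0 "\<lambda>t. partials as g (x + t *\<^sub>R axis a 1)" "\<lambda>_. 0" 0 0] by simp
    then show "(\<lambda>t. partials as g (x + t *\<^sub>R axis a 1)) field_differentiable at 0"
      unfolding field_differentiable_def by blast
  next
    fix as :: "'a list"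
    show "continuous_on U (partials as g)"
      by (subst continuous_on_cong[OF refl eq]) auto
  qed
qed

lemma partials_sum:
  assumes "open U" "\<And>i. i \<in> A \<Longrightarrow> Ck_on k (g i) U" "length as \<le> k" "x \<in> U"
  shows "partials as (\<lambda>u. \<Sum>i\<in>A. g i u) x = (\<Sum>i\<in>A. partials as (g i) x)"
  using assms(3,4)
proof (induction as arbitrary: x)
  case (Cons a as)
  have "\<forall>\<^sub>F t in nhds 0. x + t *\<^sub>R axis a 1 \<in> U"
    using assms(1) Cons.prems(2) by (rule eventually_axis_in_open)
  then have ev: "\<forall>\<^sub>F t in nhds 0. partials as (\<lambda>u. \<Sum>i\<in>A. g i u) (x + t *\<^sub>R axis a 1) = (\<Sum>i\<in>A. partials as (g i) (x + t *\<^sub>R axis a 1))"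
    by eventually_elim (rule Cons.IH, use Cons.prems in auto)
  have "((\<lambda>t. \<Sum>i\<in>A. partials as (g i) (x + t *\<^sub>R axis a 1)) has_real_derivative (\<Sum>i\<in>A. partials (a # as) (g i) x)) (at 0)"
  proof (rule DERIV_sum)
    fix i assume "i \<in> A"
    from partial_has_derivative[OF assms(2)[OF this], of x 0 a as] Cons.prems
    show "((\<lambda>t. partials as (g i) (x + t *\<^sub>R axis a 1)) has_real_derivative partials (a # as) (g i) x) (at 0)"
      by (simp del: partials.simps)
  qed
  from DERIV_imp_deriv[OF this] ev show ?case
    by (simp add: deriv_cong_ev)
qed simp

text \<open>A partial derivative is a pointwise limit of difference quotients along 1 / (m + 1), so
  measurability passes up the order of differentiation.\<close>

lemma partial_measurable:
  fixes g :: "'y \<Rightarrow> real^'p \<Rightarrow> real"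
  assumes U: "open U" "\<And>y. Ck_on k (g y) U" and meas: "\<And>u. u \<in> U \<Longrightarrow> (\<lambda>y. g y u) \<in> borel_measurable M"
    and "length as \<le> k" "u \<in> U"
  shows "(\<lambda>y. partials as (g y) u) \<in> borel_measurable M"
  using assms(4,5)
proof (induction as arbitrary: u)
  case Nil
  then show ?case using meas by simp
next
  case (Cons a as)
  define s where "s m = 1 / real (Suc m)" for m
  have s0: "s \<longlonglongrightarrow> 0" unfolding s_def using LIMSEQ_inverse_real_of_nat by (simp add: inverse_eq_divide)
  have spos: "s m \<noteq> 0" for m by (simp add: s_def)
  \<comment> \<open>The value 0 is taken while the shifted point is outside U, where nothing is
    known about g; for large m it is inside.\<close>
  define D where "D m y = (if u + s m *\<^sub>R axis a 1 \<in> U then (partials as (g y) (u + s m *\<^sub>R axis a 1) - partials as (g y) u) / s m else 0)" for m y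
  have meas_D: "D m \<in> borel_measurable M" for m
  proof (cases "u + s m *\<^sub>R axis a 1 \<in> U")
    case True
    then have "(\<lambda>y. partials as (g y) (u + s m *\<^sub>R axis a 1)) \<in> borel_measurable M" "(\<lambda>y. partials as (g y) u) \<in> borel_measurable M"
      using Cons by auto
    then show ?thesis unfolding D_def using True by simp
  next
    case False
    then show ?thesis unfolding D_def by simp
  qed
  have "(\<lambda>m. D m y) \<longlonglongrightarrow> partials (a # as) (g y) u" for y
  proof -
    have "((\<lambda>t. partials as (g y) (u + t *\<^sub>R axis a 1)) has_real_derivative partials (a # as) (g y) (u + 0 *\<^sub>R axis a 1)) (at 0)"
      by (rule partial_has_derivative[OF U(2)]) (use Cons.prems in auto)
    then have "((\<lambda>h. (partials as (g y) (u + h *\<^sub>R axis a 1) - partials as (g y) u) / h) \<longlongrightarrow> partials (a # as) (g y) u) (at 0)"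
      unfolding DERIV_def by (simp del: partials.simps)
    then have "(\<lambda>m. (partials as (g y) (u + s m *\<^sub>R axis a 1) - partials as (g y) u) / s m) \<longlonglongrightarrow> partials (a # as) (g y) u"
      by (rule filterlim_compose) (intro filterlim_atI s0 always_eventually allI spos)
    moreover have "\<forall>\<^sub>F m in sequentially. u + s m *\<^sub>R axis a 1 \<in> U"
    proof -
      have "(\<lambda>m. u + s m *\<^sub>R axis a 1) \<longlonglongrightarrow> u + 0 *\<^sub>R axis a 1" by (intro tendsto_intros s0)
      then show ?thesis using U(1) Cons.prems by (auto intro: topological_tendstoD)
    qed
    then have "\<forall>\<^sub>F m in sequentially. (partials as (g y) (u + s m *\<^sub>R axis a 1) - partials as (g y) u) / s m = D m y"
      by eventually_elim (simp add: D_def)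
    ultimately show ?thesis by (rule Lim_transform_eventually)
  qed
  then show ?case by (rule borel_measurable_LIMSEQ_real) (rule meas_D)
qed

text \<open>A Caratheodory function is jointly measurable: approximate the continuous argument by the
  first point of a countable dense set that is close enough.\<close>

lemma caratheodory_measurable:
  fixes f :: "'a::euclidean_space \<Rightarrow> 'y \<Rightarrow> real"
  assumes U: "U \<in> sets borel" and meas: "\<And>u. u \<in> U \<Longrightarrow> f u \<in> borel_measurable M"
    and cont: "\<And>y. y \<in> space M \<Longrightarrow> continuous_on U (\<lambda>u. f u y)"
  shows "(\<lambda>(u, y). indicator U u * f u y) \<in> borel_measurable (borel \<Otimes>\<^sub>M M)"
proof (cases "U = {}")
  case False
  obtain D where D: "countable D" "D \<subseteq> U" "U \<subseteq> closure D" using separable by blast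
  have "D \<noteq> {}" using D(3) False by auto
  define e where "e = from_nat_into D"
  have e: "range e = D" unfolding e_def using D(1) \<open>D \<noteq> {}\<close> by simp
  define j where "j n u = (LEAST i. dist u (e i) < 1 / real (Suc n))" for n u
  have ex: "\<exists>i. dist u (e i) < 1 / real (Suc n)" if "u \<in> U" for n u
  proof -
    have "u \<in> closure D" using that D(3) by blast
    then obtain d where "d \<in> D" "dist d u < 1 / real (Suc n)"
      unfolding closure_approachable by (meson zero_less_divide_1_iff of_nat_0_less_iff zero_less_Suc)
    then show ?thesis using e by (metis dist_commute rangeE)
  qed
  have j: "dist u (e (j n u)) < 1 / real (Suc n)" if "u \<in> U" for n u
    unfolding j_def using ex[OF that] by (rule LeastI_ex)
  have eU: "e i \<in> U" for i using e D(2) by blast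
  have [measurable]: "U \<in> sets borel" by fact
  have [measurable]: "j n \<in> borel \<rightarrow>\<^sub>M count_space UNIV" for n unfolding j_def by measurable
  define F where "F n z = indicator U (fst z) * f (e (j n (fst z))) (snd z)" for n and z :: "'a \<times> 'y"
  have "F n \<in> borel_measurable (borel \<Otimes>\<^sub>M M)" for n
  proof -
    have [measurable]: "f (e i) \<in> borel_measurable M" for i by (rule meas[OF eU])
    have "(\<lambda>z. (\<lambda>i z. f (e i) (snd z)) (j n (fst z)) z) \<in> borel_measurable (borel \<Otimes>\<^sub>M M)"
      by (rule measurable_compose_countable) measurable
    then show ?thesis unfolding F_def by measurable
  qed
  moreover have "(\<lambda>n. F n z) \<longlonglongrightarrow> (case z of (u, y) \<Rightarrow> indicator U u * f u y)" if z: "z \<in> space (borel \<Otimes>\<^sub>M M)" for z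
  proof (cases "fst z \<in> U")
    case True
    define u y where "u = fst z" and "y = snd z"
    have "y \<in> space M" using z by (auto simp: y_def space_pair_measure)
    have "(\<lambda>n. e (j n u)) \<longlonglongrightarrow> u"
    proof -
      have "(\<lambda>n. dist (e (j n u)) u) \<longlonglongrightarrow> 0"
      proof (rule Lim_null_comparison[OF always_eventually])
        show "(\<lambda>n. 1 / real (Suc n)) \<longlonglongrightarrow> 0" using LIMSEQ_inverse_real_of_nat by (simp add: inverse_eq_divide)
        show "\<forall>n. norm (dist (e (j n u)) u) \<le> 1 / real (Suc n)"
          using j[of u] True by (simp add: u_def dist_commute less_imp_le)
      qed
      then show ?thesis by (simp only: tendsto_dist_iff[of _ u])
    qed
    then have "(\<lambda>n. f (e (j n u)) y) \<longlonglongrightarrow> f u y"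
      using cont[OF \<open>y \<in> space M\<close>] eU True unfolding continuous_on_sequentially u_def
      by (auto simp: comp_def)
    then show ?thesis using True by (simp add: F_def u_def y_def split_beta)
  next
    case False
    then show ?thesis by (simp add: F_def split_beta)
  qed
  ultimately show ?thesis by (rule borel_measurable_LIMSEQ_metric)
qed simp

section \<open>Laws of large numbers\<close>

locale iid_sequence = obs: prob_space M for M :: "'y measure"
begin

sublocale product_prob_space "\<lambda>_::nat. M" UNIV ..

abbreviation P :: "(nat \<Rightarrow> 'y) measure" where
  "P \<equiv> \<Pi>\<^sub>M _\<in>UNIV. M"

lemma component_measurable [measurable]: "(\<lambda>\<omega>. \<omega> i) \<in> P \<rightarrow>\<^sub>M M"
  by (rule measurable_component_singleton) simp

lemma integral_component:
  fixes h :: "'y \<Rightarrow> real"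
  assumes [measurable]: "h \<in> borel_measurable M"
  shows "(LINT \<omega>|P. h (\<omega> i)) = (LINT y|M. h y)" "integrable P (\<lambda>\<omega>. h (\<omega> i)) \<longleftrightarrow> integrable M h"
proof -
  have d: "distr P M (\<lambda>\<omega>. \<omega> i) = M" by (rule distr_PiM_component) (auto intro: obs.prob_space_axioms)
  show "(LINT \<omega>|P. h (\<omega> i)) = (LINT y|M. h y)"
    using integral_distr[of "\<lambda>\<omega>. \<omega> i" P M h] unfolding d by simp
  show "integrable P (\<lambda>\<omega>. h (\<omega> i)) \<longleftrightarrow> integrable M h"
    using integrable_distr_eq[of "\<lambda>\<omega>. \<omega> i" P M h] unfolding d by simp
qed

lemma integral_component_product:
  fixes h :: "'y \<Rightarrow> real"
  assumes h: "integrable M h" and "i \<noteq> j"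
  shows "(LINT \<omega>|P. h (\<omega> i) * h (\<omega> j)) = (LINT y|M. h y)\<^sup>2"
proof -
  have [measurable]: "h \<in> borel_measurable M" using h by simp
  have "(LINT \<omega>|P. h (\<omega> i) * h (\<omega> j)) = (LINT \<omega>|P. (\<Prod>k\<in>{i,j}. h (restrict \<omega> {i,j} k)))"
    using assms(2) by simp
  also have "\<dots> = (LINT x|(\<Pi>\<^sub>M _\<in>{i,j}. M). (\<Prod>k\<in>{i,j}. h (x k)))"
    by (subst distr_PiM_restrict_finite[symmetric, of "{i,j}"], simp, simp, subst integral_distr) auto
  also have "\<dots> = (\<Prod>k\<in>{i,j}. LINT y|M. h y)"
    by (rule product_integral_prod) (auto intro: h)
  also have "\<dots> = (LINT y|M. h y)\<^sup>2" using assms(2) by (simp add: power2_eq_square)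
  finally show ?thesis .
qed

text \<open>Converse of the strong law (second Borel--Cantelli lemma): the terms of the sequence are
  differences of its partial sums, hence eventually below a multiple of \<open>n\<close>.\<close>

lemma integrable_of_bounded_averages:
  fixes X :: "'y \<Rightarrow> real"
  assumes [measurable]: "X \<in> borel_measurable M"
    and bounded: "AE \<omega> in P. \<forall>\<^sub>F n in sequentially. \<bar>\<Sum>i<n. X (\<omega> i)\<bar> \<le> C * real n"
  shows "integrable M X"
proof -
  \<comment> \<open>A term is a difference of two consecutive partial sums, hence eventually at most
    2 |C| (n + 1) in absolute value. The added 1 keeps K positive.\<close>
  define K where "K = 2 * \<bar>C\<bar> + 1"
  have K: "0 < K" by (simp add: K_def)
  define p where "p n = measure M {y \<in> space M. K * real (Suc n) < \<bar>X y\<bar>}" for n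
  define A where "A m = {\<omega> \<in> space P. \<forall>n\<ge>m. \<bar>X (\<omega> n)\<bar> \<le> K * real (Suc n)}" for m
  have A_meas [measurable]: "A m \<in> sets P" for m unfolding A_def by measurable
  have ae: "AE \<omega> in P. \<exists>m. \<omega> \<in> A m"
    using bounded AE_space
  proof eventually_elim
    case (elim \<omega>)
    then obtain m where m: "\<And>n. m \<le> n \<Longrightarrow> \<bar>\<Sum>i<n. X (\<omega> i)\<bar> \<le> C * real n"
      unfolding eventually_sequentially by blast
    have "\<bar>X (\<omega> n)\<bar> \<le> K * real (Suc n)" if "m \<le> n" for n
    proof -
      have "X (\<omega> n) = (\<Sum>i<Suc n. X (\<omega> i)) - (\<Sum>i<n. X (\<omega> i))" by simp
      then have "\<bar>X (\<omega> n)\<bar> \<le> C * real (Suc n) + C * real n"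
        using m[of n] m[of "Suc n"] that by linarith
      also have "\<dots> \<le> \<bar>C\<bar> * real (Suc n) + \<bar>C\<bar> * real (Suc n)"
        by (intro add_mono mult_mono) auto
      also have "\<dots> \<le> K * real (Suc n)" by (simp add: K_def algebra_simps)
      finally show ?thesis .
    qed
    then show ?case using elim(2) by (auto simp: A_def)
  qed
  \<comment> \<open>The events A m cover almost every sample, so they cannot all be null.\<close>
  have "\<exists>m. measure P (A m) > 0"
  proof (rule ccontr)
    assume "\<not> ?thesis"
    then have "measure P (A m) = 0" for m using measure_nonneg[of P "A m"] by (metis less_eq_real_def)
    then have "A m \<in> null_sets P" for m by (simp add: null_sets_def emeasure_eq_measure)
    then have "(\<Union>m. A m) \<in> null_sets P" by blast
    then have "AE \<omega> in P. \<omega> \<notin> (\<Union>m. A m)" by (rule AE_not_in)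
    with ae have "AE \<omega> in P. False" by eventually_elim blast
    then show False by simp
  qed
  then obtain m where m: "measure P (A m) > 0" by blast
  \<comment> \<open>Independence gives P (A m) \<le> \<Prod> (1 - p n) \<le> exp (- \<Sum> p n) over
    any finite range of n \<ge> m. As P (A m) > 0, the partial sums of p are bounded.\<close>
  have "(\<Sum>n<k. p (n + m)) \<le> - ln (measure P (A m))" for k
  proof -
    have fin: "(\<Prod>n\<in>{m..<m + k}. emeasure M {y \<in> space M. \<bar>X y\<bar> \<le> K * real (Suc n)}) = ennreal (\<Prod>n\<in>{m..<m + k}. 1 - p n)"
    proof -
      have "emeasure M {y \<in> space M. \<bar>X y\<bar> \<le> K * real (Suc n)} = ennreal (1 - p n)" for n
      proof -
        have "{y \<in> space M. \<bar>X y\<bar> \<le> K * real (Suc n)} = space M - {y \<in> space M. K * real (Suc n) < \<bar>X y\<bar>}" by auto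
        then show ?thesis unfolding p_def
          by (simp add: obs.emeasure_eq_measure obs.prob_compl)
      qed
      then show ?thesis by (simp add: prod_ennreal p_def)
    qed
    have "A m \<subseteq> {\<omega> \<in> space P. \<forall>n\<in>{m..<m + k}. \<omega> n \<in> {y \<in> space M. \<bar>X y\<bar> \<le> K * real (Suc n)}}"
      by (auto simp: A_def space_PiM)
    then have "emeasure P (A m) \<le> emeasure P {\<omega> \<in> space P. \<forall>n\<in>{m..<m + k}. \<omega> n \<in> {y \<in> space M. \<bar>X y\<bar> \<le> K * real (Suc n)}}"
      by (rule emeasure_mono) measurable
    also have "\<dots> = ennreal (\<Prod>n\<in>{m..<m + k}. 1 - p n)"
      unfolding fin[symmetric] by (rule emeasure_PiM_Collect) auto
    finally have "measure P (A m) \<le> (\<Prod>n\<in>{m..<m + k}. 1 - p n)"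
      by (simp add: emeasure_eq_measure ennreal_le_iff prod_nonneg p_def)
    also have "\<dots> \<le> (\<Prod>n\<in>{m..<m + k}. exp (- p n))"
      using exp_ge_add_one_self[of "- p _"] by (intro prod_mono) (auto simp: p_def)
    also have "\<dots> = exp (- (\<Sum>n\<in>{m..<m + k}. p n))" by (simp add: exp_sum[symmetric] sum_negf)
    finally have "ln (measure P (A m)) \<le> - (\<Sum>n\<in>{m..<m + k}. p n)"
      using m by (simp add: ln_le_cancel_iff[symmetric] del: ln_le_cancel_iff)
    also have "(\<Sum>n\<in>{m..<m + k}. p n) = (\<Sum>n<k. p (n + m))"
      using sum.shift_bounds_nat_ivl[of p 0 m k] by (simp add: lessThan_atLeast0 add.commute)
    finally show ?thesis by simp
  qed
  then have "summable (\<lambda>n. p (n + m))"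
    by (intro summableI_nonneg_bounded[where x = "- ln (measure P (A m))"]) (auto simp: p_def)
  then have sp: "summable p" by (simp add: summable_iff_shift)
  \<comment> \<open>The number of n with |X y| > K (n + 1) is at least |X y| / K - 1, and its
    expectation is the sum of the tail probabilities p n.\<close>
  have "(\<integral>\<^sup>+y. ennreal (\<bar>X y\<bar> / K) \<partial>M) \<le> (\<integral>\<^sup>+y. 1 + (\<Sum>n. indicator {y \<in> space M. K * real (Suc n) < \<bar>X y\<bar>} y) \<partial>M)"
  proof (rule nn_integral_mono)
    fix y assume y: "y \<in> space M"
    define N where "N = nat \<lceil>\<bar>X y\<bar> / K\<rceil>"
    have N: "\<bar>X y\<bar> / K \<le> real N" unfolding N_def by linarith
    \<comment> \<open>N is a ceiling, so n + 1 < N already implies n + 1 < |X y| / K; this is the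
      reason for N - 1.\<close>
    have "(\<Sum>n<N - 1. indicator {y \<in> space M. K * real (Suc n) < \<bar>X y\<bar>} y) = (\<Sum>n<N - 1. (1::ennreal))"
    proof (rule sum.cong[OF refl])
      fix n assume "n \<in> {..<N - 1}"
      then have "real (Suc n) < \<bar>X y\<bar> / K" unfolding N_def by (simp add: less_diff_conv) linarith
      then have "K * real (Suc n) < \<bar>X y\<bar>" using K by (simp add: field_simps)
      then show "indicator {y \<in> space M. K * real (Suc n) < \<bar>X y\<bar>} y = (1::ennreal)" using y by simp
    qed
    then have "ennreal (real (N - 1)) = (\<Sum>n<N - 1. indicator {y \<in> space M. K * real (Suc n) < \<bar>X y\<bar>} y)"
      by (simp add: ennreal_of_nat_eq_real_of_nat)
    also have "\<dots> \<le> (\<Sum>n. indicator {y \<in> space M. K * real (Suc n) < \<bar>X y\<bar>} y)"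
      by (rule sum_le_suminf) auto
    finally have le: "ennreal (real (N - 1)) \<le> (\<Sum>n. indicator {y \<in> space M. K * real (Suc n) < \<bar>X y\<bar>} y)" .
    have "\<bar>X y\<bar> / K \<le> 1 + real (N - 1)" using N by linarith
    then have "ennreal (\<bar>X y\<bar> / K) \<le> 1 + ennreal (real (N - 1))"
      by (metis ennreal_1 ennreal_leI ennreal_plus of_nat_0_le_iff zero_le_one)
    also have "\<dots> \<le> 1 + (\<Sum>n. indicator {y \<in> space M. K * real (Suc n) < \<bar>X y\<bar>} y)" by (intro add_left_mono le)
    finally show "ennreal (\<bar>X y\<bar> / K) \<le> 1 + (\<Sum>n. indicator {y \<in> space M. K * real (Suc n) < \<bar>X y\<bar>} y)" .
  qed
  also have "\<dots> = 1 + (\<Sum>n. ennreal (p n))"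
  proof -
    have p: "emeasure M {y \<in> space M. K * real (Suc n) < \<bar>X y\<bar>} = ennreal (p n)" for n
      by (simp only: p_def obs.emeasure_eq_measure)
    have "(\<integral>\<^sup>+y. (\<Sum>n. indicator {y \<in> space M. K * real (Suc n) < \<bar>X y\<bar>} y) \<partial>M)
      = (\<Sum>n. \<integral>\<^sup>+y. indicator {y \<in> space M. K * real (Suc n) < \<bar>X y\<bar>} y \<partial>M)"
      by (rule nn_integral_suminf) measurable
    also have "\<dots> = (\<Sum>n. ennreal (p n))"
      unfolding p[symmetric] by (intro suminf_cong nn_integral_indicator) measurable
    finally have "(\<integral>\<^sup>+y. (\<Sum>n. indicator {y \<in> space M. K * real (Suc n) < \<bar>X y\<bar>} y) \<partial>M) = (\<Sum>n. ennreal (p n))" .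
    moreover have "(\<integral>\<^sup>+y. 1 + (\<Sum>n. indicator {y \<in> space M. K * real (Suc n) < \<bar>X y\<bar>} y) \<partial>M)
      = (\<integral>\<^sup>+y. 1 \<partial>M) + (\<integral>\<^sup>+y. (\<Sum>n. indicator {y \<in> space M. K * real (Suc n) < \<bar>X y\<bar>} y) \<partial>M)"
      by (rule nn_integral_add) measurable
    ultimately show ?thesis by (simp only: nn_integral_const obs.emeasure_space_1 mult_1)
  qed
  also have "(\<Sum>n. ennreal (p n)) = ennreal (suminf p)"
    by (rule suminf_ennreal2[OF _ sp]) (simp add: p_def)
  also have "1 + ennreal (suminf p) < \<infinity>" by simp
  finally have fin: "(\<integral>\<^sup>+y. ennreal (\<bar>X y\<bar> / K) \<partial>M) < \<infinity>" .
  have "integrable M (\<lambda>y. X y / K)"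
  proof (rule integrableI_bounded)
    show "(\<integral>\<^sup>+y. ennreal (norm (X y / K)) \<partial>M) < \<infinity>"
      using fin abs_of_pos[OF K] by (simp only: real_norm_def abs_divide)
  qed measurable
  from integrable_mult_right[OF this, of K] show ?thesis using K by simp
qed

text \<open>Either |z| \<le> t or |z| \<le> z^2 / t. This turns a variance bound into a bound in
  L1.\<close>

lemma expectation_abs_le:
  fixes Z :: "(nat \<Rightarrow> 'y) \<Rightarrow> real"
  assumes Z: "integrable P Z" "integrable P (\<lambda>\<omega>. (Z \<omega>)\<^sup>2)" and "0 < t"
  shows "(LINT \<omega>|P. \<bar>Z \<omega>\<bar>) \<le> t + (LINT \<omega>|P. (Z \<omega>)\<^sup>2) / t"
proof -
  have "(LINT \<omega>|P. \<bar>Z \<omega>\<bar>) \<le> (LINT \<omega>|P. t + (Z \<omega>)\<^sup>2 / t)"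
  proof (rule integral_mono)
    show "integrable P (\<lambda>\<omega>. \<bar>Z \<omega>\<bar>)" "integrable P (\<lambda>\<omega>. t + (Z \<omega>)\<^sup>2 / t)" using Z by auto
    fix \<omega>
    show "\<bar>Z \<omega>\<bar> \<le> t + (Z \<omega>)\<^sup>2 / t"
    proof (cases "\<bar>Z \<omega>\<bar> \<le> t")
      case True
      moreover have "0 \<le> (Z \<omega>)\<^sup>2 / t" using \<open>0 < t\<close> by simp
      ultimately show ?thesis by linarith
    next
      case False
      then have "\<bar>Z \<omega>\<bar> * t \<le> \<bar>Z \<omega>\<bar> * \<bar>Z \<omega>\<bar>" by (intro mult_left_mono) auto
      then have "\<bar>Z \<omega>\<bar> \<le> (Z \<omega>)\<^sup>2 / t" using \<open>0 < t\<close> by (simp add: le_divide_eq power2_eq_square)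
      then show ?thesis using \<open>0 < t\<close> by linarith
    qed
  qed
  also have "\<dots> = t + (LINT \<omega>|P. (Z \<omega>)\<^sup>2) / t" using Z by (simp add: P.prob_space)
  finally show ?thesis .
qed

text \<open>Centred independent terms are uncorrelated, so the sum has second moment at most n K^2
  and the average at most K^2 / n.\<close>

lemma bounded_average_L1:
  fixes Y :: "'y \<Rightarrow> real"
  assumes [measurable]: "Y \<in> borel_measurable M" and bound: "\<And>y. \<bar>Y y\<bar> \<le> K" and mean: "(LINT y|M. Y y) = 0"
  shows "(\<lambda>n. LINT \<omega>|P. \<bar>(\<Sum>i<n. Y (\<omega> i)) / real n\<bar>) \<longlonglongrightarrow> 0"
proof (rule tendstoI)
  fix e :: real assume "0 < e"
  have Y: "integrable M Y" by (rule obs.integrable_const_bound[of _ K]) (use bound in auto)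
  have "0 \<le> K" using bound[of undefined] by linarith
  define S where "S n \<omega> = (\<Sum>i<n. Y (\<omega> i))" for n and \<omega> :: "nat \<Rightarrow> 'y"
  have S_meas [measurable]: "S n \<in> borel_measurable P" for n unfolding S_def by measurable
  have S_bound: "\<bar>S n \<omega>\<bar> \<le> real n * K" for n \<omega>
    unfolding S_def using sum_abs[of "\<lambda>i. Y (\<omega> i)" "{..<n}"] sum_mono[of "{..<n}" "\<lambda>i. \<bar>Y (\<omega> i)\<bar>" "\<lambda>_. K"] bound
    by (auto intro: order_trans)
  have S_int: "integrable P (S n)" for n
    by (rule integrable_const_bound[of _ "real n * K"]) (use S_bound in auto)
  have S2_int: "integrable P (\<lambda>\<omega>. (S n \<omega>)\<^sup>2)" for n
    by (rule integrable_const_bound[of _ "(real n * K)\<^sup>2"]) (use power_mono[OF S_bound[of n], where n = 2] in auto)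
  have prod_int: "integrable P (\<lambda>\<omega>. Y (\<omega> i) * Y (\<omega> j))" for i j
    by (rule integrable_const_bound[of _ "K * K"])
       (use bound \<open>0 \<le> K\<close> in \<open>auto simp: abs_mult intro!: AE_I2 mult_mono\<close>)
  have S2: "(LINT \<omega>|P. (S n \<omega>)\<^sup>2) \<le> real n * K\<^sup>2" for n
  proof -
    have "(LINT \<omega>|P. (S n \<omega>)\<^sup>2) = (LINT \<omega>|P. (\<Sum>i<n. \<Sum>j<n. Y (\<omega> i) * Y (\<omega> j)))"
      by (simp add: S_def power2_eq_square sum_product)
    also have "\<dots> = (\<Sum>i<n. \<Sum>j<n. LINT \<omega>|P. Y (\<omega> i) * Y (\<omega> j))"
      by (simp add: prod_int Bochner_Integration.integral_sum)
    also have "\<dots> \<le> (\<Sum>i<n. \<Sum>j<n. if i = j then K\<^sup>2 else 0)"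
    proof (intro sum_mono)
      fix i j
      show "(LINT \<omega>|P. Y (\<omega> i) * Y (\<omega> j)) \<le> (if i = j then K\<^sup>2 else 0)"
      proof (cases "i = j")
        case True
        have "(LINT \<omega>|P. Y (\<omega> i) * Y (\<omega> j)) \<le> (LINT \<omega>|P. K\<^sup>2)"
        proof (rule integral_mono[OF prod_int])
          fix \<omega> show "Y (\<omega> i) * Y (\<omega> j) \<le> K\<^sup>2"
            using power_mono[OF bound[of "\<omega> i"], where n = 2] True by (simp add: power2_eq_square)
        qed simp
        then show ?thesis using True by (simp add: P.prob_space)
      next
        case False
        then show ?thesis using integral_component_product[OF Y False] mean by simp
      qed
    qed
    also have "\<dots> = real n * K\<^sup>2" by simp
    finally show ?thesis .
  qed
  have le: "(LINT \<omega>|P. \<bar>S n \<omega> / real n\<bar>) \<le> e / 2 + 2 * K\<^sup>2 / e / real n" if "0 < n" for n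
  proof -
    have "(LINT \<omega>|P. \<bar>S n \<omega> / real n\<bar>) \<le> e / 2 + (LINT \<omega>|P. (S n \<omega> / real n)\<^sup>2) / (e / 2)"
    proof (rule expectation_abs_le)
      show "integrable P (\<lambda>\<omega>. S n \<omega> / real n)" using S_int by simp
      have "integrable P (\<lambda>\<omega>. (S n \<omega>)\<^sup>2 / (real n)\<^sup>2)" using S2_int by simp
      then show "integrable P (\<lambda>\<omega>. (S n \<omega> / real n)\<^sup>2)" by (simp add: power_divide)
    qed (use \<open>0 < e\<close> in simp)
    also have "(LINT \<omega>|P. (S n \<omega> / real n)\<^sup>2) = (LINT \<omega>|P. (S n \<omega>)\<^sup>2) / (real n)\<^sup>2" by (simp add: power_divide)
    also have "e / 2 + (LINT \<omega>|P. (S n \<omega>)\<^sup>2) / (real n)\<^sup>2 / (e / 2) \<le> e / 2 + real n * K\<^sup>2 / (real n)\<^sup>2 / (e / 2)"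
      using \<open>0 < e\<close> by (intro add_left_mono divide_right_mono S2) auto
    also have "\<dots> = e / 2 + 2 * K\<^sup>2 / e / real n" using that \<open>0 < e\<close> by (simp add: field_simps power2_eq_square)
    finally show ?thesis .
  qed
  have "(\<lambda>n. 2 * K\<^sup>2 / e / real n) \<longlonglongrightarrow> 0" by (rule lim_const_over_n)
  then have "\<forall>\<^sub>F n in sequentially. 2 * K\<^sup>2 / e / real n < e / 2"
    using \<open>0 < e\<close> by (intro order_tendstoD(2)) auto
  with eventually_gt_at_top[of 0] show "\<forall>\<^sub>F n in sequentially. dist (LINT \<omega>|P. \<bar>(\<Sum>i<n. Y (\<omega> i)) / real n\<bar>) 0 < e"
  proof eventually_elim
    case (elim n)
    have "0 \<le> (LINT \<omega>|P. \<bar>S n \<omega> / real n\<bar>)" by simp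
    then show ?case using le[OF elim(1)] elim(2) by (simp add: S_def)
  qed
qed

text \<open>Truncation: the bounded part obeys \<open>bounded_average_L1\<close>, the discarded part
  has a small first moment whatever n is, and the truncated mean is close to the true one. These
  three errors take e / 4 each.\<close>

lemma weak_law_L1:
  fixes X :: "'y \<Rightarrow> real"
  assumes X: "integrable M X"
  shows "(\<lambda>n. LINT \<omega>|P. \<bar>(\<Sum>i<n. X (\<omega> i)) / real n - (LINT y|M. X y)\<bar>) \<longlonglongrightarrow> 0"
    and "integrable P (\<lambda>\<omega>. (\<Sum>i<n. X (\<omega> i)) / real n - (LINT y|M. X y))"
proof -
  have [measurable]: "X \<in> borel_measurable M" using X by simp
  have X_int: "integrable P (\<lambda>\<omega>. X (\<omega> i))" for i using X integral_component(2)[of X i] by simp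
  then show "integrable P (\<lambda>\<omega>. (\<Sum>i<n. X (\<omega> i)) / real n - (LINT y|M. X y))" for n by simp
  show "(\<lambda>n. LINT \<omega>|P. \<bar>(\<Sum>i<n. X (\<omega> i)) / real n - (LINT y|M. X y)\<bar>) \<longlonglongrightarrow> 0"
  proof (rule tendstoI)
    fix e :: real assume "0 < e"
    define t where "t k y = (if \<bar>X y\<bar> \<le> real k then X y else 0)" for k y
    have t_meas [measurable]: "t k \<in> borel_measurable M" for k unfolding t_def by measurable
    have "(\<lambda>k. LINT y|M. \<bar>X y - t k y\<bar>) \<longlonglongrightarrow> (LINT y|M. (0::real))"
    proof (rule integral_dominated_convergence[where w = "\<lambda>y. \<bar>X y\<bar>"])
      show "AE y in M. (\<lambda>k. \<bar>X y - t k y\<bar>) \<longlonglongrightarrow> 0"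
      proof (rule AE_I2)
        fix y
        obtain k0 :: nat where k0: "\<bar>X y\<bar> \<le> real k0" using real_arch_simple by blast
        have "\<forall>\<^sub>F k in sequentially. 0 = \<bar>X y - t k y\<bar>"
          using eventually_ge_at_top[of k0] by eventually_elim (use k0 in \<open>simp add: t_def\<close>)
        then show "(\<lambda>k. \<bar>X y - t k y\<bar>) \<longlonglongrightarrow> 0" by (rule Lim_transform_eventually[OF tendsto_const])
      qed
    qed (use X in \<open>auto simp: t_def intro!: AE_I2\<close>)
    then have "\<forall>\<^sub>F k in sequentially. (LINT y|M. \<bar>X y - t k y\<bar>) < e / 4"
      using \<open>0 < e\<close> by (intro order_tendstoD(2)) auto
    then obtain k where k: "(LINT y|M. \<bar>X y - t k y\<bar>) < e / 4" by (auto simp: eventually_sequentially)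
    have t_bound: "\<bar>t k y\<bar> \<le> real k" for y by (simp add: t_def)
    have t_int: "integrable M (t k)" by (rule obs.integrable_const_bound[of _ "real k"]) (use t_bound in auto)
    define \<mu> where "\<mu> = (LINT y|M. t k y)"
    define \<nu> where "\<nu> = (LINT y|M. X y)"
    have \<mu>\<nu>: "\<bar>\<mu> - \<nu>\<bar> \<le> e / 4"
    proof -
      have "\<bar>\<mu> - \<nu>\<bar> = \<bar>LINT y|M. X y - t k y\<bar>" using X t_int by (simp add: \<mu>_def \<nu>_def abs_minus_commute)
      also have "\<dots> \<le> (LINT y|M. \<bar>X y - t k y\<bar>)" by (rule integral_abs_bound)
      finally show ?thesis using k by linarith
    qed
    define Y where "Y y = t k y - \<mu>" for y
    have Y_meas [measurable]: "Y \<in> borel_measurable M" unfolding Y_def by measurable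
    have Y_int: "integrable P (\<lambda>\<omega>. Y (\<omega> i))" for i
      using t_int integral_component(2)[of Y i] by (simp add: Y_def[abs_def])
    have "(\<lambda>n. LINT \<omega>|P. \<bar>(\<Sum>i<n. Y (\<omega> i)) / real n\<bar>) \<longlonglongrightarrow> 0"
    proof (rule bounded_average_L1[of Y "real k + \<bar>\<mu>\<bar>"])
      show "\<bar>Y y\<bar> \<le> real k + \<bar>\<mu>\<bar>" for y unfolding Y_def using t_bound[of y] by linarith
      show "(LINT y|M. Y y) = 0" unfolding Y_def using t_int by (simp add: \<mu>_def obs.prob_space)
    qed simp
    then have "\<forall>\<^sub>F n in sequentially. (LINT \<omega>|P. \<bar>(\<Sum>i<n. Y (\<omega> i)) / real n\<bar>) < e / 4"
      using \<open>0 < e\<close> by (intro order_tendstoD(2)) auto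
    with eventually_gt_at_top[of 0]
    show "\<forall>\<^sub>F n in sequentially. dist (LINT \<omega>|P. \<bar>(\<Sum>i<n. X (\<omega> i)) / real n - (LINT y|M. X y)\<bar>) 0 < e"
    proof eventually_elim
      case (elim n)
      define W where "W y = X y - t k y" for y
      have W_meas [measurable]: "W \<in> borel_measurable M" unfolding W_def by measurable
      have W_int: "integrable M (\<lambda>y. \<bar>W y\<bar>)" unfolding W_def using X t_int by simp
      have W_int': "integrable P (\<lambda>\<omega>. \<bar>W (\<omega> i)\<bar>)" for i
        using W_int integral_component(2)[of "\<lambda>y. \<bar>W y\<bar>" i] by simp
      have "(LINT \<omega>|P. \<bar>(\<Sum>i<n. X (\<omega> i)) / real n - \<nu>\<bar>)
        \<le> (LINT \<omega>|P. (\<bar>(\<Sum>i<n. Y (\<omega> i)) / real n\<bar> + (\<Sum>i<n. \<bar>W (\<omega> i)\<bar>) / real n) + e / 4)"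
      proof (rule integral_mono)
        show "integrable P (\<lambda>\<omega>. \<bar>(\<Sum>i<n. X (\<omega> i)) / real n - \<nu>\<bar>)" using X_int by simp
        show "integrable P (\<lambda>\<omega>. (\<bar>(\<Sum>i<n. Y (\<omega> i)) / real n\<bar> + (\<Sum>i<n. \<bar>W (\<omega> i)\<bar>) / real n) + e / 4)"
          using Y_int W_int' by simp
        fix \<omega>
        have "(\<Sum>i<n. X (\<omega> i)) = (\<Sum>i<n. Y (\<omega> i)) + (\<Sum>i<n. W (\<omega> i)) + real n * \<mu>"
          by (simp add: Y_def W_def sum.distrib[symmetric] sum_subtractf)
        then have eq: "(\<Sum>i<n. X (\<omega> i)) / real n - \<nu> = (\<Sum>i<n. Y (\<omega> i)) / real n + (\<Sum>i<n. W (\<omega> i)) / real n + (\<mu> - \<nu>)"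
          using elim(1) by (simp add: field_simps)
        have "\<bar>(\<Sum>i<n. W (\<omega> i)) / real n\<bar> \<le> (\<Sum>i<n. \<bar>W (\<omega> i)\<bar>) / real n"
          by (simp add: abs_divide divide_right_mono)
        then show "\<bar>(\<Sum>i<n. X (\<omega> i)) / real n - \<nu>\<bar> \<le> (\<bar>(\<Sum>i<n. Y (\<omega> i)) / real n\<bar> + (\<Sum>i<n. \<bar>W (\<omega> i)\<bar>) / real n) + e / 4"
          unfolding eq using \<mu>\<nu> by linarith
      qed
      also have "\<dots> = (LINT \<omega>|P. \<bar>(\<Sum>i<n. Y (\<omega> i)) / real n\<bar>) + (\<Sum>i<n. LINT \<omega>|P. \<bar>W (\<omega> i)\<bar>) / real n + e / 4"
        using Y_int W_int' by (simp add: P.prob_space)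
      also have "(\<Sum>i<n. LINT \<omega>|P. \<bar>W (\<omega> i)\<bar>) / real n = (LINT y|M. \<bar>W y\<bar>)"
        using integral_component(1)[of "\<lambda>y. \<bar>W y\<bar>"] elim(1) by simp
      also have "(LINT \<omega>|P. \<bar>(\<Sum>i<n. Y (\<omega> i)) / real n\<bar>) + (LINT y|M. \<bar>W y\<bar>) + e / 4 < e"
        using elim(2) k \<open>0 < e\<close> unfolding W_def by linarith
      finally show ?case by (simp add: \<nu>_def dist_real_def)
    qed
  qed
qed

end

section \<open>The statistical model\<close>

lemma prob_space_obs_law:
  assumes "density_family \<Theta> f" "\<theta> \<in> \<Theta>"
  shows "prob_space (obs_law f \<theta>)"
  using assms by (simp add: density_family_def)

locale laplace_model =
  fixes \<Theta> :: "(real^'p) set" and f :: "real^'p \<Rightarrow> 'y::euclidean_space \<Rightarrow> real" and \<theta> :: "real^'p"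
  assumes open_\<Theta>: "open \<Theta>" and \<theta>: "\<theta> \<in> \<Theta>"
    and density: "density_family \<Theta> f" and laplace: "laplace_regular \<Theta> f"
begin

sublocale iid_sequence "obs_law f \<theta>"
  unfolding iid_sequence_def by (rule prob_space_obs_law[OF density \<theta>])

lemma sample_law: "sample_law f \<theta> = P"
  by (simp add: sample_law_def)

lemma sets_obs_law [simp, measurable_cong]: "sets (obs_law f u) = sets borel"
  and space_obs_law [simp]: "space (obs_law f u) = UNIV"
  by (simp_all add: obs_law_def)

lemma f_measurable: "u \<in> \<Theta> \<Longrightarrow> f u \<in> borel_measurable borel"
  and f_nonneg: "u \<in> \<Theta> \<Longrightarrow> 0 \<le> f u y"
  using density by (auto simp: density_family_def)

lemma smooth: "smooth_loglik \<Theta> f"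
  using laplace by (simp add: laplace_regular_def)

lemma f_pos: "u \<in> \<Theta> \<Longrightarrow> y \<in> obs_support \<Theta> f \<Longrightarrow> 0 < f u y"
  using smooth by (simp add: smooth_loglik_def)

lemma f_zero: "u \<in> \<Theta> \<Longrightarrow> y \<notin> obs_support \<Theta> f \<Longrightarrow> f u y = 0"
  using f_nonneg[of u y] by (force simp: obs_support_def)

lemma AE_support: "AE \<omega> in P. \<forall>i. \<omega> i \<in> obs_support \<Theta> f"
  unfolding AE_all_countable
proof
  fix i :: nat
  have "AE y in obs_law f \<theta>. y \<in> obs_support \<Theta> f"
    unfolding obs_law_def using f_measurable[OF \<theta>]
    by (subst AE_density) (use \<theta> in \<open>auto simp: obs_support_def intro!: AE_I2\<close>)
  then show "AE \<omega> in P. \<omega> i \<in> obs_support \<Theta> f"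
    by (intro AE_PiM_component prob_space_obs_law[OF density \<theta>]) auto
qed

lemma Ck_loglik: "(\<And>i. i < n \<Longrightarrow> \<omega> i \<in> obs_support \<Theta> f) \<Longrightarrow> Ck_on 6 (loglik f \<omega> n) \<Theta>"
  using smooth by (simp add: smooth_loglik_def)

text \<open>A sample of size one has the single log density as its log-likelihood.\<close>

lemma Ck_ln: "Ck_on 6 (\<lambda>u. ln (f u y)) \<Theta>"
proof (cases "y \<in> obs_support \<Theta> f")
  case True
  then show ?thesis using Ck_loglik[of 1 "\<lambda>_. y"] by (simp add: loglik_def[abs_def])
next
  case False
  then show ?thesis by (intro Ck_on_zero open_\<Theta>) (simp add: f_zero)
qed

lemma partials_loglik:
  assumes "length as \<le> 6" "u \<in> \<Theta>"
  shows "partials as (loglik f \<omega> n) u = (\<Sum>i<n. partials as (\<lambda>u. ln (f u (\<omega> i))) u)"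
  unfolding loglik_def[abs_def] by (rule partials_sum[OF open_\<Theta> Ck_ln assms])

lemma partials_ln_measurable:
  assumes "length as \<le> 6" "u \<in> \<Theta>"
  shows "(\<lambda>y. partials as (\<lambda>u. ln (f u y)) u) \<in> borel_measurable (obs_law f \<theta>)"
proof (rule partial_measurable[OF open_\<Theta> Ck_ln _ assms])
  show "(\<lambda>y. ln (f u y)) \<in> borel_measurable (obs_law f \<theta>)" if "u \<in> \<Theta>" for u
    using f_measurable[OF that] by simp
qed

text \<open>The limit superior conditions in the form of eventual inequalities. M does not depend on
  the sample, while c may.\<close>

definition good_sample :: "real \<Rightarrow> real \<Rightarrow> (nat \<Rightarrow> 'y) \<Rightarrow> bool" where
  "good_sample \<epsilon> M \<omega> \<longleftrightarrow> (\<forall>i. \<omega> i \<in> obs_support \<Theta> f) \<and>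
     (\<forall>js. length js \<le> 6 \<longrightarrow> (\<forall>\<^sub>F n in sequentially. \<forall>u\<in>ball \<theta> \<epsilon>. \<bar>partials js (loglik f \<omega> n) u\<bar> \<le> M * real n)) \<and>
     (\<forall>\<delta>>0. ball \<theta> \<delta> \<subseteq> \<Theta> \<longrightarrow> (\<exists>c>0. \<forall>\<^sub>F n in sequentially. \<forall>u\<in>\<Theta> - ball \<theta> \<delta>.
        loglik f \<omega> n u - loglik f \<omega> n \<theta> \<le> - c * real n))"

lemma AE_good_sample:
  obtains \<epsilon> M where "0 < \<epsilon>" "ball \<theta> \<epsilon> \<subseteq> \<Theta>" "AE \<omega> in P. good_sample \<epsilon> M \<omega>"
proof -
  obtain \<epsilon> M where \<epsilon>: "0 < \<epsilon>" "ball \<theta> \<epsilon> \<subseteq> \<Theta>" and ae: "AE \<omega> in P.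
    (\<forall>js. length js \<le> 6 \<longrightarrow> limsup (\<lambda>n. SUP u\<in>ball \<theta> \<epsilon>. ereal (\<bar>partials js (loglik f \<omega> n) u\<bar> / real n)) < ereal M) \<and>
    (\<forall>\<delta>>0. ball \<theta> \<delta> \<subseteq> \<Theta> \<longrightarrow> limsup (\<lambda>n. SUP u\<in>\<Theta> - ball \<theta> \<delta>. ereal ((loglik f \<omega> n u - loglik f \<omega> n \<theta>) / real n)) < 0)"
  proof -
    from laplace \<theta> obtain \<epsilon> M \<eta> where "0 < \<epsilon>" "ball \<theta> \<epsilon> \<subseteq> \<Theta>" and
      "AE \<omega> in sample_law f \<theta>.
           (\<forall>js. length js \<le> 6 \<longrightarrow>
              limsup (\<lambda>n. SUP u\<in>ball \<theta> \<epsilon>. ereal (\<bar>partials js (loglik f \<omega> n) u\<bar> / real n)) < ereal M) \<and>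
           ereal \<eta> < liminf (\<lambda>n. INF u\<in>ball \<theta> \<epsilon>. ereal (det ((- 1 / real n) *\<^sub>R hessian (loglik f \<omega> n) u))) \<and>
           (\<forall>\<delta>>0. ball \<theta> \<delta> \<subseteq> \<Theta> \<longrightarrow>
              limsup (\<lambda>n. SUP u\<in>\<Theta> - ball \<theta> \<delta>. ereal ((loglik f \<omega> n u - loglik f \<omega> n \<theta>) / real n)) < 0)"
      unfolding laplace_regular_def by meson
    then show ?thesis using that[of \<epsilon> M] unfolding sample_law
      by (auto elim: AE_mp intro!: AE_I2)
  qed
  have "AE \<omega> in P. good_sample \<epsilon> M \<omega>"
    using ae AE_support
  proof eventually_elim
    case (elim \<omega>)
    have "\<forall>\<^sub>F n in sequentially. \<forall>u\<in>ball \<theta> \<epsilon>. \<bar>partials js (loglik f \<omega> n) u\<bar> \<le> M * real n" if "length js \<le> 6" for js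
    proof -
      have "limsup (\<lambda>n. SUP u\<in>ball \<theta> \<epsilon>. ereal (\<bar>partials js (loglik f \<omega> n) u\<bar> / real n)) < ereal M"
        using elim(1) that by blast
      from Limsup_lessD[OF this] eventually_gt_at_top[of 0] show ?thesis
      proof eventually_elim
        case (elim n)
        show ?case
        proof
          fix u assume "u \<in> ball \<theta> \<epsilon>"
          then have "ereal (\<bar>partials js (loglik f \<omega> n) u\<bar> / real n) \<le> (SUP u\<in>ball \<theta> \<epsilon>. ereal (\<bar>partials js (loglik f \<omega> n) u\<bar> / real n))"
            by (rule SUP_upper)
          then have "ereal (\<bar>partials js (loglik f \<omega> n) u\<bar> / real n) < ereal M" using elim(1) by (rule le_less_trans)
          then show "\<bar>partials js (loglik f \<omega> n) u\<bar> \<le> M * real n" using elim(2) by (simp add: field_simps)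
        qed
      qed
    qed
    moreover have "\<exists>c>0. \<forall>\<^sub>F n in sequentially. \<forall>u\<in>\<Theta> - ball \<theta> \<delta>. loglik f \<omega> n u - loglik f \<omega> n \<theta> \<le> - c * real n"
      if "0 < \<delta>" "ball \<theta> \<delta> \<subseteq> \<Theta>" for \<delta>
    proof -
      have "limsup (\<lambda>n. SUP u\<in>\<Theta> - ball \<theta> \<delta>. ereal ((loglik f \<omega> n u - loglik f \<omega> n \<theta>) / real n)) < 0"
        using elim(1) that by blast
      \<comment> \<open>A strictly negative limit superior leaves room for a real z between it and
        0; the constant c is - z.\<close>
      then obtain z where z: "limsup (\<lambda>n. SUP u\<in>\<Theta> - ball \<theta> \<delta>. ereal ((loglik f \<omega> n u - loglik f \<omega> n \<theta>) / real n)) < ereal z"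
        "ereal z < 0" using ereal_dense2 by blast
      from Limsup_lessD[OF z(1)] eventually_gt_at_top[of 0]
      have "\<forall>\<^sub>F n in sequentially. \<forall>u\<in>\<Theta> - ball \<theta> \<delta>. loglik f \<omega> n u - loglik f \<omega> n \<theta> \<le> - (- z) * real n"
      proof eventually_elim
        case (elim n)
        show ?case
        proof
          fix u assume "u \<in> \<Theta> - ball \<theta> \<delta>"
          then have "ereal ((loglik f \<omega> n u - loglik f \<omega> n \<theta>) / real n) \<le> (SUP u\<in>\<Theta> - ball \<theta> \<delta>. ereal ((loglik f \<omega> n u - loglik f \<omega> n \<theta>) / real n))"
            by (rule SUP_upper)
          then have "ereal ((loglik f \<omega> n u - loglik f \<omega> n \<theta>) / real n) < ereal z" using elim(1) by (rule le_less_trans)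
          then show "loglik f \<omega> n u - loglik f \<omega> n \<theta> \<le> - (- z) * real n" using elim(2) by (simp add: field_simps)
        qed
      qed
      moreover have "0 < - z" using z(2) by simp
      ultimately show ?thesis by blast
    qed
    ultimately show ?case unfolding good_sample_def using elim(2) by blast
  qed
  with \<epsilon> that show ?thesis by blast
qed

text \<open>Laplace regularity bounds averages along almost every sample and does not mention
  expectations. Without integrability the Bochner integral in \<open>fisher_info\<close> would be 0
  by convention and unrelated to the observed Hessians.\<close>

lemma hessian_integrable: "integrable (obs_law f \<theta>) (\<lambda>y. partials [a, b] (\<lambda>u. ln (f u y)) \<theta>)"
proof -
  obtain \<epsilon> M where \<epsilon>: "0 < \<epsilon>" and ae: "AE \<omega> in P. good_sample \<epsilon> M \<omega>" by (rule AE_good_sample)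
  have meas: "(\<lambda>y. partials [a, b] (\<lambda>u. ln (f u y)) \<theta>) \<in> borel_measurable (obs_law f \<theta>)"
    by (rule partials_ln_measurable) (use \<theta> in simp_all)
  have "AE \<omega> in P. \<forall>\<^sub>F n in sequentially. \<bar>\<Sum>i<n. partials [a, b] (\<lambda>u. ln (f u (\<omega> i))) \<theta>\<bar> \<le> M * real n"
    using ae
  proof eventually_elim
    case (elim \<omega>)
    have "\<forall>\<^sub>F n in sequentially. \<forall>u\<in>ball \<theta> \<epsilon>. \<bar>partials [a, b] (loglik f \<omega> n) u\<bar> \<le> M * real n"
      using elim unfolding good_sample_def by (simp del: partials.simps)
    then show ?case
    proof eventually_elim
      case (elim n)
      have "\<theta> \<in> ball \<theta> \<epsilon>" using \<epsilon> by simp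
      with elim have "\<bar>partials [a, b] (loglik f \<omega> n) \<theta>\<bar> \<le> M * real n" by blast
      moreover have "partials [a, b] (loglik f \<omega> n) \<theta> = (\<Sum>i<n. partials [a, b] (\<lambda>u. ln (f u (\<omega> i))) \<theta>)"
        by (rule partials_loglik) (use \<theta> in simp_all)
      ultimately show ?case by (simp only:)
    qed
  qed
  with meas show ?thesis by (rule integrable_of_bounded_averages)
qed

text \<open>All entries are summed into one scalar, so that a single subsequence serves the whole
  matrix.\<close>

definition hessian_error :: "nat \<Rightarrow> (nat \<Rightarrow> 'y) \<Rightarrow> real" where
  "hessian_error n \<omega> = (\<Sum>a\<in>UNIV. \<Sum>b\<in>UNIV. \<bar>partials [a, b] (loglik f \<omega> n) \<theta> / real n + fisher_info f \<theta> $ a $ b\<bar>)"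

lemma hessian_error_L1:
  shows "(\<lambda>n. LINT \<omega>|P. hessian_error n \<omega>) \<longlonglongrightarrow> 0" "integrable P (hessian_error n)"
proof -
  define X where "X a b y = partials [a, b] (\<lambda>u. ln (f u y)) \<theta>" for a b y
  have X: "integrable (obs_law f \<theta>) (X a b)" for a b
    unfolding X_def[abs_def] by (rule hessian_integrable)
  have fisher: "fisher_info f \<theta> $ a $ b = - (LINT y|obs_law f \<theta>. X a b y)" for a b
    by (simp add: fisher_info_def exp_nld_def X_def del: partials.simps)
  have part: "partials [a, b] (loglik f \<omega> n) \<theta> = (\<Sum>i<n. X a b (\<omega> i))" for a b \<omega> n
    unfolding X_def by (rule partials_loglik) (use \<theta> in simp_all)
  have eq: "hessian_error n \<omega> = (\<Sum>a\<in>UNIV. \<Sum>b\<in>UNIV. \<bar>(\<Sum>i<n. X a b (\<omega> i)) / real n - (LINT y|obs_law f \<theta>. X a b y)\<bar>)" for n \<omega>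
    unfolding hessian_error_def part fisher by simp
  have int: "integrable P (\<lambda>\<omega>. \<bar>(\<Sum>i<n. X a b (\<omega> i)) / real n - (LINT y|obs_law f \<theta>. X a b y)\<bar>)" for a b n
    by (intro integrable_abs weak_law_L1(2) X)
  show "integrable P (hessian_error n)" for n
    unfolding eq[abs_def] by (intro Bochner_Integration.integrable_sum int)
  have "(\<lambda>n. \<Sum>a\<in>(UNIV::'p set). \<Sum>b\<in>(UNIV::'p set). LINT \<omega>|P. \<bar>(\<Sum>i<n. X a b (\<omega> i)) / real n - (LINT y|obs_law f \<theta>. X a b y)\<bar>) \<longlonglongrightarrow> 0"
    by (intro tendsto_null_sum weak_law_L1(1) X)
  moreover have "(LINT \<omega>|P. hessian_error n \<omega>) = (\<Sum>a\<in>(UNIV::'p set). \<Sum>b\<in>(UNIV::'p set). LINT \<omega>|P. \<bar>(\<Sum>i<n. X a b (\<omega> i)) / real n - (LINT y|obs_law f \<theta>. X a b y)\<bar>)" for n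
    unfolding eq by (simp add: Bochner_Integration.integral_sum int)
  ultimately show "(\<lambda>n. LINT \<omega>|P. hessian_error n \<omega>) \<longlonglongrightarrow> 0" by simp
qed

lemma hessian_error_subseq:
  fixes s :: "nat \<Rightarrow> nat"
  assumes "strict_mono s"
  shows "\<exists>r. strict_mono r \<and> (AE \<omega> in P. (\<lambda>k. hessian_error (s (r k)) \<omega>) \<longlonglongrightarrow> 0)"
proof -
  have nonneg: "0 \<le> hessian_error n \<omega>" for n \<omega> unfolding hessian_error_def by (intro sum_nonneg) auto
  have "(\<lambda>k. LINT \<omega>|P. norm (hessian_error (s k) \<omega>)) \<longlonglongrightarrow> 0"
    using LIMSEQ_subseq_LIMSEQ[OF hessian_error_L1(1) assms] nonneg by (simp add: comp_def)
  with hessian_error_L1(2) show ?thesis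
    by (rule tendsto_L1_AE_subseq[of P "\<lambda>k. hessian_error (s k)"])
qed

text \<open>The eventual bounds pass to any subsequence; only the convergence of the Hessians
  depends on the choice of s.\<close>

lemma laplace_sequence_subseq:
  assumes inv: "invertible (fisher_info f \<theta>)" and mle: "is_mle \<Theta> f \<theta> T"
    and \<epsilon>: "0 < \<epsilon>" "ball \<theta> \<epsilon> \<subseteq> \<Theta>" and good: "AE \<omega> in P. good_sample \<epsilon> M \<omega>"
    and s: "strict_mono s" and err: "AE \<omega> in P. (\<lambda>k. hessian_error (s k) \<omega>) \<longlonglongrightarrow> 0"
  shows "AE \<omega> in P. laplace_sequence \<Theta> \<theta> (fisher_info f \<theta>) (\<lambda>k. loglik f \<omega> (s k)) (\<lambda>k. real (s k)) (\<lambda>k. T (s k) \<omega>) \<epsilon> M"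
proof -
  have "AE \<omega> in P. \<forall>\<^sub>F n in sequentially. T n \<omega> \<in> \<Theta> \<and> (\<forall>u\<in>\<Theta>. loglik f \<omega> n u \<le> loglik f \<omega> n (T n \<omega>))"
    using mle unfolding is_mle_def sample_law by blast
  with good err show ?thesis
  proof eventually_elim
    case (elim \<omega>)
    show ?case
    proof
      show "open \<Theta>" "\<theta> \<in> \<Theta>" "0 < \<epsilon>" "ball \<theta> \<epsilon> \<subseteq> \<Theta>" "invertible (fisher_info f \<theta>)"
        by (rule open_\<Theta> \<theta> \<epsilon> inv)+
      show "Ck_on 3 (loglik f \<omega> (s k)) \<Theta>" for k
        using elim(1) by (intro Ck_on_mono[OF Ck_loglik]) (auto simp: good_sample_def)
      show "filterlim (\<lambda>k. real (s k)) at_top sequentially"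
        by (rule filterlim_compose[OF filterlim_real_sequentially filterlim_subseq[OF s]])
      have "\<forall>\<^sub>F n in sequentially. \<forall>u\<in>ball \<theta> \<epsilon>. \<bar>partials [a, b, c] (loglik f \<omega> n) u\<bar> \<le> M * real n" for a b c
        using elim(1) unfolding good_sample_def by (simp del: partials.simps)
      then have "\<forall>\<^sub>F n in sequentially. \<forall>a b c. \<forall>u\<in>ball \<theta> \<epsilon>. \<bar>partials [a, b, c] (loglik f \<omega> n) u\<bar> \<le> M * real n"
        by (intro eventually_all_finite)
      from eventually_subseq[OF s this]
      show "\<forall>\<^sub>F k in sequentially. \<forall>u\<in>ball \<theta> \<epsilon>. \<forall>a b c. \<bar>partials [a, b, c] (loglik f \<omega> (s k)) u\<bar> \<le> M * real (s k)"
        by eventually_elim blast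
      show "(\<lambda>k. partials [a, b] (loglik f \<omega> (s k)) \<theta> / real (s k)) \<longlonglongrightarrow> - fisher_info f \<theta> $ a $ b" for a b
      proof -
        define D where "D k = partials [a, b] (loglik f \<omega> (s k)) \<theta> / real (s k)" for k
        have "\<bar>D k + fisher_info f \<theta> $ a $ b\<bar> \<le> hessian_error (s k) \<omega>" for k
        proof -
          have "\<bar>D k + fisher_info f \<theta> $ a $ b\<bar> \<le> (\<Sum>b\<in>UNIV. \<bar>partials [a, b] (loglik f \<omega> (s k)) \<theta> / real (s k) + fisher_info f \<theta> $ a $ b\<bar>)"
            unfolding D_def by (rule member_le_sum) auto
          also have "\<dots> \<le> hessian_error (s k) \<omega>"
            unfolding hessian_error_def by (rule member_le_sum) (auto intro: sum_nonneg)
          finally show ?thesis .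
        qed
        then have "(\<lambda>k. D k + fisher_info f \<theta> $ a $ b) \<longlonglongrightarrow> 0"
          by (intro Lim_null_comparison[OF always_eventually elim(2)]) simp
        from tendsto_diff[OF this tendsto_const[of "fisher_info f \<theta> $ a $ b"]] have "D \<longlonglongrightarrow> - fisher_info f \<theta> $ a $ b"
          by simp
        then show ?thesis unfolding D_def .
      qed
      show "\<exists>c>0. \<forall>\<^sub>F k in sequentially. \<forall>u\<in>\<Theta> - ball \<theta> \<delta>. loglik f \<omega> (s k) u - loglik f \<omega> (s k) \<theta> \<le> - c * real (s k)"
        if \<delta>: "0 < \<delta>" "ball \<theta> \<delta> \<subseteq> \<Theta>" for \<delta>
      proof -
        obtain c where "0 < c" and c: "\<forall>\<^sub>F n in sequentially. \<forall>u\<in>\<Theta> - ball \<theta> \<delta>. loglik f \<omega> n u - loglik f \<omega> n \<theta> \<le> - c * real n"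
          using elim(1) \<delta> unfolding good_sample_def by blast
        from eventually_subseq[OF s c] \<open>0 < c\<close> show ?thesis by blast
      qed
      show "\<forall>\<^sub>F k in sequentially. T (s k) \<omega> \<in> \<Theta> \<and> (\<forall>u\<in>\<Theta>. loglik f \<omega> (s k) u \<le> loglik f \<omega> (s k) (T (s k) \<omega>))"
        by (rule eventually_subseq[OF s elim(3)])
    qed
  qed
qed

section \<open>The Bayes factor as a quotient of Laplace integrals, and its measurability\<close>

lemma likelihood_eq_exp:
  assumes "\<And>i. i < n \<Longrightarrow> \<omega> i \<in> obs_support \<Theta> f" "u \<in> \<Theta>"
  shows "likelihood f \<omega> n u = exp (loglik f \<omega> n u)"
  using assms by (simp add: likelihood_def loglik_def exp_sum f_pos)

text \<open>The factor exp c is common to both integrals and cancels; c will be the maximal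
  log-likelihood.\<close>

lemma bayes_factor_eq:
  assumes "\<And>i. i < n \<Longrightarrow> \<omega> i \<in> obs_support \<Theta> f"
  shows "bayes_factor \<Theta> f \<pi>1 \<pi>0 \<omega> n =
    (LINT u:\<Theta>|lborel. exp (loglik f \<omega> n u - c) * \<pi>1 u) / (LINT u:\<Theta>|lborel. exp (loglik f \<omega> n u - c) * \<pi>0 u)"
proof -
  have "marginal_likelihood \<Theta> f \<pi> \<omega> n = exp c * (LINT u:\<Theta>|lborel. exp (loglik f \<omega> n u - c) * \<pi> u)" for \<pi>
  proof -
    have "marginal_likelihood \<Theta> f \<pi> \<omega> n = (LINT u:\<Theta>|lborel. exp c * (exp (loglik f \<omega> n u - c) * \<pi> u))"
      unfolding marginal_likelihood_def set_lebesgue_integral_def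
      by (intro Bochner_Integration.integral_cong refl)
         (auto simp: likelihood_eq_exp[OF assms] exp_diff split: split_indicator)
    then show ?thesis by simp
  qed
  then show ?thesis by (simp add: bayes_factor_def)
qed

text \<open>Laws of the Bayes factor are formed with \<open>distr\<close>, which presupposes
  measurability. The density is continuous in the parameter and measurable in the observation, hence
  jointly measurable on \<Theta>, and integrating out the parameter keeps measurability.\<close>

lemma marginal_likelihood_measurable:
  assumes \<pi>: "set_integrable lborel \<Theta> \<pi>"
  shows "(\<lambda>\<omega>. marginal_likelihood \<Theta> f \<pi> \<omega> n) \<in> borel_measurable P"
proof -
  have [measurable]: "\<Theta> \<in> sets borel" using open_\<Theta> by simp
  have \<pi>_meas [measurable]: "(\<lambda>u. indicator \<Theta> u * \<pi> u) \<in> borel_measurable borel"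
    using \<pi> borel_measurable_integrable unfolding set_integrable_def by fastforce
  have "(\<lambda>(u, y). indicator \<Theta> u * f u y) \<in> borel_measurable (borel \<Otimes>\<^sub>M obs_law f \<theta>)"
  proof (rule caratheodory_measurable)
    show "f u \<in> borel_measurable (obs_law f \<theta>)" if "u \<in> \<Theta>" for u using f_measurable[OF that] by simp
    show "continuous_on \<Theta> (\<lambda>u. f u y)" for y
    proof (cases "y \<in> obs_support \<Theta> f")
      case True
      have "continuous_on \<Theta> (partials [] (\<lambda>u. ln (f u y)))" by (rule Ck_on_continuous[OF Ck_ln]) simp
      then have "continuous_on \<Theta> (\<lambda>u. exp (ln (f u y)))" by (auto intro!: continuous_intros)
      then show ?thesis by (rule continuous_on_eq) (simp add: f_pos True)
    next
      case False
      have "continuous_on \<Theta> (\<lambda>u. 0::real)" by simp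
      then show ?thesis by (rule continuous_on_eq) (simp add: f_zero False)
    qed
  qed simp
  then have f_meas: "(\<lambda>z. indicator \<Theta> (fst z) * f (fst z) (snd z)) \<in> borel_measurable (borel \<Otimes>\<^sub>M obs_law f \<theta>)"
    by (simp add: split_beta)
  have comp: "(\<lambda>z. indicator \<Theta> (snd z) * f (snd z) (fst z i)) \<in> borel_measurable (P \<Otimes>\<^sub>M lborel)" for i
  proof -
    have "(\<lambda>z. (snd z, fst z i)) \<in> P \<Otimes>\<^sub>M lborel \<rightarrow>\<^sub>M borel \<Otimes>\<^sub>M obs_law f \<theta>" by measurable
    from measurable_compose[OF this f_meas] show ?thesis by simp
  qed
  \<comment> \<open>One indicator per factor makes each factor measurable on the whole product
    space; on \<Theta> they are all 1.\<close>
  have "(\<lambda>z. (\<Prod>i<n. indicator \<Theta> (snd z) * f (snd z) (fst z i)) * (indicator \<Theta> (snd z) * \<pi> (snd z))) \<in> borel_measurable (P \<Otimes>\<^sub>M lborel)"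
    by (intro borel_measurable_times[OF borel_measurable_prod[OF comp]] measurable_compose[OF _ \<pi>_meas]) measurable
  then have "(\<lambda>\<omega>. LINT u|lborel. (\<Prod>i<n. indicator \<Theta> u * f u (\<omega> i)) * (indicator \<Theta> u * \<pi> u)) \<in> borel_measurable P"
    by (intro lborel.borel_measurable_lebesgue_integral) (simp add: split_beta)
  moreover have "marginal_likelihood \<Theta> f \<pi> \<omega> n = (LINT u|lborel. (\<Prod>i<n. indicator \<Theta> u * f u (\<omega> i)) * (indicator \<Theta> u * \<pi> u))" for \<omega>
    unfolding marginal_likelihood_def set_lebesgue_integral_def likelihood_def
    by (intro Bochner_Integration.integral_cong) (auto split: split_indicator)
  ultimately show ?thesis by simp
qed

end

section \<open>Weak convergence from an expansion in probability\<close>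

text \<open>Otherwise infinitely many terms stay at a fixed distance from l, and enumerating them
  gives a subsequence that violates the hypothesis.\<close>

lemma tendsto_by_subsequences:
  fixes a :: "nat \<Rightarrow> real"
  assumes "\<And>s :: nat \<Rightarrow> nat. strict_mono s \<Longrightarrow> \<exists>r. strict_mono r \<and> (\<lambda>k. a (s (r k))) \<longlonglongrightarrow> l"
  shows "a \<longlonglongrightarrow> l"
proof (rule ccontr)
  assume "\<not> ?thesis"
  then obtain e where e: "0 < e" "\<not> (\<forall>\<^sub>F n in sequentially. dist (a n) l < e)"
    unfolding tendsto_iff by blast
  then have "\<exists>\<^sub>F n in sequentially. \<not> dist (a n) l < e" by (simp add: frequently_def)
  then have inf: "infinite {n. \<not> dist (a n) l < e}"
    unfolding cofinite_eq_sequentially[symmetric] frequently_cofinite .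
  define s where "s = enumerate {n. \<not> dist (a n) l < e}"
  have s: "strict_mono s" "\<not> dist (a (s k)) l < e" for k
    unfolding s_def using strict_mono_enumerate[OF inf] enumerate_in_set[OF inf, of k] by auto
  obtain r where r: "strict_mono r" "(\<lambda>k. a (s (r k))) \<longlonglongrightarrow> l" using assms[OF s(1)] by blast
  from tendstoD[OF r(2) e(1)] have "\<forall>\<^sub>F k in sequentially. False" by eventually_elim (use s(2) in blast)
  then show False by simp
qed

text \<open>The error is only controlled relative to \<open>1 + |W|\<^sup>d\<close>; since \<open>W n\<close> converges in law it is
  tight, and the cutoff \<open>h\<close> makes this precise.\<close>

lemma weak_conv_of_expansion:
  fixes W :: "nat \<Rightarrow> 's \<Rightarrow> 'b::euclidean_space" and F :: "'b \<Rightarrow> real"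
  assumes P: "prob_space P" and X [measurable]: "\<And>n. X n \<in> borel_measurable P"
    and W [measurable]: "\<And>n. W n \<in> borel_measurable P"
    and \<mu>: "prob_space \<mu>" "sets \<mu> = sets borel"
    and conv: "converges_in_dist P W \<mu>" and F: "continuous_on UNIV F"
    and expansion: "\<And>s :: nat \<Rightarrow> nat. strict_mono s \<Longrightarrow> \<exists>r. strict_mono r \<and>
      (AE \<omega> in P. (\<lambda>k. (X (s (r k)) \<omega> - F (W (s (r k)) \<omega>)) / (1 + norm (W (s (r k)) \<omega>) ^ d)) \<longlonglongrightarrow> 0)"
  shows "weak_conv_m (\<lambda>n. distr P borel (X n)) (distr \<mu> borel F)"
proof -
  interpret P: prob_space P by fact
  interpret \<mu>: prob_space \<mu> by fact
  have [measurable_cong]: "sets \<mu> = sets borel" by fact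
  have F_meas [measurable]: "F \<in> borel_measurable borel" by (rule borel_measurable_continuous_onI[OF F])
  show ?thesis
  proof (rule integral_cts_step_conv_imp_weak_conv)
    show "real_distribution (distr P borel (X n))" for n by (rule P.real_distribution_distr) measurable
    show "real_distribution (distr \<mu> borel F)" by (rule \<mu>.real_distribution_distr) measurable
    fix x y :: real assume "x < y"
    \<comment> \<open>Piecewise linear steps are enough as test functions. Their uniform continuity
      makes g (X) - g (F W) small as soon as X - F W is, wherever F W lies.\<close>
    define g where "g = cts_step x y"
    have g_uc: "uniformly_continuous_on UNIV g" unfolding g_def by (rule cts_step_uniformly_continuous) fact
    have g_cont: "continuous_on UNIV g" by (rule uniformly_continuous_imp_continuous[OF g_uc])
    have g_meas [measurable]: "g \<in> borel_measurable borel" by (rule borel_measurable_continuous_onI[OF g_cont])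
    have g01: "0 \<le> g t" "g t \<le> 1" for t
      using \<open>x < y\<close> by (auto simp: g_def cts_step_def divide_simps)
    have g_abs: "\<bar>g t\<bar> \<le> 1" for t using g01[of t] by linarith
    have g_diff: "\<bar>g s - g t\<bar> \<le> 1" for s t using g01[of s] g01[of t] by linarith
    have conv_gF: "(\<lambda>n. LINT \<omega>|P. g (F (W n \<omega>))) \<longlonglongrightarrow> (LINT w|\<mu>. g (F w))"
    proof -
      have "continuous_on UNIV (\<lambda>w. g (F w))" using continuous_on_compose2[OF g_cont F] by simp
      moreover have "bounded (range (\<lambda>w. g (F w)))"
        unfolding bounded_iff using g_abs by (intro exI[of _ 1]) auto
      ultimately show ?thesis using conv[unfolded converges_in_dist_def, rule_format, of "\<lambda>w. g (F w)"] by blast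
    qed
    have diff: "(\<lambda>n. (LINT \<omega>|P. g (X n \<omega>)) - (LINT \<omega>|P. g (F (W n \<omega>)))) \<longlonglongrightarrow> 0"
    proof (rule tendstoI)
      fix e :: real assume "0 < e"
      define h where "h R w = max 0 (min 1 (real R + 1 - norm w))" for R :: nat and w :: 'b
      have h01: "0 \<le> h R w" "h R w \<le> 1" for R w by (auto simp: h_def)
      have h_abs: "\<bar>1 - h R w\<bar> \<le> 1" for R w using h01[of R w] by linarith
      have h_cont: "continuous_on UNIV (\<lambda>w. 1 - h R w)" for R unfolding h_def by (intro continuous_intros)
      have h_meas [measurable]: "h R \<in> borel_measurable borel" for R unfolding h_def by measurable
      have "(\<lambda>R. LINT w|\<mu>. 1 - h R w) \<longlonglongrightarrow> (LINT w|\<mu>. (0::real))"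
      proof (rule integral_dominated_convergence[where w = "\<lambda>_. 1"])
        show "AE w in \<mu>. (\<lambda>R. 1 - h R w) \<longlonglongrightarrow> 0"
        proof (rule AE_I2)
          fix w :: 'b
          obtain R0 :: nat where R0: "norm w \<le> real R0" using real_arch_simple by blast
          have "\<forall>\<^sub>F R in sequentially. 0 = 1 - h R w"
            using eventually_ge_at_top[of R0] by eventually_elim (use R0 in \<open>simp add: h_def\<close>)
          then show "(\<lambda>R. 1 - h R w) \<longlonglongrightarrow> 0" by (rule Lim_transform_eventually[OF tendsto_const])
        qed
        show "AE w in \<mu>. norm (1 - h R w) \<le> 1" for R using h_abs by (intro AE_I2) simp
      qed simp_all
      then have "\<forall>\<^sub>F R in sequentially. (LINT w|\<mu>. 1 - h R w) < e / 2"
        using \<open>0 < e\<close> by (intro order_tendstoD(2)) auto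
      \<comment> \<open>R is chosen for the limit law; since 1 - h R is bounded and continuous, the
        convergence of W carries the tail bound to large n.\<close>
      then obtain R where R: "(LINT w|\<mu>. 1 - h R w) < e / 2" by (auto simp: eventually_sequentially)
      have "(\<lambda>n. LINT \<omega>|P. 1 - h R (W n \<omega>)) \<longlonglongrightarrow> (LINT w|\<mu>. 1 - h R w)"
      proof -
        have "bounded (range (\<lambda>w. 1 - h R w))"
          unfolding bounded_iff using h_abs by (intro exI[of _ 1]) auto
        then show ?thesis using conv[unfolded converges_in_dist_def, rule_format, of "\<lambda>w. 1 - h R w"] h_cont by blast
      qed
      from order_tendstoD(2)[OF this R] have tail: "\<forall>\<^sub>F n in sequentially. (LINT \<omega>|P. 1 - h R (W n \<omega>)) < e / 2" .
      \<comment> \<open>The expected difference weighted by the cutoff. What is left out is at most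
        the expectation of 1 - h R, because values of g differ by at most 1.\<close>
      define a where "a n = (LINT \<omega>|P. \<bar>g (X n \<omega>) - g (F (W n \<omega>))\<bar> * h R (W n \<omega>))" for n
      have "a \<longlonglongrightarrow> 0"
      proof (rule tendsto_by_subsequences)
        fix s :: "nat \<Rightarrow> nat" assume "strict_mono s"
        from expansion[OF this] obtain r where r: "strict_mono r" and
          ae: "AE \<omega> in P. (\<lambda>k. (X (s (r k)) \<omega> - F (W (s (r k)) \<omega>)) / (1 + norm (W (s (r k)) \<omega>) ^ d)) \<longlonglongrightarrow> 0" by blast
        have "(\<lambda>k. a (s (r k))) \<longlonglongrightarrow> (LINT \<omega>|P. (0::real))"
          unfolding a_def
        proof (rule integral_dominated_convergence[where w = "\<lambda>_. 1"])
          show "AE \<omega> in P. norm (\<bar>g (X (s (r k)) \<omega>) - g (F (W (s (r k)) \<omega>))\<bar> * h R (W (s (r k)) \<omega>)) \<le> 1" for k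
            using g_diff h01 by (intro AE_I2) (auto simp: abs_mult intro!: mult_le_one)
          show "AE \<omega> in P. (\<lambda>k. \<bar>g (X (s (r k)) \<omega>) - g (F (W (s (r k)) \<omega>))\<bar> * h R (W (s (r k)) \<omega>)) \<longlonglongrightarrow> 0"
            using ae
          proof eventually_elim
            case (elim \<omega>)
            show ?case
            proof (rule tendstoI)
              fix e' :: real assume "0 < e'"
              then obtain \<delta> where \<delta>: "0 < \<delta>" "\<And>s t. dist s t < \<delta> \<Longrightarrow> dist (g s) (g t) < e'"
                using g_uc unfolding uniformly_continuous_on_def by (metis UNIV_I)
              \<comment> \<open>Where h R is nonzero, |W| < R + 1, so the weight 1 + |W|^d is at
                most C.\<close>
              define C where "C = 1 + (real R + 1) ^ d"
              have C: "0 < C" by (simp add: C_def add_pos_nonneg)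
              from tendstoD[OF elim, of "\<delta> / C"] C \<delta>(1)
              have "\<forall>\<^sub>F k in sequentially. \<bar>(X (s (r k)) \<omega> - F (W (s (r k)) \<omega>)) / (1 + norm (W (s (r k)) \<omega>) ^ d)\<bar> < \<delta> / C"
                by simp
              then show "\<forall>\<^sub>F k in sequentially. dist (\<bar>g (X (s (r k)) \<omega>) - g (F (W (s (r k)) \<omega>))\<bar> * h R (W (s (r k)) \<omega>)) 0 < e'"
              proof eventually_elim
                case (elim k)
                define X' W' where "X' = X (s (r k)) \<omega>" and "W' = W (s (r k)) \<omega>"
                show ?case
                proof (cases "norm W' \<le> real R + 1")
                  case True
                  define \<nu> where "\<nu> = 1 + norm W' ^ d"
                  have \<nu>: "0 < \<nu>" "\<nu> \<le> C" using True by (auto simp: \<nu>_def C_def add_pos_nonneg intro!: power_mono)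
                  have "\<bar>X' - F W'\<bar> / \<nu> < \<delta> / C" using elim \<nu>(1) by (simp add: X'_def W'_def \<nu>_def)
                  then have "\<bar>X' - F W'\<bar> < \<delta> / C * \<nu>" using \<nu>(1) by (simp add: pos_divide_less_eq)
                  also have "\<dots> \<le> \<delta> / C * C" using \<nu>(2) \<delta>(1) C by (intro mult_left_mono) auto
                  also have "\<dots> = \<delta>" using C by simp
                  finally have "\<bar>g X' - g (F W')\<bar> < e'" using \<delta>(2)[of X' "F W'"] by (simp add: dist_real_def)
                  moreover have "\<bar>g X' - g (F W')\<bar> * h R W' \<le> \<bar>g X' - g (F W')\<bar>"
                    using h01[of R W'] by (intro mult_left_le) auto
                  ultimately show ?thesis using h01[of R W'] by (simp add: X'_def[symmetric] W'_def[symmetric] abs_mult)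
                next
                  case False
                  then have "h R W' = 0" by (simp add: h_def)
                  then show ?thesis using \<open>0 < e'\<close> by (simp add: W'_def)
                qed
              qed
            qed
          qed
        qed simp_all
        with r show "\<exists>r. strict_mono r \<and> (\<lambda>k. a (s (r k))) \<longlonglongrightarrow> 0" by auto
      qed
      then have "\<forall>\<^sub>F n in sequentially. a n < e / 2" using \<open>0 < e\<close> by (intro order_tendstoD(2)) auto
      with tail show "\<forall>\<^sub>F n in sequentially. dist ((LINT \<omega>|P. g (X n \<omega>)) - (LINT \<omega>|P. g (F (W n \<omega>)))) 0 < e"
      proof eventually_elim
        case (elim n)
        have int: "integrable P (\<lambda>\<omega>. g (X n \<omega>))" "integrable P (\<lambda>\<omega>. g (F (W n \<omega>)))"
          by (rule P.integrable_const_bound[of _ 1]; use g_abs in auto)+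
        have inth: "integrable P (\<lambda>\<omega>. 1 - h R (W n \<omega>))"
          by (rule P.integrable_const_bound[of _ 1]) (use h_abs in auto)
        have inta: "integrable P (\<lambda>\<omega>. \<bar>g (X n \<omega>) - g (F (W n \<omega>))\<bar> * h R (W n \<omega>))"
          by (rule P.integrable_const_bound[of _ 1]) (use g_diff h01 in \<open>auto simp: abs_mult intro!: mult_le_one\<close>)
        have "\<bar>(LINT \<omega>|P. g (X n \<omega>)) - (LINT \<omega>|P. g (F (W n \<omega>)))\<bar> = \<bar>LINT \<omega>|P. g (X n \<omega>) - g (F (W n \<omega>))\<bar>"
          using int by simp
        also have "\<dots> \<le> (LINT \<omega>|P. \<bar>g (X n \<omega>) - g (F (W n \<omega>))\<bar>)" by (rule integral_abs_bound)
        also have "\<dots> \<le> (LINT \<omega>|P. \<bar>g (X n \<omega>) - g (F (W n \<omega>))\<bar> * h R (W n \<omega>) + (1 - h R (W n \<omega>)))"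
        proof (rule integral_mono)
          fix \<omega>
          define u v where "u = \<bar>g (X n \<omega>) - g (F (W n \<omega>))\<bar>" and "v = 1 - h R (W n \<omega>)"
          have "u * v \<le> v" using g_diff h01[of R "W n \<omega>"] by (intro mult_left_le_one_le) (auto simp: u_def v_def)
          then show "\<bar>g (X n \<omega>) - g (F (W n \<omega>))\<bar> \<le> \<bar>g (X n \<omega>) - g (F (W n \<omega>))\<bar> * h R (W n \<omega>) + (1 - h R (W n \<omega>))"
            unfolding u_def[symmetric] by (simp add: v_def algebra_simps)
        qed (use int inth inta in auto)
        also have "\<dots> = a n + (LINT \<omega>|P. 1 - h R (W n \<omega>))"
          unfolding a_def by (rule Bochner_Integration.integral_add[OF inta inth])
        also have "\<dots> < e" using elim by linarith
        finally show ?case by simp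
      qed
    qed
    have "(\<lambda>n. ((LINT \<omega>|P. g (X n \<omega>)) - (LINT \<omega>|P. g (F (W n \<omega>)))) + (LINT \<omega>|P. g (F (W n \<omega>)))) \<longlonglongrightarrow> 0 + (LINT w|\<mu>. g (F w))"
      by (rule tendsto_add[OF diff conv_gF])
    then show "(\<lambda>n. integral\<^sup>L (distr P borel (X n)) (cts_step x y)) \<longlonglongrightarrow> integral\<^sup>L (distr \<mu> borel F) (cts_step x y)"
      unfolding g_def[symmetric] by (simp add: integral_distr)
  qed
qed

section \<open>Expansion of the centred log Bayes factor in probability\<close>

context laplace_model
begin

lemma centred_log_bf_measurable:
  assumes "set_integrable lborel \<Theta> \<pi>1" "set_integrable lborel \<Theta> \<pi>0"
  shows "centred_log_bf \<Theta> f \<pi>1 \<pi>0 \<theta> n \<in> borel_measurable P"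
proof -
  note [measurable] = marginal_likelihood_measurable[OF assms(1)] marginal_likelihood_measurable[OF assms(2)]
  show ?thesis unfolding centred_log_bf_def bayes_factor_def by measurable
qed

text \<open>The Gaussian mean of R (w + x), divided by the prior value, splits into F w and a
  constant c. The latter is also the limit of the scaled bias, so centring by the bias leaves F w.
  The subsequence r is one along which the observed Hessians converge almost surely.\<close>

lemma centred_log_bf_expansion:
  fixes s :: "nat \<Rightarrow> nat"
  assumes inv: "invertible (fisher_info f \<theta>)" and mle: "is_mle \<Theta> f \<theta> T"
    and mass: "measure (mvn (matrix_inv (fisher_info f \<theta>))) UNIV = 1"
    and \<pi>1: "set_integrable lborel \<Theta> \<pi>1" "0 < \<pi>1 \<theta>"
    and \<pi>0: "set_integrable lborel \<Theta> \<pi>0" "0 < \<pi>0 \<theta>" "isCont \<pi>0 \<theta>"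
    and d: "1 \<le> d" "d \<le> 2"
    and R: "R \<in> borel_measurable borel"
    and R_bound: "\<And>h. \<bar>R h\<bar> \<le> C * norm h ^ d"
    and R_scale: "\<And>c h. 0 < c \<Longrightarrow> R (c *\<^sub>R h) = c ^ d * R h"
    and q_R: "\<And>e. 0 < e \<Longrightarrow> \<exists>\<delta>>0. \<forall>h. norm h < \<delta> \<longrightarrow>
      \<bar>(\<pi>1 (\<theta> + h) - \<pi>1 \<theta> / \<pi>0 \<theta> * \<pi>0 (\<theta> + h)) - R h\<bar> \<le> e * norm h ^ d"
    and F: "\<And>w. (LINT x|mvn (matrix_inv (fisher_info f \<theta>)). R (w + x)) / \<pi>1 \<theta> = F w + c"
    and bias: "(\<lambda>n. sqrt (real n) ^ d * bias_term f \<pi>1 \<pi>0 \<theta> n) \<longlonglongrightarrow> c"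
    and W: "\<And>n \<omega>. W n \<omega> = sqrt (real n) *\<^sub>R (T n \<omega> - \<theta>)"
    and s: "strict_mono s"
  shows "\<exists>r. strict_mono r \<and> (AE \<omega> in P. (\<lambda>k. (sqrt (real (s (r k))) ^ d * centred_log_bf \<Theta> f \<pi>1 \<pi>0 \<theta> (s (r k)) \<omega>
      - F (W (s (r k)) \<omega>)) / (1 + norm (W (s (r k)) \<omega>) ^ d)) \<longlonglongrightarrow> 0)"
proof -
  obtain \<epsilon> M where \<epsilon>: "0 < \<epsilon>" "ball \<theta> \<epsilon> \<subseteq> \<Theta>" and good: "AE \<omega> in P. good_sample \<epsilon> M \<omega>" by (rule AE_good_sample)
  obtain r where r: "strict_mono r" and err: "AE \<omega> in P. (\<lambda>k. hessian_error (s (r k)) \<omega>) \<longlonglongrightarrow> 0"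
    using hessian_error_subseq[OF s] by blast
  define \<sigma> where "\<sigma> k = s (r k)" for k
  have \<sigma>: "strict_mono \<sigma>" unfolding \<sigma>_def using s r by (simp add: strict_mono_def)
  have "AE \<omega> in P. laplace_sequence \<Theta> \<theta> (fisher_info f \<theta>) (\<lambda>k. loglik f \<omega> (\<sigma> k)) (\<lambda>k. real (\<sigma> k)) (\<lambda>k. T (\<sigma> k) \<omega>) \<epsilon> M"
    by (rule laplace_sequence_subseq[OF inv mle \<epsilon> good \<sigma>]) (use err in \<open>simp add: \<sigma>_def\<close>)
  with AE_support have "AE \<omega> in P. (\<lambda>k. (sqrt (real (\<sigma> k)) ^ d * centred_log_bf \<Theta> f \<pi>1 \<pi>0 \<theta> (\<sigma> k) \<omega>
      - F (W (\<sigma> k) \<omega>)) / (1 + norm (W (\<sigma> k) \<omega>) ^ d)) \<longlonglongrightarrow> 0"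
  proof eventually_elim
    case (elim \<omega>)
    interpret ls: laplace_sequence \<Theta> \<theta> "fisher_info f \<theta>" "\<lambda>k. loglik f \<omega> (\<sigma> k)" "\<lambda>k. real (\<sigma> k)" "\<lambda>k. T (\<sigma> k) \<omega>" \<epsilon> M
      by (rule elim(2))
    have W': "ls.scaled_error k = W (\<sigma> k) \<omega>" for k by (simp add: ls.scaled_error_def W)
    have bf: "ls.laplace_int k \<pi>1 / ls.laplace_int k \<pi>0 = bayes_factor \<Theta> f \<pi>1 \<pi>0 \<omega> (\<sigma> k)" for k
      unfolding ls.laplace_int_def by (rule bayes_factor_eq[symmetric]) (use elim(1) in simp)
    have "(\<lambda>k. (sqrt (real (\<sigma> k)) ^ d * (ln (ls.laplace_int k \<pi>1 / ls.laplace_int k \<pi>0) - ln (\<pi>1 \<theta> / \<pi>0 \<theta>))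
      - (LINT x|mvn (matrix_inv (fisher_info f \<theta>)). R (ls.scaled_error k + x)) / \<pi>1 \<theta>) / (1 + norm (ls.scaled_error k) ^ d)) \<longlonglongrightarrow> 0"
      by (rule ls.log_ratio_expansion[OF mass \<pi>1 \<pi>0 d R R_bound R_scale q_R])
    then have lim1: "(\<lambda>k. (sqrt (real (\<sigma> k)) ^ d * (ln (bayes_factor \<Theta> f \<pi>1 \<pi>0 \<omega> (\<sigma> k)) - ln (\<pi>1 \<theta> / \<pi>0 \<theta>))
      - (F (W (\<sigma> k) \<omega>) + c)) / (1 + norm (W (\<sigma> k) \<omega>) ^ d)) \<longlonglongrightarrow> 0"
      unfolding bf W' F .
    have "(\<lambda>k. sqrt (real (\<sigma> k)) ^ d * bias_term f \<pi>1 \<pi>0 \<theta> (\<sigma> k)) \<longlonglongrightarrow> c"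
      using LIMSEQ_subseq_LIMSEQ[OF bias \<sigma>] by (simp add: comp_def)
    from tendsto_diff[OF tendsto_const[of c] this]
    have "(\<lambda>k. c - sqrt (real (\<sigma> k)) ^ d * bias_term f \<pi>1 \<pi>0 \<theta> (\<sigma> k)) \<longlonglongrightarrow> 0" by simp
    then have "(\<lambda>k. \<bar>c - sqrt (real (\<sigma> k)) ^ d * bias_term f \<pi>1 \<pi>0 \<theta> (\<sigma> k)\<bar>) \<longlonglongrightarrow> 0" by (rule tendsto_rabs_zero)
    then have lim2: "(\<lambda>k. (c - sqrt (real (\<sigma> k)) ^ d * bias_term f \<pi>1 \<pi>0 \<theta> (\<sigma> k)) / (1 + norm (W (\<sigma> k) \<omega>) ^ d)) \<longlonglongrightarrow> 0"
    proof (rule Lim_null_comparison[rotated], intro always_eventually allI)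
      fix k
      have \<nu>: "1 \<le> 1 + norm (W (\<sigma> k) \<omega>) ^ d" by simp
      then have \<nu>0: "0 < 1 + norm (W (\<sigma> k) \<omega>) ^ d" by linarith
      have "\<bar>z\<bar> / (1 + norm (W (\<sigma> k) \<omega>) ^ d) \<le> \<bar>z\<bar>" for z :: real
        unfolding pos_divide_le_eq[OF \<nu>0] using mult_left_mono[OF \<nu>, of "\<bar>z\<bar>"] by simp
      then show "norm ((c - sqrt (real (\<sigma> k)) ^ d * bias_term f \<pi>1 \<pi>0 \<theta> (\<sigma> k)) / (1 + norm (W (\<sigma> k) \<omega>) ^ d))
        \<le> \<bar>c - sqrt (real (\<sigma> k)) ^ d * bias_term f \<pi>1 \<pi>0 \<theta> (\<sigma> k)\<bar>"
        using \<nu>0 by (simp only: real_norm_def abs_divide abs_of_pos)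
    qed
    have eq: "(sqrt (real (\<sigma> k)) ^ d * centred_log_bf \<Theta> f \<pi>1 \<pi>0 \<theta> (\<sigma> k) \<omega> - F (W (\<sigma> k) \<omega>)) / (1 + norm (W (\<sigma> k) \<omega>) ^ d)
      = (sqrt (real (\<sigma> k)) ^ d * (ln (bayes_factor \<Theta> f \<pi>1 \<pi>0 \<omega> (\<sigma> k)) - ln (\<pi>1 \<theta> / \<pi>0 \<theta>))
      - (F (W (\<sigma> k) \<omega>) + c)) / (1 + norm (W (\<sigma> k) \<omega>) ^ d)
      + (c - sqrt (real (\<sigma> k)) ^ d * bias_term f \<pi>1 \<pi>0 \<theta> (\<sigma> k)) / (1 + norm (W (\<sigma> k) \<omega>) ^ d)" for k
      unfolding add_divide_distrib[symmetric] centred_log_bf_def log_prior_ratio_def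
      by (simp add: algebra_simps)
    show ?case unfolding eq using tendsto_add[OF lim1 lim2] by simp
  qed
  with r show ?thesis unfolding \<sigma>_def by blast
qed

text \<open>Symmetry and semidefiniteness of the information are obtained on almost every sample but
  do not mention the sample, so one good sample is enough.\<close>

lemma gaussian_fisher:
  assumes inv: "invertible (fisher_info f \<theta>)" and mle: "is_mle \<Theta> f \<theta> T"
    and mass: "measure (mvn (matrix_inv (fisher_info f \<theta>))) UNIV = 1"
  shows "gaussian (matrix_inv (fisher_info f \<theta>))"
proof -
  obtain \<epsilon> M where \<epsilon>: "0 < \<epsilon>" "ball \<theta> \<epsilon> \<subseteq> \<Theta>" and good: "AE \<omega> in P. good_sample \<epsilon> M \<omega>" by (rule AE_good_sample)
  obtain r where r: "strict_mono r" and err: "AE \<omega> in P. (\<lambda>k. hessian_error (r k) \<omega>) \<longlonglongrightarrow> 0"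
    using hessian_error_subseq[of "\<lambda>n. n"] by (auto simp: strict_mono_def)
  have "AE \<omega> in P. gaussian (matrix_inv (fisher_info f \<theta>))"
    using laplace_sequence_subseq[OF inv mle \<epsilon> good r err]
  proof eventually_elim
    case (elim \<omega>)
    interpret ls: laplace_sequence \<Theta> \<theta> "fisher_info f \<theta>" "\<lambda>k. loglik f \<omega> (r k)" "\<lambda>k. real (r k)" "\<lambda>k. T (r k) \<omega>" \<epsilon> M
      by (rule elim)
    show ?case by (rule gaussian_matrix_inv[OF ls.I_sym ls.I_psd inv mass])
  qed
  then show ?thesis by simp
qed

end

section \<open>The prior ratio and the bias term\<close>

lemma taylor1_peano:
  assumes "Ck_at k g x" "1 \<le> k" "0 < e"
  shows "\<exists>d>0. \<forall>h. norm h < d \<longrightarrow> \<bar>g (x + h) - (g x + grad g x \<bullet> h)\<bar> \<le> e * norm h"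
proof -
  obtain U where U: "open U" "x \<in> U" "Ck_on k g U" using assms unfolding Ck_at_def by blast
  have "(partials [] g has_derivative (\<lambda>h. \<Sum>a\<in>UNIV. h $ a * partials [a] g x)) (at x)"
    by (rule Ck_on_has_derivative[OF U(1,3,2)]) (use assms in simp)
  then obtain d where d: "0 < d" "\<And>y. norm (y - x) < d \<Longrightarrow> norm (g y - g x - grad g x \<bullet> (y - x)) \<le> e * norm (y - x)"
    using assms(3) unfolding has_derivative_at_alt inner_grad by auto
  show ?thesis
  proof (intro exI[of _ d] conjI allI impI d(1))
    fix h :: "real^'a" assume "norm h < d"
    then show "\<bar>g (x + h) - (g x + grad g x \<bullet> h)\<bar> \<le> e * norm h"
      using d(2)[of "x + h"] by (simp add: algebra_simps)
  qed
qed

lemma log_prior_ratio_derivatives: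
  assumes "\<forall>\<^sub>F u in nhds x. 0 < p u" "\<forall>\<^sub>F u in nhds x. 0 < q u" "Ck_at k p x" "Ck_at k q x" "2 \<le> k"
  shows "partials [a] (log_prior_ratio p q) x = partials [a] p x / p x - partials [a] q x / q x"
    and "partials [a, b] (log_prior_ratio p q) x =
      (partials [a, b] p x * p x - partials [a] p x * partials [b] p x) / (p x)\<^sup>2
      - (partials [a, b] q x * q x - partials [a] q x * partials [b] q x) / (q x)\<^sup>2"
proof -
  obtain U1 where U1: "open U1" "x \<in> U1" "Ck_on k p U1" using assms unfolding Ck_at_def by blast
  obtain U2 where U2: "open U2" "x \<in> U2" "Ck_on k q U2" using assms unfolding Ck_at_def by blast
  obtain U3 where U3: "open U3" "x \<in> U3" "\<And>u. u \<in> U3 \<Longrightarrow> 0 < p u \<and> 0 < q u"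
    using eventually_conj[OF assms(1,2)] unfolding eventually_nhds by blast
  define U where "U = U1 \<inter> U2 \<inter> U3"
  have U: "open U" "x \<in> U" using U1 U2 U3 by (auto simp: U_def)
  have pos: "0 < p u" "0 < q u" if "u \<in> U" for u using that U3 by (auto simp: U_def)
  have Ck: "Ck_on k p U" "Ck_on k q U"
    using Ck_on_mono[OF U1(3) le_refl, of U] Ck_on_mono[OF U2(3) le_refl, of U] by (auto simp: U_def)
  have der: "((\<lambda>t. partials as g (u + t *\<^sub>R axis a 1)) has_real_derivative partials (a # as) g u) (at 0)"
    if "Ck_on k g U" "u \<in> U" "length as < 2" for g as a u
    using partial_has_derivative[OF that(1), of u 0 a as] that assms(5) by (simp del: partials.simps)
  \<comment> \<open>Proved on all of U and not just at x, because it is differentiated once more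
    below.\<close>
  have first: "partials [a] (log_prior_ratio p q) u = partials [a] p u / p u - partials [a] q u / q u" if u: "u \<in> U" for u a
  proof -
    have dp: "((\<lambda>t. p (u + t *\<^sub>R axis a 1)) has_real_derivative partials [a] p u) (at 0)"
      using der[OF Ck(1) u, of "[]"] by simp
    have dq: "((\<lambda>t. q (u + t *\<^sub>R axis a 1)) has_real_derivative partials [a] q u) (at 0)"
      using der[OF Ck(2) u, of "[]"] by simp
    have "((\<lambda>t. ln (p (u + t *\<^sub>R axis a 1)) - ln (q (u + t *\<^sub>R axis a 1))) has_real_derivative
        (1 / p (u + 0 *\<^sub>R axis a 1)) * partials [a] p u - (1 / q (u + 0 *\<^sub>R axis a 1)) * partials [a] q u) (at 0)"
      using pos[OF u] by (intro DERIV_diff DERIV_chain2[OF DERIV_ln_divide dp] DERIV_chain2[OF DERIV_ln_divide dq]) auto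
    then have d: "deriv (\<lambda>t. ln (p (u + t *\<^sub>R axis a 1)) - ln (q (u + t *\<^sub>R axis a 1))) 0 = partials [a] p u / p u - partials [a] q u / q u"
      by (subst DERIV_imp_deriv) (simp_all del: partials.simps)
    have "\<forall>\<^sub>F t in nhds 0. log_prior_ratio p q (u + t *\<^sub>R axis a 1) = ln (p (u + t *\<^sub>R axis a 1)) - ln (q (u + t *\<^sub>R axis a 1))"
      using eventually_axis_in_open[OF U(1) u, of a]
    proof eventually_elim
      case (elim t)
      show ?case using pos[OF elim] by (simp add: log_prior_ratio_def ln_div)
    qed
    then have "deriv (\<lambda>t. log_prior_ratio p q (u + t *\<^sub>R axis a 1)) 0 = deriv (\<lambda>t. ln (p (u + t *\<^sub>R axis a 1)) - ln (q (u + t *\<^sub>R axis a 1))) 0"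
      by (rule deriv_cong_ev) simp
    with d show ?thesis by simp
  qed
  show "partials [a] (log_prior_ratio p q) x = partials [a] p x / p x - partials [a] q x / q x" by (rule first[OF U(2)])
  define D where "D g t = partials [b] g (x + t *\<^sub>R axis a 1) / g (x + t *\<^sub>R axis a 1)" for g t
  have dD: "(D g has_real_derivative (partials [a, b] g x * g x - partials [a] g x * partials [b] g x) / (g x)\<^sup>2) (at 0)"
    if "Ck_on k g U" "0 < g x" for g
  proof -
    have d1: "((\<lambda>t. partials [b] g (x + t *\<^sub>R axis a 1)) has_real_derivative partials [a, b] g x) (at 0)"
      by (rule der[OF that(1) U(2)]) simp
    have d0: "((\<lambda>t. g (x + t *\<^sub>R axis a 1)) has_real_derivative partials [a] g x) (at 0)"
      using der[OF that(1) U(2), of "[]"] by simp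
    show ?thesis unfolding D_def[abs_def]
      by (rule DERIV_cong[OF DERIV_divide[OF d1 d0]]) (use that in \<open>simp_all add: power2_eq_square mult.commute del: partials.simps\<close>)
  qed
  have "\<forall>\<^sub>F t in nhds 0. partials [b] (log_prior_ratio p q) (x + t *\<^sub>R axis a 1) = D p t - D q t"
    using eventually_axis_in_open[OF U, of a] unfolding D_def by eventually_elim (rule first)
  then have "deriv (\<lambda>t. partials [b] (log_prior_ratio p q) (x + t *\<^sub>R axis a 1)) 0 = deriv (\<lambda>t. D p t - D q t) 0"
    by (rule deriv_cong_ev) simp
  also have "\<dots> = (partials [a, b] p x * p x - partials [a] p x * partials [b] p x) / (p x)\<^sup>2
      - (partials [a, b] q x * q x - partials [a] q x * partials [b] q x) / (q x)\<^sup>2"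
    by (intro DERIV_imp_deriv DERIV_diff dD Ck pos U(2))
  finally show "partials [a, b] (log_prior_ratio p q) x =
      (partials [a, b] p x * p x - partials [a] p x * partials [b] p x) / (p x)\<^sup>2
      - (partials [a, b] q x * q x - partials [a] q x * partials [b] q x) / (q x)\<^sup>2"
    by (simp only: partials.simps(2)[of a "[b]"])
qed

lemma log_quotient_limits:
  fixes a b c d :: real
  shows "(\<lambda>n. sqrt (real n) * ln ((1 + a / real n + b / (real n)\<^sup>2) / (1 + c / real n + d / (real n)\<^sup>2))) \<longlonglongrightarrow> 0"
    and "(\<lambda>n. real n * ln ((1 + a / real n + b / (real n)\<^sup>2) / (1 + c / real n + d / (real n)\<^sup>2))) \<longlonglongrightarrow> a - c"
proof -
  show "(\<lambda>n. sqrt (real n) * ln ((1 + a / real n + b / (real n)\<^sup>2) / (1 + c / real n + d / (real n)\<^sup>2))) \<longlonglongrightarrow> 0"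
    by real_asymp
  show "(\<lambda>n. real n * ln ((1 + a / real n + b / (real n)\<^sup>2) / (1 + c / real n + d / (real n)\<^sup>2))) \<longlonglongrightarrow> a - c"
    by real_asymp
qed

lemma bias_term_limits:
  shows "(\<lambda>n. sqrt (real n) * bias_term f p q x n) \<longlonglongrightarrow> 0"
    and "(\<lambda>n. real n * bias_term f p q x n) \<longlonglongrightarrow> C1 f p x - C1 f q x"
  unfolding bias_term_def by (rule log_quotient_limits)+

text \<open>Terms in h alone are the same for both priors, and the mixed term sees the prior only
  through its logarithmic gradient, on which the two priors agree.\<close>

lemma C1_diff:
  assumes "\<And>d. partials [d] p x / p x = partials [d] q x / q x" "p x \<noteq> 0" "q x \<noteq> 0"
  shows "C1 f p x - C1 f q x =
    (\<Sum>a\<in>UNIV. \<Sum>b\<in>UNIV. (partials [a, b] p x / p x - partials [a, b] q x / q x) / 2 * mvn_moment f x [a, b])"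
proof -
  have eq: "h * partials [d] p x / (6 * p x) = h * partials [d] q x / (6 * q x)" for h d
    using arg_cong[OF assms(1)[of d], of "\<lambda>z. h * z / 6"] by (simp add: field_simps del: partials.simps)
  have "C1 f p x - C1 f q x = (\<Sum>(a,b)\<in>UNIV. partials [a, b] p x / (2 * p x) * mvn_moment f x [a, b])
     - (\<Sum>(a,b)\<in>UNIV. partials [a, b] q x / (2 * q x) * mvn_moment f x [a, b])"
    unfolding C1_def Let_def eq by (simp only: diff_add_eq add_diff_cancel_right)
  also have "\<dots> = (\<Sum>(a,b)\<in>UNIV. (partials [a, b] p x / p x - partials [a, b] q x / q x) / 2 * mvn_moment f x [a, b])"
    unfolding sum_subtractf[symmetric]
    by (intro sum.cong refl) (simp add: split_beta left_diff_distrib diff_divide_distrib mult.commute[of 2] del: partials.simps)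
  also have "\<dots> = (\<Sum>a\<in>UNIV. \<Sum>b\<in>UNIV. (partials [a, b] p x / p x - partials [a, b] q x / q x) / 2 * mvn_moment f x [a, b])"
    by (simp only: sum.cartesian_product UNIV_Times_UNIV)
  finally show ?thesis .
qed

theorem theorem2:
  fixes \<Theta> :: "(real^'p) set"
    and f :: "real^'p \<Rightarrow> 'y::euclidean_space \<Rightarrow> real"
    and \<pi>\<^sub>1 \<pi>\<^sub>0 :: "real^'p \<Rightarrow> real"
    and \<theta> :: "real^'p"
  defines "v \<equiv> grad (log_prior_ratio \<pi>\<^sub>1 \<pi>\<^sub>0) \<theta>"
    and "H \<equiv> hessian (log_prior_ratio \<pi>\<^sub>1 \<pi>\<^sub>0) \<theta>"
    and "J \<equiv> matrix_inv (fisher_info f \<theta>)"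
  assumes "open \<Theta>" and "\<theta> \<in> \<Theta>"
    and "density_family \<Theta> f" and "identifiable \<Theta> f"
    and "laplace_regular \<Theta> f" and "regular_family \<Theta> f"
    and "prior_density \<Theta> \<pi>\<^sub>1" and "prior_density \<Theta> \<pi>\<^sub>0"
    and "\<forall>\<^sub>F u in nhds \<theta>. 0 < \<pi>\<^sub>1 u" and "\<forall>\<^sub>F u in nhds \<theta>. 0 < \<pi>\<^sub>0 u"
    and "Ck_at 4 \<pi>\<^sub>1 \<theta>" and "Ck_at 4 \<pi>\<^sub>0 \<theta>"
  shows "(v \<noteq> 0 \<longrightarrow>
            weak_conv_m
              (\<lambda>n. distr (sample_law f \<theta>) borel
                 (\<lambda>\<omega>. sqrt (real n) * centred_log_bf \<Theta> f \<pi>\<^sub>1 \<pi>\<^sub>0 \<theta> n \<omega>))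
              (density lborel (normal_density 0 (sqrt (v \<bullet> (J *v v))))) \<and>
            (\<lambda>n. sqrt (real n) * bias_term f \<pi>\<^sub>1 \<pi>\<^sub>0 \<theta> n) \<longlonglongrightarrow> 0) \<and>
         (v = 0 \<and> H \<noteq> 0 \<longrightarrow>
            weak_conv_m
              (\<lambda>n. distr (sample_law f \<theta>) borel
                 (\<lambda>\<omega>. real n * centred_log_bf \<Theta> f \<pi>\<^sub>1 \<pi>\<^sub>0 \<theta> n \<omega>))
              (distr (mvn (mat 1)) borel
                 (\<lambda>z. 1 / 2 * (z \<bullet> ((psd_sqrt J ** H ** psd_sqrt J) *v z)))))"
proof -
  interpret laplace_model \<Theta> f \<theta>
    by (rule laplace_model.intro[OF assms(4-6,8)])
  note regular = bspec[OF assms(9)[unfolded regular_family_def] \<open>\<theta> \<in> \<Theta>\<close>]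
  have inv: "invertible (fisher_info f \<theta>)" using regular by blast
  obtain T where mle: "is_mle \<Theta> f \<theta> T" and
    conv: "converges_in_dist P (\<lambda>n \<omega>. sqrt (real n) *\<^sub>R (T n \<omega> - \<theta>)) (mvn J)"
    using regular unfolding J_def sample_law by blast
  define W where "W n \<omega> = sqrt (real n) *\<^sub>R (T n \<omega> - \<theta>)" for n \<omega>
  have [measurable]: "T n \<in> borel_measurable P" for n
    using mle unfolding is_mle_def sample_law by blast
  have W_meas: "W n \<in> borel_measurable P" for n unfolding W_def by measurable
  have W_conv: "converges_in_dist P W (mvn J)" using conv unfolding W_def[abs_def] .
  \<comment> \<open>Weak convergence is tested against the constant function 1.\<close>
  have mass: "measure (mvn J) UNIV = 1"
  proof -
    have "(\<lambda>n. LINT \<omega>|P. (1::real)) \<longlonglongrightarrow> (LINT x|mvn J. 1)"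
      by (rule W_conv[unfolded converges_in_dist_def, rule_format]) (auto simp: image_constant_conv)
    then show ?thesis by (simp add: P.prob_space LIMSEQ_const_iff)
  qed
  interpret g: gaussian J unfolding J_def by (rule gaussian_fisher[OF inv mle mass[unfolded J_def]])

  have int1: "set_integrable lborel \<Theta> \<pi>\<^sub>1" and int0: "set_integrable lborel \<Theta> \<pi>\<^sub>0"
    using assms(10,11) by (auto simp: prior_density_def)
  have pos1: "0 < \<pi>\<^sub>1 \<theta>" and pos0: "0 < \<pi>\<^sub>0 \<theta>"
    using assms(12,13) eventually_nhds_x_imp_x by blast+
  have cont0: "isCont \<pi>\<^sub>0 \<theta>"
  proof -
    obtain U where "open U" "\<theta> \<in> U" "Ck_on 4 \<pi>\<^sub>0 U" using assms(15) unfolding Ck_at_def by blast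
    then show ?thesis using Ck_on_isCont[of U 4 \<pi>\<^sub>0 \<theta> "[]"] by simp
  qed
  define r where "r = \<pi>\<^sub>1 \<theta> / \<pi>\<^sub>0 \<theta>"
  have r: "0 < r" "\<pi>\<^sub>1 \<theta> = r * \<pi>\<^sub>0 \<theta>" using pos1 pos0 by (auto simp: r_def)
  note ratio = log_prior_ratio_derivatives[OF assms(12-15)]
  \<comment> \<open>The gradient of the log ratio is the difference of the logarithmic gradients;
    multiplied by \<open>\<pi>\<^sub>1 \<theta>\<close> it is the gradient of
    \<open>\<pi>\<^sub>1 - r \<pi>\<^sub>0\<close> at \<theta>.\<close>
  have grad_v: "grad \<pi>\<^sub>1 \<theta> - r *\<^sub>R grad \<pi>\<^sub>0 \<theta> = \<pi>\<^sub>1 \<theta> *\<^sub>R v"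
    using pos1 pos0 unfolding v_def
    by (simp add: vec_eq_iff grad_def ratio(1) r_def right_diff_distrib del: partials.simps)
  note centred = centred_log_bf_measurable[OF int1 int0]

  have part1: "weak_conv_m (\<lambda>n. distr P borel (\<lambda>\<omega>. sqrt (real n) * centred_log_bf \<Theta> f \<pi>\<^sub>1 \<pi>\<^sub>0 \<theta> n \<omega>))
    (density lborel (normal_density 0 (sqrt (v \<bullet> (J *v v)))))" if "v \<noteq> 0"
  proof -
    define R where "R h = \<pi>\<^sub>1 \<theta> * (v \<bullet> h)" for h
    have "weak_conv_m (\<lambda>n. distr P borel (\<lambda>\<omega>. sqrt (real n) ^ 1 * centred_log_bf \<Theta> f \<pi>\<^sub>1 \<pi>\<^sub>0 \<theta> n \<omega>)) (distr (mvn J) borel (\<lambda>w. v \<bullet> w))"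
    proof (rule weak_conv_of_expansion[where d = 1, OF P.prob_space_axioms _ W_meas g.prob_space_axioms sets_mvn W_conv])
      show "(\<lambda>\<omega>. sqrt (real n) ^ 1 * centred_log_bf \<Theta> f \<pi>\<^sub>1 \<pi>\<^sub>0 \<theta> n \<omega>) \<in> borel_measurable P" for n
        using centred by measurable
      show "continuous_on UNIV (\<lambda>w. v \<bullet> w)" by (intro continuous_intros)
      fix s :: "nat \<Rightarrow> nat" assume s: "strict_mono s"
      show "\<exists>r. strict_mono r \<and> (AE \<omega> in P. (\<lambda>k. (sqrt (real (s (r k))) ^ 1 * centred_log_bf \<Theta> f \<pi>\<^sub>1 \<pi>\<^sub>0 \<theta> (s (r k)) \<omega>
          - v \<bullet> W (s (r k)) \<omega>) / (1 + norm (W (s (r k)) \<omega>) ^ 1)) \<longlonglongrightarrow> 0)"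
      proof (rule centred_log_bf_expansion[OF inv mle mass[unfolded J_def] int1 pos1 int0 pos0 cont0, where R = R and c = 0 and C = "\<pi>\<^sub>1 \<theta> * norm v", OF _ _ _ _ _ _ _ _ W_def s])
        show "R \<in> borel_measurable borel" unfolding R_def by measurable
        show "\<bar>R h\<bar> \<le> \<pi>\<^sub>1 \<theta> * norm v * norm h ^ 1" for h
          using Cauchy_Schwarz_ineq2[of v h] pos1 by (simp add: R_def abs_mult mult.assoc)
        show "R (c *\<^sub>R h) = c ^ 1 * R h" for c h by (simp add: R_def)
        show "\<exists>\<delta>>0. \<forall>h. norm h < \<delta> \<longrightarrow> \<bar>(\<pi>\<^sub>1 (\<theta> + h) - \<pi>\<^sub>1 \<theta> / \<pi>\<^sub>0 \<theta> * \<pi>\<^sub>0 (\<theta> + h)) - R h\<bar> \<le> e * norm h ^ 1" if "0 < e" for e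
        proof -
          obtain d1 where d1: "0 < d1" "\<And>h. norm h < d1 \<Longrightarrow> \<bar>\<pi>\<^sub>1 (\<theta> + h) - (\<pi>\<^sub>1 \<theta> + grad \<pi>\<^sub>1 \<theta> \<bullet> h)\<bar> \<le> (e / 2) * norm h"
            using taylor1_peano[OF assms(14), of "e / 2"] \<open>0 < e\<close> by auto
          obtain d0 where d0: "0 < d0" "\<And>h. norm h < d0 \<Longrightarrow> \<bar>\<pi>\<^sub>0 (\<theta> + h) - (\<pi>\<^sub>0 \<theta> + grad \<pi>\<^sub>0 \<theta> \<bullet> h)\<bar> \<le> (e / 2 / r) * norm h"
            using taylor1_peano[OF assms(15), of "e / 2 / r"] \<open>0 < e\<close> r(1) by auto
          show ?thesis
          proof (intro exI[of _ "min d1 d0"] conjI allI impI)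
            fix h :: "real^'p" assume h: "norm h < min d1 d0"
            define E1 E0 where "E1 = \<pi>\<^sub>1 (\<theta> + h) - (\<pi>\<^sub>1 \<theta> + grad \<pi>\<^sub>1 \<theta> \<bullet> h)" and "E0 = \<pi>\<^sub>0 (\<theta> + h) - (\<pi>\<^sub>0 \<theta> + grad \<pi>\<^sub>0 \<theta> \<bullet> h)"
            have "R h = grad \<pi>\<^sub>1 \<theta> \<bullet> h - r * (grad \<pi>\<^sub>0 \<theta> \<bullet> h)"
              unfolding R_def using arg_cong[OF grad_v, of "\<lambda>z. z \<bullet> h"] by (simp add: inner_diff_left)
            then have "(\<pi>\<^sub>1 (\<theta> + h) - \<pi>\<^sub>1 \<theta> / \<pi>\<^sub>0 \<theta> * \<pi>\<^sub>0 (\<theta> + h)) - R h = E1 - r * E0"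
              unfolding r_def[symmetric] E1_def E0_def using r(2) by (simp add: algebra_simps)
            also have "\<bar>\<dots>\<bar> \<le> \<bar>E1\<bar> + r * \<bar>E0\<bar>" using r(1) by (metis abs_mult abs_of_pos abs_triangle_ineq4)
            also have "\<dots> \<le> (e / 2) * norm h + r * ((e / 2 / r) * norm h)"
              using h r(1) unfolding E1_def E0_def by (intro add_mono mult_left_mono d1(2) d0(2)) auto
            also have "\<dots> = e * norm h ^ 1" using r(1) by simp
            finally show "\<bar>(\<pi>\<^sub>1 (\<theta> + h) - \<pi>\<^sub>1 \<theta> / \<pi>\<^sub>0 \<theta> * \<pi>\<^sub>0 (\<theta> + h)) - R h\<bar> \<le> e * norm h ^ 1" .
          qed (use d1 d0 in auto)
        qed
        \<comment> \<open>R is linear and x has mean 0, so no constant remains and c = 0.\<close>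
        show "(LINT x|mvn (matrix_inv (fisher_info f \<theta>)). R (w + x)) / \<pi>\<^sub>1 \<theta> = v \<bullet> w + 0" for w
          unfolding R_def J_def[symmetric] using pos1
          by (simp add: inner_add_right g.inner_moments mass)
        show "(\<lambda>n. sqrt (real n) ^ 1 * bias_term f \<pi>\<^sub>1 \<pi>\<^sub>0 \<theta> n) \<longlonglongrightarrow> 0" using bias_term_limits(1) by simp
      qed simp_all
    qed
    then show ?thesis unfolding g.distr_inner(1)[OF that] by simp
  qed

  have part2: "weak_conv_m (\<lambda>n. distr P borel (\<lambda>\<omega>. real n * centred_log_bf \<Theta> f \<pi>\<^sub>1 \<pi>\<^sub>0 \<theta> n \<omega>))
    (distr (mvn (mat 1)) borel (\<lambda>z. 1 / 2 * (z \<bullet> ((psd_sqrt J ** H ** psd_sqrt J) *v z))))" if "v = 0"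
  proof -
    define R where "R h = \<pi>\<^sub>1 \<theta> / 2 * (h \<bullet> (H *v h))" for h
    define c where "c = (\<Sum>a\<in>UNIV. \<Sum>b\<in>UNIV. H $ a $ b * J $ a $ b) / 2"
    have grad_eq: "grad \<pi>\<^sub>1 \<theta> = r *\<^sub>R grad \<pi>\<^sub>0 \<theta>" using grad_v that by simp
    have D: "partials [a] \<pi>\<^sub>1 \<theta> / \<pi>\<^sub>1 \<theta> = partials [a] \<pi>\<^sub>0 \<theta> / \<pi>\<^sub>0 \<theta>" for a
    proof -
      have "partials [a] \<pi>\<^sub>1 \<theta> = r * partials [a] \<pi>\<^sub>0 \<theta>"
        using arg_cong[OF grad_eq, of "\<lambda>z. z $ a"] by (simp add: grad_def del: partials.simps)
      then show ?thesis using r pos0 by (simp del: partials.simps)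
    qed
    \<comment> \<open>By \<open>D\<close> the products of first derivatives agree for the two priors
      and drop out of the Hessian of the log ratio.\<close>
    have H_eq: "H $ a $ b = partials [a, b] \<pi>\<^sub>1 \<theta> / \<pi>\<^sub>1 \<theta> - partials [a, b] \<pi>\<^sub>0 \<theta> / \<pi>\<^sub>0 \<theta>" for a b
    proof -
      have "H $ a $ b = (partials [a, b] \<pi>\<^sub>1 \<theta> / \<pi>\<^sub>1 \<theta> - (partials [a] \<pi>\<^sub>1 \<theta> / \<pi>\<^sub>1 \<theta>) * (partials [b] \<pi>\<^sub>1 \<theta> / \<pi>\<^sub>1 \<theta>))
        - (partials [a, b] \<pi>\<^sub>0 \<theta> / \<pi>\<^sub>0 \<theta> - (partials [a] \<pi>\<^sub>0 \<theta> / \<pi>\<^sub>0 \<theta>) * (partials [b] \<pi>\<^sub>0 \<theta> / \<pi>\<^sub>0 \<theta>))"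
        using pos1 pos0 by (simp add: H_def hessian_def ratio(2) diff_divide_distrib power2_eq_square del: partials.simps)
      then show ?thesis unfolding D by simp
    qed
    have hess_eq: "hessian \<pi>\<^sub>1 \<theta> - r *\<^sub>R hessian \<pi>\<^sub>0 \<theta> = \<pi>\<^sub>1 \<theta> *\<^sub>R H"
      using pos1 pos0 by (simp add: vec_eq_iff H_eq hessian_def r_def right_diff_distrib del: partials.simps)
    have H_quad: "\<exists>K\<ge>0. \<forall>h. \<bar>h \<bullet> (H *v h)\<bar> \<le> K * (norm h)\<^sup>2"
    proof -
      define K where "K = Max (range (\<lambda>(a, b). \<bar>H $ a $ b\<bar>))"
      have K: "\<bar>H $ a $ b\<bar> \<le> K" for a b unfolding K_def by (rule Max_ge) auto
      then have "0 \<le> K" using abs_ge_zero order_trans by blast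
      then show ?thesis using matrix_quadratic_bound[OF K]
        by (intro exI[of _ "K * (real CARD('p))\<^sup>2"]) auto
    qed
    then obtain K where K: "0 \<le> K" "\<And>h. \<bar>h \<bullet> (H *v h)\<bar> \<le> K * (norm h)\<^sup>2" by blast
    have "weak_conv_m (\<lambda>n. distr P borel (\<lambda>\<omega>. sqrt (real n) ^ 2 * centred_log_bf \<Theta> f \<pi>\<^sub>1 \<pi>\<^sub>0 \<theta> n \<omega>)) (distr (mvn J) borel (\<lambda>w. (w \<bullet> (H *v w)) / 2))"
    proof (rule weak_conv_of_expansion[where d = 2, OF P.prob_space_axioms _ W_meas g.prob_space_axioms sets_mvn W_conv])
      show "(\<lambda>\<omega>. sqrt (real n) ^ 2 * centred_log_bf \<Theta> f \<pi>\<^sub>1 \<pi>\<^sub>0 \<theta> n \<omega>) \<in> borel_measurable P" for n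
        using centred by measurable
      show "continuous_on UNIV (\<lambda>w. (w \<bullet> (H *v w)) / 2)" by (intro continuous_intros) auto
      fix s :: "nat \<Rightarrow> nat" assume s: "strict_mono s"
      show "\<exists>r. strict_mono r \<and> (AE \<omega> in P. (\<lambda>k. (sqrt (real (s (r k))) ^ 2 * centred_log_bf \<Theta> f \<pi>\<^sub>1 \<pi>\<^sub>0 \<theta> (s (r k)) \<omega>
          - (W (s (r k)) \<omega> \<bullet> (H *v W (s (r k)) \<omega>)) / 2) / (1 + norm (W (s (r k)) \<omega>) ^ 2)) \<longlonglongrightarrow> 0)"
      proof (rule centred_log_bf_expansion[OF inv mle mass[unfolded J_def] int1 pos1 int0 pos0 cont0, where R = R and c = c and C = "\<pi>\<^sub>1 \<theta> / 2 * K" and F = "\<lambda>w. (w \<bullet> (H *v w)) / 2", OF _ _ _ _ _ _ _ _ W_def s])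
        show "R \<in> borel_measurable borel" unfolding R_def by measurable
        show "\<bar>R h\<bar> \<le> \<pi>\<^sub>1 \<theta> / 2 * K * norm h ^ 2" for h
          using mult_left_mono[OF K(2)[of h], of "\<pi>\<^sub>1 \<theta> / 2"] pos1 by (simp add: R_def abs_mult mult.assoc)
        show "R (c *\<^sub>R h) = c ^ 2 * R h" for c h by (simp add: R_def matrix_vector_mult_scaleR power2_eq_square)
        show "\<exists>\<delta>>0. \<forall>h. norm h < \<delta> \<longrightarrow> \<bar>(\<pi>\<^sub>1 (\<theta> + h) - \<pi>\<^sub>1 \<theta> / \<pi>\<^sub>0 \<theta> * \<pi>\<^sub>0 (\<theta> + h)) - R h\<bar> \<le> e * norm h ^ 2" if "0 < e" for e
        proof -
          obtain d1 where d1: "0 < d1" "\<And>h. norm h < d1 \<Longrightarrow>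
              \<bar>\<pi>\<^sub>1 (\<theta> + h) - (\<pi>\<^sub>1 \<theta> + grad \<pi>\<^sub>1 \<theta> \<bullet> h + (h \<bullet> (hessian \<pi>\<^sub>1 \<theta> *v h)) / 2)\<bar> \<le> (e / 2) * (norm h)\<^sup>2"
            using taylor2_peano[OF assms(14), of "e / 2"] \<open>0 < e\<close> by auto
          obtain d0 where d0: "0 < d0" "\<And>h. norm h < d0 \<Longrightarrow>
              \<bar>\<pi>\<^sub>0 (\<theta> + h) - (\<pi>\<^sub>0 \<theta> + grad \<pi>\<^sub>0 \<theta> \<bullet> h + (h \<bullet> (hessian \<pi>\<^sub>0 \<theta> *v h)) / 2)\<bar> \<le> (e / 2 / r) * (norm h)\<^sup>2"
            using taylor2_peano[OF assms(15), of "e / 2 / r"] \<open>0 < e\<close> r(1) by auto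
          show ?thesis
          proof (intro exI[of _ "min d1 d0"] conjI allI impI)
            fix h :: "real^'p" assume h: "norm h < min d1 d0"
            define E1 E0 where "E1 = \<pi>\<^sub>1 (\<theta> + h) - (\<pi>\<^sub>1 \<theta> + grad \<pi>\<^sub>1 \<theta> \<bullet> h + (h \<bullet> (hessian \<pi>\<^sub>1 \<theta> *v h)) / 2)"
              and "E0 = \<pi>\<^sub>0 (\<theta> + h) - (\<pi>\<^sub>0 \<theta> + grad \<pi>\<^sub>0 \<theta> \<bullet> h + (h \<bullet> (hessian \<pi>\<^sub>0 \<theta> *v h)) / 2)"
            have "R h = (h \<bullet> (hessian \<pi>\<^sub>1 \<theta> *v h)) / 2 - r * (h \<bullet> (hessian \<pi>\<^sub>0 \<theta> *v h)) / 2"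
              unfolding R_def using arg_cong[OF hess_eq, of "\<lambda>A. h \<bullet> (A *v h) / 2"]
              by (simp add: matrix_vector_mult_diff_rdistrib scaleR_matrix_vector_assoc[symmetric] inner_diff_right diff_divide_distrib)
            then have "(\<pi>\<^sub>1 (\<theta> + h) - \<pi>\<^sub>1 \<theta> / \<pi>\<^sub>0 \<theta> * \<pi>\<^sub>0 (\<theta> + h)) - R h = E1 - r * E0"
              unfolding r_def[symmetric] E1_def E0_def using r(2) by (simp add: grad_eq algebra_simps)
            also have "\<bar>\<dots>\<bar> \<le> \<bar>E1\<bar> + r * \<bar>E0\<bar>" using r(1) by (metis abs_mult abs_of_pos abs_triangle_ineq4)
            also have "\<dots> \<le> (e / 2) * (norm h)\<^sup>2 + r * ((e / 2 / r) * (norm h)\<^sup>2)"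
              using h r(1) unfolding E1_def E0_def by (intro add_mono mult_left_mono d1(2) d0(2)) auto
            also have "\<dots> = e * (norm h)\<^sup>2" using r(1) by simp
            finally show "\<bar>(\<pi>\<^sub>1 (\<theta> + h) - \<pi>\<^sub>1 \<theta> / \<pi>\<^sub>0 \<theta> * \<pi>\<^sub>0 (\<theta> + h)) - R h\<bar> \<le> e * (norm h)\<^sup>2" .
          qed (use d1 d0 in auto)
        qed
        show "(LINT x|mvn (matrix_inv (fisher_info f \<theta>)). R (w + x)) / \<pi>\<^sub>1 \<theta> = (w \<bullet> (H *v w)) / 2 + c" for w
          unfolding R_def J_def[symmetric] c_def using pos1
          by (simp add: g.shifted_quadratic_moment add_divide_distrib)
        have moment: "mvn_moment f \<theta> [a, b] = J $ a $ b" for a b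
          unfolding mvn_moment_def J_def[symmetric] using g.component_moments(4)[of a b] by simp
        have "C1 f \<pi>\<^sub>1 \<theta> - C1 f \<pi>\<^sub>0 \<theta> = c"
          using C1_diff[of \<pi>\<^sub>1 \<theta> \<pi>\<^sub>0 f] D pos1 pos0
          unfolding moment H_eq[symmetric] c_def by (simp add: sum_divide_distrib mult.commute)
        then show "(\<lambda>n. sqrt (real n) ^ 2 * bias_term f \<pi>\<^sub>1 \<pi>\<^sub>0 \<theta> n) \<longlonglongrightarrow> c"
          using bias_term_limits(2)[of f \<pi>\<^sub>1 \<pi>\<^sub>0 \<theta>] by simp
      qed simp_all
    qed
    \<comment> \<open>Writing w = S z with S = \<open>psd_sqrt J\<close>, symmetry of S puts one
      square root on each side of H.\<close>
    moreover have "distr (mvn J) borel (\<lambda>w. (w \<bullet> (H *v w)) / 2)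
      = distr (mvn (mat 1)) borel (\<lambda>z. 1 / 2 * (z \<bullet> ((psd_sqrt J ** H ** psd_sqrt J) *v z)))"
    proof -
      have "(psd_sqrt J *v z) \<bullet> (H *v (psd_sqrt J *v z)) = z \<bullet> ((psd_sqrt J ** H ** psd_sqrt J) *v z)" for z
        using transpose_eq_imp_selfadjoint[OF psd_sqrt(1)[OF g.sym g.psd], of z "H *v (psd_sqrt J *v z)"]
        by (simp add: matrix_vector_mul_assoc matrix_mul_assoc)
      then show ?thesis
        by (subst g.mvn_distr) (subst distr_distr, auto simp: comp_def)
    qed
    ultimately show ?thesis by simp
  qed
  show ?thesis unfolding sample_law using part1 part2 bias_term_limits(1) by blast
qed

end
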